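(* (i) For $0<\Delta\le 1$ and $w,z\in\mathbb{C}$, \[ K_{\mathrm{SO(even)},\pi\Delta}(w,z) = \frac{\sin\pi\Delta(z-\overline{w})}{\pi(z-\overline{w})} - \frac{1}{2 + \Delta} \left(\frac{\sin\pi\Delta z}{\pi z}\right) \left( \frac{\sin\pi\Delta \overline{w} }{\pi \overline{w}}\right). \] (ii) For $1<\Delta\le 2$, define the constants $\tau := e^{(2-\Delta)i/4} + i e^{\Delta i/4}$, $a := e^{\Delta i /4} + i e^{(2-\Delta)i/4} - ie^{ \Delta i/4} + \left( \tfrac{2 - \Delta}{4}\right)\tau$, $b := e^{\Delta i/4} + ie^{(2-\Delta) i/4} - e^{(2- \Delta) i/4} + \left( \tfrac{2 - \Delta}{4}\right)\tau$, and the functions of $w\in\mathbb{C}$ \[ C(w) := \frac{-16\pi^2w^2 -4 \pi i w\,e^{2\pi iw}}{1 - 16 \pi^2w^2},\qquad F(w) := \frac{2\cos(\pi(2-\Delta)w) - 8 \pi w \sin(\pi \Delta w)}{1 - 16 \pi^2 w^2}, \] \[ G(w):=\frac{2\cos(\pi \Delta w)+ 4 \pi i w\, e^{- \pi \Delta i w} - e^{\pi (2 -\Delta)i w} }{1 - 16 \pi^2 w^2} - \frac{\sin(\pi (2 - \Delta)w)}{2\pi w (1 - 16 \pi^2 w^2) } + \left( \frac{2 - \Delta}{4}\right)F(w), \] \[ A(w) := \frac{\overline{a}\,\overline{G(\overline{w})} - \overline{b}\,G(w)}{\overline{a} b - a\overline{b}},\quad B(w) := \frac{b\,G(w) - a\,\overline{G(\overline{w})}}{\overline{a}b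 - a \overline{b}},\quad D(w) := \frac12 \big(\tau A(w) + \overline{\tau} B(w) - F(w)\big). \] Then \begin{align*} K_{\mathrm{SO(even)},\pi\Delta}(w,z) &= \frac{\overline{A(w)} \big(i e^{2\pi i z} - 1\big)\big(e^{-\Delta( \pi i z + i/4)} - e^{-(2-\Delta)(\pi i z + i/4)}\big)}{2\pi i z + i/2} \\ &\quad +\frac{\overline{B(w)}\big( -i e^{2\pi i z} - 1\big)\big(e^{-\Delta( \pi i z - i/4)} - e^{-(2-\Delta)(\pi i z - i/4)}\big)}{2\pi i z - i/2} \\ &\quad + \frac{C(\overline{w})\big( e^{\pi \Delta i (z - \overline{w})} - e^{\pi (2-\Delta) i (z - \overline{w})}\big) + \overline{C(w)}\big(-e^{-\pi \Delta i (z-\overline{w})} + e^{-\pi (2 - \Delta) i (z-\overline{w})}\big)}{2\pi i (z-\overline{w})}\\ &\quad + \frac{\overline{D(w)} \, \sin\big(\pi (2-\Delta) z\big)}{\pi z} + \frac{\sin\big(\pi (2-\Delta) (z - \overline{w})\big)}{\pi(z-\overline{w})}, \end{align*} where at $w=\pm 1/(4\pi)$ the formula is interpreted as the appropriate limit (the map $w\mapsto K_{\mathrm{SO(even)},\pi\Delta}(\overline{w},z)$ being entire).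
   Context: $W_{\mathrm{SO(even)}}(x)=1+\frac{\sin 2\pi x}{2\pi x}$. For $\Delta>0$, $\mathcal{H}_{\mathrm{SO(even)},\pi\Delta}$ is the Hilbert space of entire functions $F$ of exponential type at most $\pi\Delta$ with $\int_{\mathbb{R}}|F(x)|^2W_{\mathrm{SO(even)}}(x)\,dx<\infty$, with inner product $\langle F,H\rangle=\int_{\mathbb{R}}F\overline{H}\,W_{\mathrm{SO(even)}}\,dx$. Its reproducing kernel $K_{\mathrm{SO(even)},\pi\Delta}$ is the unique function on $\mathbb{C}\times\mathbb{C}$ with $K(w,\cdot)$ in the space and $F(w)=\langle F,K(w,\cdot)\rangle$ for all $F$ in the space and all $w\in\mathbb{C}$. Removable singularities (e.g. at $z=0$, $z=\overline{w}$) are interpreted by continuity. *)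

theory Defs
  imports "HOL-Analysis.Analysis"
begin

text \<open>Weight W_SO(even)(x) = 1 + sin(2 pi x)/(2 pi x), with its continuous value 2 at x = 0.\<close>
definition W_SO :: "real \<Rightarrow> real" where
  "W_SO x = (if x = 0 then 2 else 1 + sin (2 * pi * x) / (2 * pi * x))"

definition exp_type_le :: "(complex \<Rightarrow> complex) \<Rightarrow> real \<Rightarrow> bool" where
  "exp_type_le F \<sigma> \<longleftrightarrow> F holomorphic_on UNIV \<and>
     (\<forall>\<epsilon>>0. \<exists>C. \<forall>z. cmod (F z) \<le> C * exp ((\<sigma> + \<epsilon>) * cmod z))"

definition H_SO :: "real \<Rightarrow> (complex \<Rightarrow> complex) set" where
  "H_SO \<Delta> = {F. exp_type_le F (pi * \<Delta>) \<and>
     integrable lborel (\<lambda>x::real. (cmod (F (complex_of_real x)))\<^sup>2 * W_SO x)}"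

definition inner_SO :: "(complex \<Rightarrow> complex) \<Rightarrow> (complex \<Rightarrow> complex) \<Rightarrow> complex" where
  "inner_SO F H = (LINT x|lborel. F (complex_of_real x) * cnj (H (complex_of_real x))
                                   * complex_of_real (W_SO x))"

definition is_repr_kernel :: "real \<Rightarrow> (complex \<Rightarrow> complex \<Rightarrow> complex) \<Rightarrow> bool" where
  "is_repr_kernel \<Delta> K \<longleftrightarrow> (\<forall>w. K w \<in> H_SO \<Delta>) \<and>
     (\<forall>F\<in>H_SO \<Delta>. \<forall>w. F w = inner_SO F (K w))"

definition K_SO :: "real \<Rightarrow> complex \<Rightarrow> complex \<Rightarrow> complex" where
  "K_SO \<Delta> = (THE K. is_repr_kernel \<Delta> K)"

definition kform1 :: "real \<Rightarrow> complex \<Rightarrow> complex \<Rightarrow> complex" where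
  "kform1 \<Delta> w z = (let d = complex_of_real \<Delta>; p = complex_of_real pi in
     sin (p * d * (z - cnj w)) / (p * (z - cnj w))
     - 1 / (2 + d) * (sin (p * d * z) / (p * z)) * (sin (p * d * cnj w) / (p * cnj w)))"

definition gen1 :: "complex \<Rightarrow> complex \<Rightarrow> bool" where
  "gen1 w z \<longleftrightarrow> z \<noteq> cnj w \<and> z \<noteq> 0 \<and> w \<noteq> 0"

definition tauc :: "real \<Rightarrow> complex" where
  "tauc \<Delta> = (let d = complex_of_real \<Delta> in exp ((2 - d) * \<i> / 4) + \<i> * exp (d * \<i> / 4))"

definition ac :: "real \<Rightarrow> complex" where
  "ac \<Delta> = (let d = complex_of_real \<Delta> in
     exp (d * \<i> / 4) + \<i> * exp ((2 - d) * \<i> / 4) - \<i> * exp (d * \<i> / 4) + ((2 - d) / 4) * tauc \<Delta>)"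

definition bc :: "real \<Rightarrow> complex" where
  "bc \<Delta> = (let d = complex_of_real \<Delta> in
     exp (d * \<i> / 4) + \<i> * exp ((2 - d) * \<i> / 4) - exp ((2 - d) * \<i> / 4) + ((2 - d) / 4) * tauc \<Delta>)"

definition Cf :: "complex \<Rightarrow> complex" where
  "Cf w = (let p = complex_of_real pi in
     (- 16 * p\<^sup>2 * w\<^sup>2 - 4 * p * \<i> * w * exp (2 * p * \<i> * w)) / (1 - 16 * p\<^sup>2 * w\<^sup>2))"

definition Ff :: "real \<Rightarrow> complex \<Rightarrow> complex" where
  "Ff \<Delta> w = (let d = complex_of_real \<Delta>; p = complex_of_real pi in
     (2 * cos (p * (2 - d) * w) - 8 * p * w * sin (p * d * w)) / (1 - 16 * p\<^sup>2 * w\<^sup>2))"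

definition Gf :: "real \<Rightarrow> complex \<Rightarrow> complex" where
  "Gf \<Delta> w = (let d = complex_of_real \<Delta>; p = complex_of_real pi in
     (2 * cos (p * d * w) + 4 * p * \<i> * w * exp (- p * d * \<i> * w) - exp (p * (2 - d) * \<i> * w))
        / (1 - 16 * p\<^sup>2 * w\<^sup>2)
     - sin (p * (2 - d) * w) / (2 * p * w * (1 - 16 * p\<^sup>2 * w\<^sup>2))
     + ((2 - d) / 4) * Ff \<Delta> w)"

definition Af :: "real \<Rightarrow> complex \<Rightarrow> complex" where
  "Af \<Delta> w = (cnj (ac \<Delta>) * cnj (Gf \<Delta> (cnj w)) - cnj (bc \<Delta>) * Gf \<Delta> w)
              / (cnj (ac \<Delta>) * bc \<Delta> - ac \<Delta> * cnj (bc \<Delta>))"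

definition Bf :: "real \<Rightarrow> complex \<Rightarrow> complex" where
  "Bf \<Delta> w = (bc \<Delta> * Gf \<Delta> w - ac \<Delta> * cnj (Gf \<Delta> (cnj w)))
              / (cnj (ac \<Delta>) * bc \<Delta> - ac \<Delta> * cnj (bc \<Delta>))"

definition Df :: "real \<Rightarrow> complex \<Rightarrow> complex" where
  "Df \<Delta> w = (1 / 2) * (tauc \<Delta> * Af \<Delta> w + cnj (tauc \<Delta>) * Bf \<Delta> w - Ff \<Delta> w)"

definition kform2 :: "real \<Rightarrow> complex \<Rightarrow> complex \<Rightarrow> complex" where
  "kform2 \<Delta> w z = (let d = complex_of_real \<Delta>; p = complex_of_real pi; u = z - cnj w in
       cnj (Af \<Delta> w) * (\<i> * exp (2 * p * \<i> * z) - 1)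
         * (exp (- d * (p * \<i> * z + \<i> / 4)) - exp (- (2 - d) * (p * \<i> * z + \<i> / 4)))
         / (2 * p * \<i> * z + \<i> / 2)
     + cnj (Bf \<Delta> w) * (- \<i> * exp (2 * p * \<i> * z) - 1)
         * (exp (- d * (p * \<i> * z - \<i> / 4)) - exp (- (2 - d) * (p * \<i> * z - \<i> / 4)))
         / (2 * p * \<i> * z - \<i> / 2)
     + (Cf (cnj w) * (exp (p * d * \<i> * u) - exp (p * (2 - d) * \<i> * u))
        + cnj (Cf w) * (- exp (- p * d * \<i> * u) + exp (- p * (2 - d) * \<i> * u)))
         / (2 * p * \<i> * u)
     + cnj (Df \<Delta> w) * sin (p * (2 - d) * z) / (p * z)
     + sin (p * (2 - d) * u) / (p * u))"

text \<open>Points where no denominator in part (ii) vanishes.\<close>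
definition gen2 :: "complex \<Rightarrow> complex \<Rightarrow> bool" where
  "gen2 w z \<longleftrightarrow> (let p = complex_of_real pi in
     z \<noteq> 0 \<and> z \<noteq> cnj w \<and> 2 * p * \<i> * z + \<i> / 2 \<noteq> 0 \<and> 2 * p * \<i> * z - \<i> / 2 \<noteq> 0 \<and>
     w \<noteq> 0 \<and> 1 - 16 * p\<^sup>2 * w\<^sup>2 \<noteq> 0 \<and> 1 - 16 * p\<^sup>2 * (cnj w)\<^sup>2 \<noteq> 0)"

end

theory Submission
  imports Defs "HOL-Probability.Sinc_Integral" "HOL-Complex_Analysis.Complex_Analysis" "HOL-Real_Asymp.Real_Asymp"
begin

text \<open>Since \<open>W = 1 + (1/2) \<integral>\<^sub>-\<^sub>1\<^sup>1 exp (2 \<pi> \<i> s x) ds\<close>, the kernel is the Fourier transform of the density \<open>g\<close> on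
  \<open>[- \<Delta>/2, \<Delta>/2]\<close> solving \<open>g(t) + (1/2) \<integral>\<^bsub>\<bar>s - t\<bar> \<le> 1\<^esub> g(s) ds = exp (- 2 \<pi> \<i> cnj w t)\<close>. Reproduction for functions that
  decay fast on the real line is Fubini together with Fourier inversion by contour integration; a general element of
  the space is dilated and multiplied by a cubed sinc, which is legitimate because Phragmen-Lindelof bounds it by
  \<open>(1 + \<bar>z\<bar>) exp ((\<pi> \<Delta> + \<epsilon>) \<bar>Im z\<bar>)\<close>. The integral equation has a solution for every \<open>w\<close> by a Neumann series, which also
  gives joint continuity of the kernel and hence all limits at removable singularities. Reproducing kernels being
  unique, the formulas follow by exhibiting the solutions \<open>g\<close>: \<open>exp (- 2 \<pi> \<i> cnj w t)\<close> minus a constant for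
  \<open>\<Delta> \<le> 1\<close>, and a function with three exponential pieces for \<open>\<Delta> > 1\<close>.\<close>

section \<open>Phragmen-Lindelof\<close>

text \<open>The integral equation is asked for only on [- \<Delta>/2, \<Delta>/2]. What the moving
  integral produces beyond is invisible to functions of type pi \<Delta>, whose Fourier transforms
  vanish there. At \<Delta> = 1 the window of radius 1 ceases to cover the whole support, which is
  where the two formulas part. Two obstacles shape the argument. \<open>K_SO\<close> is a definite
  description, meaningful only once a kernel exists for all w at once, whereas the closed forms
  break down at zeros of their denominators. So existence comes from the Neumann series for every w,
  and the closed forms are compared with it at one w at a time. Moreover, an element of the space is
  merely square integrable on the line, so Fubini and contour shifts do not apply to it directly.
  Its regularisation must keep the type, and F(b x) with varying b has no evident common majorant;
  in the limit the dilation is therefore moved to the kernel, whose decay is explicit.\<close>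

text \<open>The substitution \<open>z = u\<^sup>2\<close> turns the quadrant into the sector \<open>0 \<le> Im u \<le> Re u\<close>, where
  \<open>Re ((1 - 2 \<i>) u\<^sup>3) \<ge> (Re u)\<^sup>3\<close>; so \<open>exp (- \<eta> (1 - 2 \<i>) u\<^sup>3)\<close> is a damping factor that needs no branch of a power.\<close>
lemma phragmen_lindelof_quadrant:
  fixes f :: "complex \<Rightarrow> complex" and A B M :: real
  defines "Q \<equiv> {z. 0 \<le> Re z \<and> 0 \<le> Im z}"
  assumes hol: "f holomorphic_on Q"
    and growth: "\<And>z. z \<in> Q \<Longrightarrow> cmod (f z) \<le> A * exp (B * cmod z)"
    and re: "\<And>x. 0 \<le> x \<Longrightarrow> cmod (f (of_real x)) \<le> M"
    and im: "\<And>y. 0 \<le> y \<Longrightarrow> cmod (f (\<i> * of_real y)) \<le> M"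
    and M: "0 < M" and z: "z \<in> Q"
  shows "cmod (f z) \<le> M"
proof -
  define u where "u = csqrt z"
  have u2: "u\<^sup>2 = z" by (simp add: u_def)
  have reu: "0 \<le> Re u" unfolding u_def using Re_csqrt by blast
  have imz: "Im z = 2 * Re u * Im u" using u2 by (metis Im_power2)
  have rez: "Re z = (Re u)\<^sup>2 - (Im u)\<^sup>2" using u2 by (metis Re_power2)
  have imu: "0 \<le> Im u"
    using z abs_Re_le_cmod[of z] by (simp add: u_def Q_def)
  have imre: "Im u \<le> Re u"
    using z rez reu imu by (auto simp: Q_def intro: power2_le_imp_le)
  define S where "S = {v. 0 \<le> Im v \<and> Im v \<le> Re v}"
  have sqS: "v\<^sup>2 \<in> Q" if "v \<in> S" for v
    using that by (auto simp: S_def Q_def Re_power2 Im_power2 intro: power_mono)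
  define c where "c v = Re ((1 - 2 * \<i>) * v ^ 3)" for v
  have c_ge: "(Re v) ^ 3 \<le> c v" if "v \<in> S" for v
  proof -
    obtain x y where v: "v = Complex x y" by (cases v)
    have xy: "0 \<le> y" "y \<le> x" using that by (auto simp: S_def v)
    \<comment> \<open>The term 6 x^2 y is due to the factor - 2 i. It outweighs 3 x y^2 + 2 y^3
      because y <= x, and what remains is at least x^3.\<close>
    have "c v = x ^ 3 + 6 * x * x * y - 3 * x * y * y - 2 * y * y * y"
      by (simp add: c_def v power3_eq_cube algebra_simps)
    moreover have "x * y * y \<le> x * x * y" "y * y * y \<le> x * x * y"
      using xy by (auto intro!: mult_mono)
    moreover have "0 \<le> x * x * y" using xy by auto
    ultimately show ?thesis by (simp add: v)
  qed
  have main: "cmod (f z) \<le> M * exp (\<eta> * c u)" if \<eta>: "0 < \<eta>" for \<eta>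
  proof -
    define h where "h v = f (v\<^sup>2) * exp (- (of_real \<eta> * ((1 - 2 * \<i>) * v ^ 3)))" for v
    have nh: "cmod (h v) = cmod (f (v\<^sup>2)) * exp (- (\<eta> * c v))" for v
      by (simp add: h_def c_def norm_mult)
    \<comment> \<open>In the variable v the growth of f has order 2, so cubic damping wins on large
      arcs. The 1/8 is (1/2)^3: on an arc of radius R inside the sector, Re v >= R/2.\<close>
    have "((\<lambda>R. A * exp (B * R\<^sup>2 - \<eta> * R ^ 3 / 8)) \<longlongrightarrow> 0) at_top"
      using \<eta> by real_asymp
    then have "eventually (\<lambda>R. A * exp (B * R\<^sup>2 - \<eta> * R ^ 3 / 8) < M) at_top"
      using M by (auto dest: order_tendstoD)
    moreover have "eventually (\<lambda>R. R > cmod u) at_top" by (rule eventually_gt_at_top)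
    ultimately have "eventually (\<lambda>R. A * exp (B * R\<^sup>2 - \<eta> * R ^ 3 / 8) < M \<and> R > cmod u) at_top"
      by eventually_elim auto
    then obtain R where R: "A * exp (B * R\<^sup>2 - \<eta> * R ^ 3 / 8) < M" "R > cmod u"
      by (auto simp: eventually_at_top_linorder)
    define D where "D = S \<inter> cball 0 R"
    have clS: "closed S"
      unfolding S_def by (intro closed_Collect_conj closed_Collect_le continuous_intros)
    have clD: "closed D" by (auto simp: D_def clS)
    have hS: "h holomorphic_on S"
    proof -
      have "(\<lambda>v. f (v\<^sup>2)) holomorphic_on S"
        using holomorphic_on_compose_gen[OF holomorphic_on_power[OF holomorphic_on_ident] hol, of 2 S] sqS
        by (auto simp: o_def image_subset_iff)
      then show ?thesis unfolding h_def by (intro holomorphic_intros)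
    qed
    have "cmod (h u) \<le> M"
    proof (rule maximum_modulus_frontier[where f = h and S = D and \<xi> = u])
      show "h holomorphic_on interior D"
        using hS interior_subset[of D] by (auto simp: D_def intro: holomorphic_on_subset)
      have "h holomorphic_on D" using hS by (auto simp: D_def intro: holomorphic_on_subset)
      then show "continuous_on (closure D) h"
        using clD by (simp add: holomorphic_on_imp_continuous_on)
      show "bounded D" by (auto simp: D_def intro: bounded_Int)
      show "u \<in> D" using R imu imre by (auto simp: D_def S_def)
      fix v assume "v \<in> frontier D"
      then have vD: "v \<in> D" and vi: "v \<notin> interior D"
        using clD by (auto simp: frontier_def)
      have "v \<notin> {v. 0 < Im v} \<inter> {v. Im v < Re v} \<inter> ball 0 R" (is "_ \<notin> ?O")
      proof
        assume "v \<in> ?O"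
        moreover have "open ?O"
          by (intro open_Int open_Collect_less continuous_intros) auto
        moreover have "?O \<subseteq> D" by (auto simp: D_def S_def)
        ultimately show False using vi interiorI by blast
      qed
      then consider "Im v = 0" | "Im v = Re v" | "cmod v = R"
        using vD by (force simp: D_def S_def)
      then show "cmod (h v) \<le> M"
      proof cases
        case 1
        have vS: "v \<in> S" and rv: "0 \<le> Re v" using vD by (auto simp: D_def S_def)
        have "v\<^sup>2 = of_real ((Re v)\<^sup>2)" using 1 by (simp add: complex_eq_iff power2_eq_square)
        then have f: "cmod (f (v\<^sup>2)) \<le> M" using re[of "(Re v)\<^sup>2"] by simp
        have "0 \<le> c v" using c_ge[OF vS] rv by (meson order_trans zero_le_power)
        then have "exp (- (\<eta> * c v)) \<le> 1" using \<eta> by simp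
        then show ?thesis unfolding nh using f M
          by (metis exp_ge_zero mult.right_neutral mult_mono norm_ge_zero order.trans)
      next
        case 2
        have vS: "v \<in> S" and rv: "0 \<le> Re v" using vD by (auto simp: D_def S_def)
        have "v\<^sup>2 = \<i> * of_real (2 * (Re v)\<^sup>2)" using 2 by (simp add: complex_eq_iff power2_eq_square)
        then have f: "cmod (f (v\<^sup>2)) \<le> M" using im[of "2 * (Re v)\<^sup>2"] by simp
        have "0 \<le> c v" using c_ge[OF vS] rv by (meson order_trans zero_le_power)
        then have "exp (- (\<eta> * c v)) \<le> 1" using \<eta> by simp
        then show ?thesis unfolding nh using f M
          by (metis exp_ge_zero mult.right_neutral mult_mono norm_ge_zero order.trans)
      next
        case 3
        have vS: "v \<in> S" and rv: "0 \<le> Re v" using vD by (auto simp: D_def S_def)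
        have "R \<le> \<bar>Re v\<bar> + \<bar>Im v\<bar>" using 3 cmod_le by blast
        then have "R / 2 \<le> Re v" using vS by (auto simp: S_def)
        then have "(R / 2) ^ 3 \<le> c v"
          using c_ge[OF vS] power_mono[of "R/2" "Re v" 3] 3 by force
        then have "\<eta> * R ^ 3 / 8 \<le> \<eta> * c v" using \<eta> by (simp add: power_divide)
        then have e: "exp (- (\<eta> * c v)) \<le> exp (- (\<eta> * R ^ 3 / 8))" by simp
        have "cmod (f (v\<^sup>2)) \<le> A * exp (B * R\<^sup>2)"
          using growth[OF sqS[OF vS]] 3 by (simp add: norm_power)
        then have "cmod (h v) \<le> A * exp (B * R\<^sup>2) * exp (- (\<eta> * R ^ 3 / 8))"
          unfolding nh using e by (intro mult_mono) (auto intro: order_trans[OF norm_ge_zero])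
        also have "\<dots> = A * exp (B * R\<^sup>2 - \<eta> * R ^ 3 / 8)"
          by (simp add: mult_exp_exp[symmetric] diff_conv_add_uminus del: add_uminus_conv_diff)
        finally show ?thesis using R by simp
      qed
    qed
    then show ?thesis
      by (simp add: nh u2 exp_minus field_simps)
  qed
  \<comment> \<open>The point u is fixed, so the damping can now be released.\<close>
  have "((\<lambda>\<eta>. M * exp (\<eta> * c u)) \<longlongrightarrow> M * exp (0 * c u)) (at_right 0)"
    by (intro tendsto_intros)
  then have lim: "((\<lambda>\<eta>. M * exp (\<eta> * c u)) \<longlongrightarrow> M) (at_right 0)" by simp
  have "eventually (\<lambda>\<eta>. cmod (f z) \<le> M * exp (\<eta> * c u)) (at_right 0)"
    using main by (auto simp: eventually_at_filter)
  then show ?thesis by (rule tendsto_lowerbound[OF lim]) simp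
qed

text \<open>The factor exp (i s z) cancels the growth exp (s |z|) on the positive imaginary axis and
  has modulus 1 on the real axis, where division by z + 1 absorbs the linear growth. In the quadrant
  |z + 1| >= 1, so no pole enters.\<close>

lemma quadrant_growth:
  assumes hol: "g holomorphic_on UNIV" and s: "0 \<le> s"
    and gr: "\<And>z. cmod (g z) \<le> C * exp (s * cmod z)"
    and re: "\<And>x::real. cmod (g (of_real x)) \<le> M * (1 + \<bar>x\<bar>)"
    and z: "0 \<le> Re z" "0 \<le> Im z"
  shows "cmod (g z) \<le> (\<bar>M\<bar> + \<bar>C\<bar> + 1) * (1 + cmod z) * exp (s * \<bar>Im z\<bar>)"
proof -
  define M' where "M' = \<bar>M\<bar> + \<bar>C\<bar> + 1"
  define f where "f v = g v * exp (\<i> * of_real s * v) / (v + 1)" for v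
  have nf: "cmod (f v) = cmod (g v) * exp (- (s * Im v)) / cmod (v + 1)" for v
    by (simp add: f_def norm_mult norm_divide)
  have den: "1 \<le> cmod (v + 1)" if "0 \<le> Re v" for v
    using that complex_Re_le_cmod[of "v + 1"] by simp
  have "cmod (f z) \<le> M'"
  proof (rule phragmen_lindelof_quadrant[where f = f and z = z and A = "\<bar>C\<bar>" and B = s])
    have "v + 1 \<noteq> 0" if "0 \<le> Re v" for v :: complex
      using den[OF that] by auto
    then show "f holomorphic_on {z. 0 \<le> Re z \<and> 0 \<le> Im z}"
      unfolding f_def by (auto intro!: holomorphic_intros holomorphic_on_subset[OF hol])
    show "0 < M'" by (simp add: M'_def)
    show "z \<in> {z. 0 \<le> Re z \<and> 0 \<le> Im z}" using z by simp
    show "cmod (f v) \<le> \<bar>C\<bar> * exp (s * cmod v)" if "v \<in> {z. 0 \<le> Re z \<and> 0 \<le> Im z}" for v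
    proof -
      have "cmod (f v) \<le> cmod (g v) * 1 / 1"
        unfolding nf using den[of v] that s by (intro frac_le mult_mono) (auto intro: mult_nonneg_nonneg)
      also have "\<dots> \<le> C * exp (s * cmod v)" using gr by simp
      also have "\<dots> \<le> \<bar>C\<bar> * exp (s * cmod v)" by (intro mult_right_mono) auto
      finally show ?thesis .
    qed
    show "cmod (f (of_real x)) \<le> M'" if "0 \<le> x" for x
    proof -
      have "cmod (complex_of_real x + 1) = x + 1"
        using that by (metis norm_of_real abs_of_nonneg add_nonneg_nonneg of_real_1 of_real_add zero_le_one)
      then have "cmod (f (of_real x)) = cmod (g (of_real x)) / (1 + x)"
        by (simp add: nf add.commute)
      also have "\<dots> \<le> M" using re[of x] that by (subst pos_divide_le_eq) auto
      finally show ?thesis by (simp add: M'_def)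
    qed
    show "cmod (f (\<i> * of_real y)) \<le> M'" if "0 \<le> y" for y
    proof -
      have "cmod (f (\<i> * of_real y)) \<le> cmod (g (\<i> * of_real y)) * exp (- (s * y)) / 1"
        unfolding nf using den[of "\<i> * of_real y"] by (intro frac_le) auto
      also have "\<dots> \<le> C * exp (s * y) * exp (- (s * y))"
        using gr[of "\<i> * of_real y"] that by (simp add: norm_mult del: exp_minus)
      also have "\<dots> = C" by (simp add: exp_minus)
      finally show ?thesis by (simp add: M'_def)
    qed
  qed
  moreover have "0 < cmod (z + 1)" using den[OF z(1)] by linarith
  ultimately have "cmod (g z) * exp (- (s * Im z)) \<le> M' * cmod (z + 1)"
    unfolding nf by (simp add: pos_divide_le_eq)
  then have "cmod (g z) * exp (- (s * Im z)) * exp (s * Im z) \<le> M' * cmod (z + 1) * exp (s * Im z)"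
    by (rule mult_right_mono) simp
  then have "cmod (g z) \<le> M' * cmod (z + 1) * exp (s * Im z)"
    by (simp add: mult.assoc flip: exp_add)
  also have "\<dots> \<le> M' * (1 + cmod z) * exp (s * Im z)"
    using norm_triangle_ineq[of z 1] by (intro mult_right_mono mult_left_mono) (auto simp: M'_def)
  finally show ?thesis using z by (simp add: M'_def)
qed

text \<open>Both hypotheses survive z -> - z and conjugation of argument and value, so the estimate
  for one quadrant serves all four with the same constant.\<close>

lemma exp_type_growth:
  assumes et: "exp_type_le g \<sigma>" and \<sigma>: "0 \<le> \<sigma>" and \<epsilon>: "0 < \<epsilon>"
    and re: "\<And>x::real. cmod (g (of_real x)) \<le> M * (1 + \<bar>x\<bar>)"
  obtains M' where "\<And>z. cmod (g z) \<le> M' * (1 + cmod z) * exp ((\<sigma> + \<epsilon>) * \<bar>Im z\<bar>)" "0 < M'"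
proof -
  have hol: "g holomorphic_on UNIV" using et by (simp add: exp_type_le_def)
  obtain C where C: "\<And>z. cmod (g z) \<le> C * exp ((\<sigma> + \<epsilon>) * cmod z)"
    using et \<epsilon> by (auto simp: exp_type_le_def)
  have s: "0 \<le> \<sigma> + \<epsilon>" using \<sigma> \<epsilon> by simp
  define g1 where "g1 z = g (- z)" for z
  define g2 where "g2 = cnj \<circ> g \<circ> cnj"
  define g3 where "g3 = cnj \<circ> g1 \<circ> cnj"
  have h1: "g1 holomorphic_on UNIV"
    using holomorphic_on_compose_gen[OF holomorphic_on_minus[OF holomorphic_on_ident] hol, of UNIV]
    by (simp add: g1_def[abs_def] o_def)
  have h2: "g2 holomorphic_on UNIV" and h3: "g3 holomorphic_on UNIV"
    using holomorphic_on_compose_cnj_cnj[of g UNIV] holomorphic_on_compose_cnj_cnj[of g1 UNIV] hol h1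
    by (auto simp: g2_def g3_def o_assoc intro: holomorphic_on_subset)
  let ?M = "\<bar>M\<bar> + \<bar>C\<bar> + 1"
  have "cmod (g z) \<le> ?M * (1 + cmod z) * exp ((\<sigma> + \<epsilon>) * \<bar>Im z\<bar>)" for z
  proof -
    consider "0 \<le> Re z" "0 \<le> Im z" | "0 \<le> Re (-z)" "0 \<le> Im (-z)" | "0 \<le> Re (cnj z)" "0 \<le> Im (cnj z)"
      | "0 \<le> Re (- cnj z)" "0 \<le> Im (- cnj z)" by fastforce
    then show ?thesis
    proof cases
      case 1
      then show ?thesis by (intro quadrant_growth[OF hol s C re])
    next
      case 2
      have "cmod (g1 v) \<le> C * exp ((\<sigma> + \<epsilon>) * cmod v)" for v using C[of "-v"] by (simp add: g1_def)
      moreover have "cmod (g1 (of_real x)) \<le> M * (1 + \<bar>x\<bar>)" for x using re[of "-x"] by (simp add: g1_def)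
      ultimately have "cmod (g1 (-z)) \<le> ?M * (1 + cmod (-z)) * exp ((\<sigma> + \<epsilon>) * \<bar>Im (-z)\<bar>)"
        using 2 by (intro quadrant_growth[OF h1 s])
      then show ?thesis by (simp add: g1_def)
    next
      case 3
      have "cmod (g2 v) \<le> C * exp ((\<sigma> + \<epsilon>) * cmod v)" for v using C[of "cnj v"] by (simp add: g2_def)
      moreover have "cmod (g2 (of_real x)) \<le> M * (1 + \<bar>x\<bar>)" for x using re[of x] by (simp add: g2_def)
      ultimately have "cmod (g2 (cnj z)) \<le> ?M * (1 + cmod (cnj z)) * exp ((\<sigma> + \<epsilon>) * \<bar>Im (cnj z)\<bar>)"
        using 3 by (intro quadrant_growth[OF h2 s])
      then show ?thesis by (simp add: g2_def)
    next
      case 4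
      have "cmod (g3 v) \<le> C * exp ((\<sigma> + \<epsilon>) * cmod v)" for v using C[of "- cnj v"] by (simp add: g3_def g1_def)
      moreover have "cmod (g3 (of_real x)) \<le> M * (1 + \<bar>x\<bar>)" for x using re[of "-x"] by (simp add: g3_def g1_def)
      ultimately have "cmod (g3 (- cnj z)) \<le> ?M * (1 + cmod (- cnj z)) * exp ((\<sigma> + \<epsilon>) * \<bar>Im (- cnj z)\<bar>)"
        using 4 by (intro quadrant_growth[OF h3 s])
      then show ?thesis by (simp add: g3_def g1_def)
    qed
  qed
  then show ?thesis by (rule that) auto
qed

section \<open>The weight, and pointwise growth of elements of the space\<close>

text \<open>For |2 pi x| <= 2 < pi the sinc is nonnegative, and beyond that it is at most 1/2 in
  modulus. A positive lower bound makes the weighted norm equivalent to the plain one.\<close>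

lemma W_SO_lower: "1 / 2 \<le> W_SO x"
proof (cases "\<bar>2 * pi * x\<bar> \<le> 2")
  case True
  let ?u = "2 * pi * x"
  have "0 \<le> sin ?u / ?u"
  proof (cases "0 \<le> ?u")
    case T: True
    have "0 \<le> sin ?u" using T True pi_gt3 by (intro sin_ge_zero) linarith+
    then show ?thesis using T by simp
  next
    case F: False
    have "0 \<le> sin (- ?u)" using F True pi_gt3 by (intro sin_ge_zero) linarith+
    then show ?thesis using F by (simp add: divide_nonpos_nonpos)
  qed
  then show ?thesis by (simp add: W_SO_def)
next
  case False
  let ?u = "2 * pi * x"
  have "\<bar>sin ?u / ?u\<bar> \<le> 1 / 2"
    unfolding abs_divide using False by (intro frac_le) auto
  then have "- (1 / 2) \<le> sin ?u / ?u" by linarith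
  then show ?thesis by (simp only: W_SO_def split: if_splits) simp
qed

lemma W_SO_upper: "W_SO x \<le> 2"
proof -
  have "sin (2 * pi * x) / (2 * pi * x) \<le> 1" if "x \<noteq> 0"
  proof -
    have "\<bar>sin (2 * pi * x) / (2 * pi * x)\<bar> \<le> 1"
      using abs_sin_x_le_abs_x[of "2 * pi * x"] that by (simp add: abs_divide divide_le_eq_1)
    then show ?thesis by linarith
  qed
  then show ?thesis by (simp add: W_SO_def)
qed

lemma W_SO_measurable [measurable]: "W_SO \<in> borel_measurable borel"
  unfolding W_SO_def[abs_def] by measurable

lemma entire_measurable_on_real:
  assumes "F holomorphic_on UNIV"
  shows "(\<lambda>x::real. F (of_real x)) \<in> borel_measurable borel"
proof -
  have "continuous_on UNIV F" using assms by (rule holomorphic_on_imp_continuous_on)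
  then have "continuous_on UNIV (\<lambda>x::real. F (of_real x))"
    by (rule continuous_on_compose2[OF _ continuous_on_of_real_id]) auto
  then show ?thesis by (rule borel_measurable_continuous_onI)
qed

lemma H_SO_iff:
  "F \<in> H_SO \<Delta> \<longleftrightarrow> exp_type_le F (pi * \<Delta>) \<and> integrable lborel (\<lambda>x::real. (cmod (F (of_real x)))\<^sup>2)"
proof -
  have "integrable lborel (\<lambda>x::real. (cmod (F (of_real x)))\<^sup>2 * W_SO x) \<longleftrightarrow>
        integrable lborel (\<lambda>x::real. (cmod (F (of_real x)))\<^sup>2)" if "F holomorphic_on UNIV"
  proof
    have [measurable]: "(\<lambda>x::real. F (of_real x)) \<in> borel_measurable borel"
      by (rule entire_measurable_on_real[OF that])
    show "integrable lborel (\<lambda>x::real. (cmod (F (of_real x)))\<^sup>2)"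
      if "integrable lborel (\<lambda>x::real. (cmod (F (of_real x)))\<^sup>2 * W_SO x)"
    proof (rule Bochner_Integration.integrable_bound[OF integrable_mult_right[OF that, of 2]])
      have "norm ((cmod (F (of_real x)))\<^sup>2) \<le> norm (2 * ((cmod (F (of_real x)))\<^sup>2 * W_SO x))" for x
        using mult_left_mono[OF W_SO_lower[of x], of "2 * (cmod (F (of_real x)))\<^sup>2"] W_SO_lower[of x]
        by (simp add: abs_mult)
      then show "AE x in lborel. norm ((cmod (F (of_real x)))\<^sup>2) \<le> norm (2 * ((cmod (F (of_real x)))\<^sup>2 * W_SO x))"
        by simp
    qed simp
    show "integrable lborel (\<lambda>x::real. (cmod (F (of_real x)))\<^sup>2 * W_SO x)"
      if "integrable lborel (\<lambda>x::real. (cmod (F (of_real x)))\<^sup>2)"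
    proof (rule Bochner_Integration.integrable_bound[OF integrable_mult_right[OF that, of 2]])
      have "norm ((cmod (F (of_real x)))\<^sup>2 * W_SO x) \<le> norm (2 * (cmod (F (of_real x)))\<^sup>2)" for x
        using mult_left_mono[OF W_SO_upper[of x], of "(cmod (F (of_real x)))\<^sup>2"] W_SO_lower[of x]
        by (simp add: abs_mult mult.commute)
      then show "AE x in lborel. norm ((cmod (F (of_real x)))\<^sup>2 * W_SO x) \<le> norm (2 * (cmod (F (of_real x)))\<^sup>2)"
        by simp
    qed simp
  qed
  then show ?thesis by (auto simp: H_SO_def exp_type_le_def)
qed

text \<open>Passing to a primitive turns the mean-square bound on the real line into a pointwise one.\<close>
lemma primitive_bound_on_real:
  assumes \<Phi>: "\<And>z. (\<Phi> has_field_derivative F z) (at z)"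
    and hF: "F holomorphic_on UNIV"
    and L2: "integrable lborel (\<lambda>x::real. (cmod (F (of_real x)))\<^sup>2)"
  shows "cmod (\<Phi> (of_real x) - \<Phi> 0) \<le> (1 + (LINT x|lborel. (cmod (F (of_real x)))\<^sup>2)) * (1 + \<bar>x\<bar>)"
proof -
  let ?N = "LINT x|lborel. (cmod (F (of_real x)))\<^sup>2"
  have "continuous_on UNIV F" using hF by (rule holomorphic_on_imp_continuous_on)
  then have cF: "continuous_on S (\<lambda>x::real. F (of_real x))" for S
    by (rule continuous_on_compose2[OF _ continuous_on_of_real_id]) auto
  have N: "0 \<le> ?N" by simp
  have key: "cmod (\<Phi> (of_real b) - \<Phi> (of_real a)) \<le> (b - a) + ?N" if "a \<le> b" for a b :: real
  proof -
    have "((\<lambda>x. \<Phi> (of_real x)) has_vector_derivative F (of_real x)) (at x within {a..b})" for x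
      using \<Phi> has_vector_derivative_real_field has_vector_derivative_at_within by blast
    then have i: "((\<lambda>x. F (of_real x)) has_integral (\<Phi> (of_real b) - \<Phi> (of_real a))) {a..b}"
      by (intro fundamental_theorem_of_calculus that)
    have ci: "(\<lambda>x. 1 + (cmod (F (of_real x)))\<^sup>2) integrable_on {a..b}"
      by (intro integrable_continuous_interval continuous_intros cF)
    have "cmod (integral {a..b} (\<lambda>x. F (of_real x))) \<le> integral {a..b} (\<lambda>x. 1 + (cmod (F (of_real x)))\<^sup>2)"
    proof (rule integral_norm_bound_integral[OF _ ci])
      show "(\<lambda>x. F (of_real x)) integrable_on {a..b}" using i by blast
      \<comment> \<open>This stand-in for Cauchy-Schwarz costs linear growth in b - a instead of a
        square root, which the factor 1 + |x| in the growth estimate tolerates.\<close>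
      show "cmod (F (of_real x)) \<le> 1 + (cmod (F (of_real x)))\<^sup>2" for x
        using zero_le_power2[of "cmod (F (of_real x)) - 1 / 2"] by (simp add: power2_diff power_divide)
    qed
    also have "\<dots> = (b - a) + integral {a..b} (\<lambda>x. (cmod (F (of_real x)))\<^sup>2)"
      using that by (subst Henstock_Kurzweil_Integration.integral_add)
        (auto intro!: integrable_continuous_interval continuous_intros cF)
    also have "integral {a..b} (\<lambda>x. (cmod (F (of_real x)))\<^sup>2) \<le> integral UNIV (\<lambda>x. (cmod (F (of_real x)))\<^sup>2)"
      using integrable_on_lborel[OF L2]
      by (intro integral_subset_le) (auto intro!: integrable_continuous_interval continuous_intros cF)
    also have "\<dots> = ?N" using L2 by (simp add: integral_lborel)
    finally show ?thesis using i by (simp add: integral_unique)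
  qed
  have "cmod (\<Phi> (of_real x) - \<Phi> 0) \<le> \<bar>x\<bar> + ?N"
    using key[of 0 x] key[of x 0] by (cases "0 \<le> x") (auto simp: norm_minus_commute)
  also have "\<dots> \<le> (1 + ?N) * (1 + \<bar>x\<bar>)" using N by (simp add: algebra_simps)
  finally show ?thesis .
qed

text \<open>Integrating along a ray costs a factor |z|, which is at most (2 / \<epsilon>) exp
  (\<epsilon> |z| / 2). So \<epsilon> is shared equally between F and this factor.\<close>

lemma exp_type_primitive:
  assumes \<Phi>: "\<And>z. (\<Phi> has_field_derivative F z) (at z)"
    and et: "exp_type_le F \<sigma>" and \<sigma>: "0 \<le> \<sigma>"
  shows "exp_type_le (\<lambda>z. \<Phi> z - \<Phi> 0) \<sigma>"
  unfolding exp_type_le_def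
proof (intro conjI allI impI)
  show "(\<lambda>z. \<Phi> z - \<Phi> 0) holomorphic_on UNIV"
  proof (intro holomorphic_intros)
    show "\<Phi> holomorphic_on UNIV" using \<Phi> by (simp add: holomorphic_on_open) blast
  qed
  fix \<epsilon> :: real assume \<epsilon>: "0 < \<epsilon>"
  obtain C where C: "\<And>z. cmod (F z) \<le> C * exp ((\<sigma> + \<epsilon> / 2) * cmod z)"
    using et half_gt_zero[OF \<epsilon>] unfolding exp_type_le_def by blast
  have C0: "0 \<le> C" using order_trans[OF norm_ge_zero C[of 0]] by simp
  have "cmod (\<Phi> z - \<Phi> 0) \<le> C * 2 / \<epsilon> * exp ((\<sigma> + \<epsilon>) * cmod z)" for z
  proof -
    have "cmod (\<Phi> z - \<Phi> 0) \<le> C * exp ((\<sigma> + \<epsilon> / 2) * cmod z) * cmod (z - 0)"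
    proof (rule field_differentiable_bound[where S = "cball 0 (cmod z)" and f' = F])
      show "cmod (F v) \<le> C * exp ((\<sigma> + \<epsilon> / 2) * cmod z)" if "v \<in> cball 0 (cmod z)" for v
      proof -
        have "exp ((\<sigma> + \<epsilon> / 2) * cmod v) \<le> exp ((\<sigma> + \<epsilon> / 2) * cmod z)"
          using that \<sigma> \<epsilon> by (auto intro!: mult_left_mono)
        then show ?thesis using C[of v] mult_left_mono[OF _ C0] order_trans by blast
      qed
    qed (auto intro: has_field_derivative_at_within[OF \<Phi>])
    also have "cmod (z - 0) \<le> 2 / \<epsilon> * exp (\<epsilon> / 2 * cmod z)"
    proof -
      have "\<epsilon> / 2 * cmod z \<le> exp (\<epsilon> / 2 * cmod z)" using exp_ge_add_one_self[of "\<epsilon> / 2 * cmod z"] by linarith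
      then show ?thesis using \<epsilon> by (simp add: field_simps)
    qed
    finally have "cmod (\<Phi> z - \<Phi> 0) \<le> C * exp ((\<sigma> + \<epsilon> / 2) * cmod z) * (2 / \<epsilon> * exp (\<epsilon> / 2 * cmod z))"
      using C0 by (simp add: mult_left_mono)
    also have "\<dots> = C * 2 / \<epsilon> * (exp ((\<sigma> + \<epsilon> / 2) * cmod z) * exp (\<epsilon> / 2 * cmod z))" by simp
    also have "exp ((\<sigma> + \<epsilon> / 2) * cmod z) * exp (\<epsilon> / 2 * cmod z) = exp ((\<sigma> + \<epsilon>) * cmod z)"
      by (simp add: algebra_simps flip: exp_add)
    finally show ?thesis .
  qed
  then show "\<exists>C. \<forall>z. cmod (\<Phi> z - \<Phi> 0) \<le> C * exp ((\<sigma> + \<epsilon>) * cmod z)" by blast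
qed

text \<open>Phragmen-Lindelof wants pointwise control on the real line, which square integrability
  gives at once for the primitive but not for F. The bound returns from the primitive to F by
  Cauchy's inequality on unit discs, at the price of a constant.\<close>

lemma H_SO_growth:
  assumes F: "F \<in> H_SO \<Delta>" and \<Delta>: "0 < \<Delta>" and \<epsilon>: "0 < \<epsilon>"
  obtains M where "0 < M" "\<And>z. cmod (F z) \<le> M * (1 + cmod z) * exp ((pi * \<Delta> + \<epsilon>) * \<bar>Im z\<bar>)"
proof -
  have et: "exp_type_le F (pi * \<Delta>)" and L2: "integrable lborel (\<lambda>x::real. (cmod (F (of_real x)))\<^sup>2)"
    using F by (auto simp: H_SO_iff)
  have hF: "F holomorphic_on UNIV" using et by (simp add: exp_type_le_def)
  obtain \<Phi> where \<Phi>: "\<And>z. (\<Phi> has_field_derivative F z) (at z)"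
    using holomorphic_convex_primitive'[OF convex_UNIV open_UNIV hF] by auto
  let ?P = "\<lambda>z. \<Phi> z - \<Phi> 0"
  have etP: "exp_type_le ?P (pi * \<Delta>)"
    using exp_type_primitive[OF \<Phi> et] \<Delta> by simp
  obtain M where M: "\<And>z. cmod (?P z) \<le> M * (1 + cmod z) * exp ((pi * \<Delta> + \<epsilon>) * \<bar>Im z\<bar>)" "0 < M"
    by (rule exp_type_growth[OF etP _ \<epsilon> primitive_bound_on_real[OF \<Phi> hF L2]]) (use \<Delta> in auto)
  let ?s = "pi * \<Delta> + \<epsilon>"
  have s: "0 < ?s" using \<Delta> \<epsilon> by (simp add: add_pos_pos)
  have "cmod (F z) \<le> (M * 2 * exp ?s) * (1 + cmod z) * exp (?s * \<bar>Im z\<bar>)" for z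
  proof -
    have hP: "?P holomorphic_on UNIV" using etP by (simp add: exp_type_le_def)
    have "cmod ((deriv ^^ 1) ?P z) \<le> fact 1 * (M * (2 + cmod z) * exp (?s * (\<bar>Im z\<bar> + 1))) / 1 ^ 1"
    proof (rule Cauchy_inequality)
      show "?P holomorphic_on ball z 1" using hP by (rule holomorphic_on_subset) auto
      show "continuous_on (cball z 1) ?P"
        using hP by (intro holomorphic_on_imp_continuous_on) (rule holomorphic_on_subset, auto)
      fix v assume v: "cmod (z - v) = 1"
      have "cmod v \<le> 1 + cmod z" using v norm_triangle_ineq2[of v z] by (simp add: norm_minus_commute)
      moreover have "\<bar>Im v\<bar> \<le> \<bar>Im z\<bar> + 1" using v abs_Im_le_cmod[of "z - v"] by simp
      then have "?s * \<bar>Im v\<bar> \<le> ?s * (\<bar>Im z\<bar> + 1)" using s by (intro mult_left_mono) auto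
      ultimately have "M * (1 + cmod v) * exp (?s * \<bar>Im v\<bar>) \<le> M * (2 + cmod z) * exp (?s * (\<bar>Im z\<bar> + 1))"
        using M(2) by (intro mult_mono) auto
      then show "cmod (?P v) \<le> M * (2 + cmod z) * exp (?s * (\<bar>Im z\<bar> + 1))"
        using M(1)[of v] by linarith
    qed auto
    also have "(deriv ^^ 1) ?P z = F z"
      using \<Phi>[of z] by (auto intro!: DERIV_imp_deriv derivative_eq_intros)
    also have "fact 1 * (M * (2 + cmod z) * exp (?s * (\<bar>Im z\<bar> + 1))) / 1 ^ 1
       = M * (2 + cmod z) * (exp ?s * exp (?s * \<bar>Im z\<bar>))"
      by (simp add: algebra_simps flip: exp_add)
    also have "\<dots> \<le> M * (2 * (1 + cmod z)) * (exp ?s * exp (?s * \<bar>Im z\<bar>))"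
      using M(2) by (intro mult_mono) auto
    finally show ?thesis by (simp only: mult_ac)
  qed
  then show ?thesis using M(2) by (intro that[of "M * 2 * exp ?s"]) auto
qed

section \<open>Entire functions decaying on the real line\<close>

lemma tendsto_LINT_symmetric_interval:
  fixes f :: "real \<Rightarrow> complex"
  assumes "integrable lborel f"
  shows "(\<lambda>n. LINT x:{- real n..real n}|lborel. f x) \<longlonglongrightarrow> (LINT x|lborel. f x)"
  unfolding set_lebesgue_integral_def
proof (rule integral_dominated_convergence[where w = "\<lambda>x. norm (f x)"])
  show "AE x in lborel. (\<lambda>n. indicator {- real n..real n} x *\<^sub>R f x) \<longlonglongrightarrow> f x"
  proof (rule AE_I2)
    fix x :: real
    obtain N where "\<bar>x\<bar> \<le> real N" using real_arch_simple by blast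
    then have "eventually (\<lambda>n. indicator {- real n..real n} x *\<^sub>R f x = f x) sequentially"
      by (intro eventually_sequentiallyI[of N]) (auto simp: indicator_def)
    then show "(\<lambda>n. indicator {- real n..real n} x *\<^sub>R f x) \<longlonglongrightarrow> f x"
      by (rule tendsto_eventually)
  qed
qed (use assms in \<open>auto simp: indicator_def\<close>)

text \<open>The angles from pi to 2 pi run from - n to n through the lower half-plane. A primitive P
  of q gives this arc and the segment the same integral P(n) - P(- n), and integrability turns the
  symmetric limit into the integral over the line.\<close>

lemma LINT_real_eq_lower_arc_limit:
  assumes hol: "q holomorphic_on UNIV"
    and int: "integrable lborel (\<lambda>x::real. q (of_real x))"
    and lim: "(\<lambda>n. contour_integral (part_circlepath 0 (real n) pi (2 * pi)) q) \<longlonglongrightarrow> L"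
  shows "(LINT x|lborel. q (of_real x)) = L"
proof -
  obtain P where P: "\<And>z. (P has_field_derivative q z) (at z)"
    using holomorphic_convex_primitive'[OF convex_UNIV open_UNIV hol] by auto
  have arc: "contour_integral (part_circlepath 0 (real n) pi (2 * pi)) q = P (of_real n) - P (- of_real n)" for n
  proof -
    have e: "exp (\<i> * (2 * complex_of_real pi)) = 1" "exp (\<i> * complex_of_real pi) = -1"
      by (simp_all add: exp_eq_1 exp_eq_polar[symmetric] flip: cis_conv_exp)
    have "(q has_contour_integral (P (pathfinish (part_circlepath 0 (real n) pi (2 * pi)))
             - P (pathstart (part_circlepath 0 (real n) pi (2 * pi))))) (part_circlepath 0 (real n) pi (2 * pi))"
      by (rule contour_integral_primitive[where S = UNIV]) (auto intro: has_field_derivative_at_within P)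
    then show ?thesis by (simp add: contour_integral_unique e)
  qed
  have "(LINT x:{- real n..real n}|lborel. q (of_real x)) = P (of_real n) - P (- of_real n)" for n
  proof -
    have "((\<lambda>x. P (of_real x)) has_vector_derivative q (of_real x)) (at x within {- real n..real n})" for x
      using P has_vector_derivative_real_field has_vector_derivative_at_within by blast
    then have "((\<lambda>x. q (of_real x)) has_integral (P (of_real (real n)) - P (of_real (- real n)))) {- real n..real n}"
      by (intro fundamental_theorem_of_calculus) auto
    moreover have "set_integrable lborel {- real n..real n} (\<lambda>x. q (of_real x))"
      using int unfolding set_integrable_def by (intro integrable_mult_indicator) auto
    ultimately show ?thesis
      by (simp add: set_borel_integral_eq_integral(2) integral_unique)
  qed
  then have "(\<lambda>n. P (of_real n) - P (- of_real n)) \<longlonglongrightarrow> (LINT x|lborel. q (of_real x))"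
    using tendsto_LINT_symmetric_interval[OF int] by simp
  then show ?thesis using lim LIMSEQ_unique unfolding arc by blast
qed

text \<open>The arc length is of order n, which the quadratic denominator beats. The threshold N
  serves integrands with a pole that the arcs must first leave behind.\<close>

lemma arc_integral_tendsto_0:
  assumes "\<And>n z. N \<le> n \<Longrightarrow> z \<in> path_image (part_circlepath 0 (real n) a b) \<Longrightarrow> cmod (q z) \<le> M / (1 + (real n)\<^sup>2)"
    and "\<And>n. N \<le> n \<Longrightarrow> q contour_integrable_on (part_circlepath 0 (real n) a b)" and "0 \<le> M"
  shows "(\<lambda>n. contour_integral (part_circlepath 0 (real n) a b) q) \<longlonglongrightarrow> 0"
proof (rule Lim_null_comparison)
  show "\<forall>\<^sub>F n in sequentially. norm (contour_integral (part_circlepath 0 (real n) a b) q)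
      \<le> M / (1 + (real n)\<^sup>2) * real n * \<bar>b - a\<bar>"
    using assms by (intro eventually_sequentiallyI[of N] contour_integral_bound_part_circlepath) auto
  have "(\<lambda>n. real n / (1 + (real n)\<^sup>2)) \<longlonglongrightarrow> 0" by real_asymp
  then have "(\<lambda>n. M * (real n / (1 + (real n)\<^sup>2)) * \<bar>b - a\<bar>) \<longlonglongrightarrow> M * 0 * \<bar>b - a\<bar>"
    by (intro tendsto_intros)
  then show "(\<lambda>n. M / (1 + (real n)\<^sup>2) * real n * \<bar>b - a\<bar>) \<longlonglongrightarrow> 0" by simp
qed

lemma upper_arcD:
  assumes "z \<in> path_image (part_circlepath 0 (real n) 0 pi)"
  shows "cmod z = real n" "0 \<le> Im z"
proof -
  obtain t where "0 \<le> t" "t \<le> pi" "z = of_real (real n) * cis t"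
    using assms by (auto simp: path_image_part_circlepath cis_conv_exp)
  then show "cmod z = real n" "0 \<le> Im z" by (auto simp: norm_mult sin_ge_zero)
qed

lemma lower_arcD:
  assumes "z \<in> path_image (part_circlepath 0 (real n) pi (2 * pi))"
  shows "cmod z = real n" "Im z \<le> 0"
proof -
  obtain t where t: "pi \<le> t" "t \<le> 2 * pi" "z = of_real (real n) * cis t"
    using assms by (auto simp: path_image_part_circlepath cis_conv_exp)
  have "0 \<le> sin (t - pi)" using t by (intro sin_ge_zero) auto
  then have "sin t \<le> 0" by simp
  then show "cmod z = real n" "Im z \<le> 0" using t by (auto simp: norm_mult mult_nonneg_nonpos)
qed

lemma integrable_inverse_one_plus_square: "integrable lborel (\<lambda>x::real. 1 / (1 + x\<^sup>2))"
proof -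
  have "set_integrable lborel (einterval (-\<infinity>) \<infinity>) (\<lambda>x::real. inverse (1 + x\<^sup>2))"
    by (rule integrable_inverse_1_plus_square)
  then show ?thesis by (simp add: set_integrable_def inverse_eq_divide)
qed

text \<open>The class on which Fubini and contour shifts work: the denominator gives absolute
  integrability on the line and vanishing integrals over large arcs. The exponential involves Im z
  alone, so exp (i r z) can cancel it in a half-plane.\<close>

locale decaying_entire =
  fixes \<Phi> :: "complex \<Rightarrow> complex" and M \<sigma> :: real
  assumes hol: "\<Phi> holomorphic_on UNIV"
    and bound: "\<And>z. cmod (\<Phi> z) \<le> M * exp (\<sigma> * \<bar>Im z\<bar>) / (1 + (cmod z)\<^sup>2)"
    and \<sigma>: "0 \<le> \<sigma>"
begin

lemma M_nonneg: "0 \<le> M"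
  using order_trans[OF norm_ge_zero bound[of 0]] by simp

lemma measurable_on_real [measurable]: "(\<lambda>x::real. \<Phi> (of_real x)) \<in> borel_measurable borel"
  by (rule entire_measurable_on_real[OF hol])

lemma bound_on_real: "cmod (\<Phi> (of_real x)) \<le> M * (1 / (1 + x\<^sup>2))"
  using bound[of "of_real x"] by simp

lemma integrable_on_real: "integrable lborel (\<lambda>x::real. \<Phi> (of_real x))"
proof (rule Bochner_Integration.integrable_bound)
  show "integrable lborel (\<lambda>x::real. M * (1 / (1 + x\<^sup>2)))"
    by (intro integrable_mult_right integrable_inverse_one_plus_square)
  show "AE x in lborel. norm (\<Phi> (of_real x)) \<le> norm (M * (1 / (1 + x\<^sup>2)))"
    using bound_on_real M_nonneg by simp
qed simp

text \<open>The easy half of the Paley-Wiener theorem: on lower arcs exp (i r z) has modulus exp (-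
  r Im z), which offsets exp (\<sigma> |Im z|). At r = - \<sigma> the two just cancel and the
  denominator alone makes the arcs vanish.\<close>

lemma fourier_lower_vanishes:
  assumes "r \<le> - \<sigma>"
  shows "(LINT x|lborel. \<Phi> (of_real x) * exp (\<i> * of_real r * of_real x)) = 0"
proof (rule LINT_real_eq_lower_arc_limit[where q = "\<lambda>z. \<Phi> z * exp (\<i> * of_real r * z)"])
  show q: "(\<lambda>z. \<Phi> z * exp (\<i> * of_real r * z)) holomorphic_on UNIV"
    by (intro holomorphic_intros hol)
  show "integrable lborel (\<lambda>x. \<Phi> (of_real x) * exp (\<i> * of_real r * of_real x))"
    by (rule Bochner_Integration.integrable_bound[OF integrable_on_real]) (auto simp: norm_mult)
  show "(\<lambda>n. contour_integral (part_circlepath 0 (real n) pi (2 * pi)) (\<lambda>z. \<Phi> z * exp (\<i> * of_real r * z))) \<longlonglongrightarrow> 0"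
  proof (rule arc_integral_tendsto_0[where N = 0 and M = M])
    fix n z assume z: "z \<in> path_image (part_circlepath 0 (real n) pi (2 * pi))"
    have "cmod (\<Phi> z * exp (\<i> * of_real r * z)) = cmod (\<Phi> z) * exp (- (r * Im z))"
      by (simp add: norm_mult)
    also have "\<dots> \<le> M * exp (\<sigma> * \<bar>Im z\<bar>) / (1 + (cmod z)\<^sup>2) * exp (- (r * Im z))"
      by (intro mult_right_mono bound) auto
    also have "\<dots> = M / (1 + (cmod z)\<^sup>2) * exp (\<sigma> * \<bar>Im z\<bar> - r * Im z)"
      by (simp add: exp_diff exp_minus field_simps)
    also have "\<dots> \<le> M / (1 + (cmod z)\<^sup>2) * 1"
    proof (rule mult_left_mono)
      have "r * \<bar>Im z\<bar> \<le> - \<sigma> * \<bar>Im z\<bar>" using assms by (rule mult_right_mono) auto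
      then have "\<sigma> * \<bar>Im z\<bar> - r * Im z \<le> 0" using lower_arcD(2)[OF z] by simp
      then show "exp (\<sigma> * \<bar>Im z\<bar> - r * Im z) \<le> 1" by simp
    qed (use M_nonneg in auto)
    finally show "cmod (\<Phi> z * exp (\<i> * of_real r * z)) \<le> M / (1 + (real n)\<^sup>2)"
      using lower_arcD(1)[OF z] by simp
  next
    show "(\<lambda>z. \<Phi> z * exp (\<i> * of_real r * z)) contour_integrable_on part_circlepath 0 (real n) pi (2 * pi)" for n
      using q by (intro contour_integrable_continuous_part_circlepath holomorphic_on_imp_continuous_on)
        (rule holomorphic_on_subset, auto)
  qed (rule M_nonneg)
qed

lemma fourier_vanishes:
  assumes "\<sigma> \<le> \<bar>r\<bar>"
  shows "(LINT x|lborel. \<Phi> (of_real x) * exp (\<i> * of_real r * of_real x)) = 0"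
proof (cases "r \<le> 0")
  case True
  then show ?thesis using assms by (intro fourier_lower_vanishes) auto
next
  case False
  interpret neg: decaying_entire "\<lambda>z. \<Phi> (- z)" M \<sigma>
  proof
    show "(\<lambda>z. \<Phi> (- z)) holomorphic_on UNIV"
      using holomorphic_on_compose_gen[OF holomorphic_on_minus[OF holomorphic_on_ident] hol, of UNIV]
      by (simp add: o_def)
    show "cmod (\<Phi> (- z)) \<le> M * exp (\<sigma> * \<bar>Im z\<bar>) / (1 + (cmod z)\<^sup>2)" for z
      using bound[of "-z"] by simp
  qed (rule \<sigma>)
  have "(LINT x|lborel. \<Phi> (of_real x) * exp (\<i> * of_real r * of_real x))
      = (LINT x|lborel. \<Phi> (- of_real x) * exp (\<i> * of_real (- r) * of_real x))"
    using lborel_integral_real_affine[where c = "-1" and t = 0 and f = "\<lambda>x. \<Phi> (of_real x) * exp (\<i> * of_real r * of_real x)"]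
    by simp
  also have "\<dots> = 0" using False assms by (intro neg.fourier_lower_vanishes) auto
  finally show ?thesis .
qed

text \<open>In Cauchy's formula over a circle the upper arc is treated with \<open>\<Phi> z exp (\<i> r (z - w))\<close> and the lower
  one with \<open>\<Phi> z exp (- \<i> r (z - w))\<close>, both of which decay there; the difference of the two integrands is entire, which
  moves the lower arc to the real line. No half-plane for \<open>w\<close> has to be singled out.\<close>
lemma reproducing:
  assumes r: "\<sigma> \<le> r" and E: "E holomorphic_on UNIV"
    and Eeq: "\<And>u. 2 * of_real pi * \<i> * u * E u = exp (\<i> * of_real r * u) - exp (- (\<i> * of_real r * u))"
    and int: "integrable lborel (\<lambda>x::real. \<Phi> (of_real x) * E (of_real x - w))"
  shows "(LINT x|lborel. \<Phi> (of_real x) * E (of_real x - w)) = \<Phi> w"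
proof (rule LINT_real_eq_lower_arc_limit[where q = "\<lambda>z. \<Phi> z * E (z - w)", OF _ int])
  have hE: "(\<lambda>z. E (z - w)) holomorphic_on UNIV"
    using holomorphic_on_compose_gen[OF holomorphic_on_diff[OF holomorphic_on_ident holomorphic_on_const] E, of w UNIV]
    by (simp add: o_def)
  then show "(\<lambda>z. \<Phi> z * E (z - w)) holomorphic_on UNIV" by (intro holomorphic_intros hol)
  \<comment> \<open>From radius N on, the arcs stay at distance at least 1 from the pole w, so
    division by 2 pi (z - w) only decreases moduli.\<close>
  obtain N where N: "cmod w + 1 \<le> real N" using real_arch_simple by blast
  define h1 where "h1 z = \<Phi> z * exp (\<i> * of_real r * (z - w))" for z
  define h2 where "h2 z = \<Phi> z * exp (- (\<i> * of_real r * (z - w)))" for z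
  define q1 where "q1 z = h1 z / (2 * of_real pi * \<i> * (z - w))" for z
  define q2 where "q2 z = h2 z / (2 * of_real pi * \<i> * (z - w))" for z
  have hh: "h1 holomorphic_on UNIV" "h2 holomorphic_on UNIV"
    unfolding h1_def h2_def by (intro holomorphic_intros hol)+
  have far: "1 \<le> cmod (z - w)" if "N \<le> n" "cmod z = real n" for n z
  proof -
    have "real N \<le> real n" using that by simp
    then show ?thesis using that N norm_triangle_ineq2[of z w] by linarith
  qed
  have sph: "path_image (part_circlepath 0 (real n) a b) \<subseteq> sphere 0 (real n)" for n a b
    by (intro path_image_part_circlepath_subset') simp
  have cont: "q1 contour_integrable_on part_circlepath 0 (real n) a b" 
       "q2 contour_integrable_on part_circlepath 0 (real n) a b" if n: "N \<le> n" for n a b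
  proof -
    have "z \<noteq> w" if "z \<in> sphere 0 (real n)" for z
      using far[OF n, of z] that by auto
    then have "\<forall>z\<in>path_image (part_circlepath 0 (real n) a b). z \<noteq> w" using sph[of n a b] by blast
    then have "continuous_on (path_image (part_circlepath 0 (real n) a b)) q1"
         "continuous_on (path_image (part_circlepath 0 (real n) a b)) q2"
      unfolding q1_def q2_def
      by (intro continuous_intros continuous_on_subset[OF holomorphic_on_imp_continuous_on[OF hh(1)]]
            continuous_on_subset[OF holomorphic_on_imp_continuous_on[OF hh(2)]]; simp)+
    then show "q1 contour_integrable_on part_circlepath 0 (real n) a b" 
       "q2 contour_integrable_on part_circlepath 0 (real n) a b"
      by (auto intro: contour_integrable_continuous_part_circlepath)
  qed
  \<comment> \<open>The extra factor is the price of centring the exponentials at w, where they then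
    equal 1.\<close>
  let ?M = "M * exp (r * \<bar>Im w\<bar>)"
  have den: "cmod v / (2 * pi * cmod (z - w)) \<le> cmod v" if "N \<le> n" "cmod z = real n" for v n z
  proof -
    have "1 * 1 \<le> (2 * pi) * cmod (z - w)" using far[OF that] pi_gt3 by (intro mult_mono) auto
    then have "cmod v / (2 * pi * cmod (z - w)) \<le> cmod v / 1" by (intro divide_left_mono) auto
    then show ?thesis by simp
  qed
  have l1: "(\<lambda>n. contour_integral (part_circlepath 0 (real n) 0 pi) q1) \<longlonglongrightarrow> 0"
  proof (rule arc_integral_tendsto_0[where N = N and M = ?M])
    fix n z assume n: "N \<le> n" and z: "z \<in> path_image (part_circlepath 0 (real n) 0 pi)"
    have "cmod (q1 z) \<le> cmod (h1 z)"
      using den[OF n upper_arcD(1)[OF z], of "h1 z"] by (simp add: q1_def norm_divide norm_mult)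
    also have "\<dots> = cmod (\<Phi> z) * exp (r * Im w - r * Im z)"
      by (simp add: h1_def norm_mult algebra_simps)
    also have "\<dots> \<le> M * exp (\<sigma> * \<bar>Im z\<bar>) / (1 + (cmod z)\<^sup>2) * exp (r * Im w - r * Im z)"
      by (intro mult_right_mono bound) auto
    also have "\<dots> = M / (1 + (cmod z)\<^sup>2) * exp (\<sigma> * \<bar>Im z\<bar> - r * Im z + r * Im w)"
      by (simp add: exp_diff exp_minus exp_add field_simps)
    also have "\<dots> \<le> M / (1 + (cmod z)\<^sup>2) * exp (r * \<bar>Im w\<bar>)"
    proof (rule mult_left_mono)
      have "\<sigma> * \<bar>Im z\<bar> \<le> r * \<bar>Im z\<bar>" "r * Im w \<le> r * \<bar>Im w\<bar>"
        using r \<sigma> by (auto intro!: mult_right_mono mult_left_mono)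
      then show "exp (\<sigma> * \<bar>Im z\<bar> - r * Im z + r * Im w) \<le> exp (r * \<bar>Im w\<bar>)"
        using upper_arcD(2)[OF z] by simp
    qed (use M_nonneg in auto)
    finally show "cmod (q1 z) \<le> ?M / (1 + (real n)\<^sup>2)" using upper_arcD(1)[OF z] by simp
  qed (use cont M_nonneg in auto)
  have l2: "(\<lambda>n. contour_integral (part_circlepath 0 (real n) pi (2 * pi)) q2) \<longlonglongrightarrow> 0"
  proof (rule arc_integral_tendsto_0[where N = N and M = ?M])
    fix n z assume n: "N \<le> n" and z: "z \<in> path_image (part_circlepath 0 (real n) pi (2 * pi))"
    have "cmod (q2 z) \<le> cmod (h2 z)"
      using den[OF n lower_arcD(1)[OF z], of "h2 z"] by (simp add: q2_def norm_divide norm_mult)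
    also have "\<dots> = cmod (\<Phi> z) * exp (r * Im z - r * Im w)"
      by (simp add: h2_def norm_mult algebra_simps)
    also have "\<dots> \<le> M * exp (\<sigma> * \<bar>Im z\<bar>) / (1 + (cmod z)\<^sup>2) * exp (r * Im z - r * Im w)"
      by (intro mult_right_mono bound) auto
    also have "\<dots> = M / (1 + (cmod z)\<^sup>2) * exp (\<sigma> * \<bar>Im z\<bar> + r * Im z - r * Im w)"
      by (simp add: exp_diff exp_minus exp_add field_simps)
    also have "\<dots> \<le> M / (1 + (cmod z)\<^sup>2) * exp (r * \<bar>Im w\<bar>)"
    proof (rule mult_left_mono)
      have "\<sigma> * \<bar>Im z\<bar> \<le> r * \<bar>Im z\<bar>" "r * (- Im w) \<le> r * \<bar>Im w\<bar>"
        using r \<sigma> by (intro mult_right_mono mult_left_mono; simp)+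
      then show "exp (\<sigma> * \<bar>Im z\<bar> + r * Im z - r * Im w) \<le> exp (r * \<bar>Im w\<bar>)"
        using lower_arcD(2)[OF z] by simp
    qed (use M_nonneg in auto)
    finally show "cmod (q2 z) \<le> ?M / (1 + (real n)\<^sup>2)" using lower_arcD(1)[OF z] by simp
  qed (use cont M_nonneg in auto)
  have eq: "contour_integral (part_circlepath 0 (real n) pi (2 * pi)) (\<lambda>z. \<Phi> z * E (z - w))
      = \<Phi> w - contour_integral (part_circlepath 0 (real n) 0 pi) q1
        - contour_integral (part_circlepath 0 (real n) pi (2 * pi)) q2" if n: "N \<le> n" for n
  proof -
    have nw: "cmod w < real n" using N n by (simp add: of_nat_le_iff[symmetric, where 'a = real] del: of_nat_le_iff)
    \<comment> \<open>Cauchy's formula yields \<open>h1 w\<close>, which is \<open>\<Phi> w\<close>;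
      so the two arcs of \<open>q1\<close> add up to \<open>\<Phi> w\<close>, and the upper one
      tends to 0.\<close>
    have "((\<lambda>u. h1 u / (u - w)) has_contour_integral (2 * of_real pi * \<i> * h1 w)) (circlepath 0 (real n))"
      using nw by (intro Cauchy_integral_circlepath_simple holomorphic_on_subset[OF hh(1)]) auto
    then have "((\<lambda>u. h1 u / (u - w) / (2 * of_real pi * \<i>)) has_contour_integral (2 * of_real pi * \<i> * h1 w) / (2 * of_real pi * \<i>)) (circlepath 0 (real n))"
      by (rule has_contour_integral_div)
    moreover have "(\<lambda>u. h1 u / (u - w) / (2 * of_real pi * \<i>)) = q1"
      by (auto simp: q1_def fun_eq_iff mult.commute)
    ultimately have "(q1 has_contour_integral \<Phi> w) (part_circlepath 0 (real n) 0 (2 * pi))"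
      by (simp add: h1_def circlepath_def)
    then have c1: "((\<lambda>t. q1 (0 + real n * cis t) * real n * \<i> * cis t) has_integral \<Phi> w) {0..2 * pi}"
      by (subst (asm) has_contour_integral_part_circlepath_iff) auto
    have c2: "((\<lambda>t. q1 (0 + real n * cis t) * real n * \<i> * cis t) has_integral contour_integral (part_circlepath 0 (real n) 0 pi) q1) {0..pi}"
      using has_contour_integral_integral[OF cont(1)[OF n, of 0 pi]]
      by (subst (asm) has_contour_integral_part_circlepath_iff) auto
    have c3: "((\<lambda>t. q1 (0 + real n * cis t) * real n * \<i> * cis t) has_integral contour_integral (part_circlepath 0 (real n) pi (2 * pi)) q1) {pi..2 * pi}"
      using has_contour_integral_integral[OF cont(1)[OF n, of pi "2 * pi"]]
      by (subst (asm) has_contour_integral_part_circlepath_iff) auto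
    have s: "contour_integral (part_circlepath 0 (real n) 0 pi) q1 + contour_integral (part_circlepath 0 (real n) pi (2 * pi)) q1 = \<Phi> w"
      using has_integral_combine[OF _ _ c2 c3] c1 by (auto intro: has_integral_unique)
    have "contour_integral (part_circlepath 0 (real n) pi (2 * pi)) (\<lambda>z. \<Phi> z * E (z - w))
        = contour_integral (part_circlepath 0 (real n) pi (2 * pi)) (\<lambda>z. q1 z - q2 z)"
    proof (rule contour_integral_eq)
      fix z assume "z \<in> path_image (part_circlepath 0 (real n) pi (2 * pi))"
      then have "z \<noteq> w" using far[OF n, of z] sph[of n pi "2 * pi"] by auto
      have "q1 z - q2 z = \<Phi> z * (exp (\<i> * of_real r * (z - w)) - exp (- (\<i> * of_real r * (z - w))))
          / (2 * of_real pi * \<i> * (z - w))"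
        by (simp only: q1_def q2_def h1_def h2_def diff_divide_distrib right_diff_distrib)
      also have "\<dots> = \<Phi> z * (2 * of_real pi * \<i> * (z - w) * E (z - w)) / (2 * of_real pi * \<i> * (z - w))"
        by (simp only: Eeq)
      also have "\<dots> = \<Phi> z * E (z - w)" using \<open>z \<noteq> w\<close> by simp
      finally show "\<Phi> z * E (z - w) = q1 z - q2 z" by simp
    qed
    also have "\<dots> = contour_integral (part_circlepath 0 (real n) pi (2 * pi)) q1
         - contour_integral (part_circlepath 0 (real n) pi (2 * pi)) q2"
      using cont[OF n] by (rule contour_integral_diff)
    finally show ?thesis using s by (simp add: algebra_simps)
  qed
  have "(\<lambda>n. \<Phi> w - contour_integral (part_circlepath 0 (real n) 0 pi) q1
        - contour_integral (part_circlepath 0 (real n) pi (2 * pi)) q2) \<longlonglongrightarrow> \<Phi> w - 0 - 0"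
    by (intro tendsto_intros l1 l2)
  moreover have "eventually (\<lambda>n. \<Phi> w - contour_integral (part_circlepath 0 (real n) 0 pi) q1
        - contour_integral (part_circlepath 0 (real n) pi (2 * pi)) q2 = 
       contour_integral (part_circlepath 0 (real n) pi (2 * pi)) (\<lambda>z. \<Phi> z * E (z - w))) sequentially"
    using eq by (intro eventually_sequentiallyI[of N]) auto
  ultimately show "(\<lambda>n. contour_integral (part_circlepath 0 (real n) pi (2 * pi)) (\<lambda>z. \<Phi> z * E (z - w))) \<longlonglongrightarrow> \<Phi> w"
    using Lim_transform_eventually by auto
qed

end

section \<open>Band-limited transforms\<close>

text \<open>Support and boundedness sit in one inequality that holds at every point, not just almost
  everywhere, since the integral equation is a pointwise statement too.\<close>

definition band :: "real \<Rightarrow> real \<Rightarrow> (real \<Rightarrow> complex) \<Rightarrow> bool" where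
  "band a B g \<longleftrightarrow> g \<in> borel_measurable borel \<and> (\<forall>t. cmod (g t) \<le> B * indicator {-a..a} t)"

abbreviation fexp :: "real \<Rightarrow> complex \<Rightarrow> complex" where
  "fexp t z \<equiv> exp (2 * of_real pi * \<i> * of_real t * z)"

abbreviation nexp :: "real \<Rightarrow> real \<Rightarrow> complex" where
  "nexp t x \<equiv> exp (- (2 * of_real pi * \<i> * of_real t * of_real x))"

definition ft :: "(real \<Rightarrow> complex) \<Rightarrow> complex \<Rightarrow> complex" where
  "ft g z = (LINT t|lborel. g t * fexp t z)"

lemma bandD:
  assumes "band a B g"
  shows "g \<in> borel_measurable borel" "cmod (g t) \<le> B * indicator {-a..a} t" "t \<notin> {-a..a} \<Longrightarrow> g t = 0"
proof -
  show "g \<in> borel_measurable borel" "cmod (g t) \<le> B * indicator {-a..a} t"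
    using assms by (auto simp: band_def)
  then show "t \<notin> {-a..a} \<Longrightarrow> g t = 0" by (auto simp: indicator_def split: if_splits)
qed

lemma integrable_box: "integrable lborel (\<lambda>t::real. B * indicator {a..b} t :: real)"
  by (intro integrable_mult_right) (simp add: integrable_indicator_iff emeasure_lborel_Icc_eq)

lemma integrable_band_mult:
  fixes h :: "real \<Rightarrow> complex"
  assumes g: "band a B g" and h: "h \<in> borel_measurable borel"
    and hb: "\<And>t. t \<in> {-a..a} \<Longrightarrow> cmod (h t) \<le> C"
  shows "integrable lborel (\<lambda>t. g t * h t)"
    and "cmod (LINT t|lborel. g t * h t) \<le> (LINT t|lborel. B * C * indicator {-a..a} t)"
proof -
  note [measurable] = bandD(1)[OF g] h
  have le: "cmod (g t * h t) \<le> B * C * indicator {-a..a} t" for t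
  proof (cases "t \<in> {-a..a}")
    case True
    have "cmod (g t) \<le> B" using bandD(2)[OF g, of t] True by simp
    then have "cmod (g t) * cmod (h t) \<le> B * C"
      using hb[OF True] by (intro mult_mono) (auto intro: order_trans[OF norm_ge_zero])
    then show ?thesis using True by (simp add: norm_mult)
  qed (use bandD(3)[OF g] in auto)
  show "integrable lborel (\<lambda>t. g t * h t)"
    by (rule Bochner_Integration.integrable_bound[OF integrable_box[of "B * C" "-a" a]])
      (auto intro!: AE_I2 order_trans[OF le] abs_ge_self)
  show "cmod (LINT t|lborel. g t * h t) \<le> (LINT t|lborel. B * C * indicator {-a..a} t)"
    by (rule Bochner_Integration.integral_norm_bound_integral) (use le integrable_box \<open>integrable lborel (\<lambda>t. g t * h t)\<close> in auto)
qed

lemma cmod_fourier_exp: "cmod (fexp t z) = exp (- (2 * pi * t * Im z))"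
  by simp

lemma cmod_fourier_exp_le:
  assumes "t \<in> {-a..a}"
  shows "cmod (fexp t z) \<le> exp (2 * pi * a * \<bar>Im z\<bar>)"
proof -
  have "- (t * Im z) \<le> \<bar>t\<bar> * \<bar>Im z\<bar>" by (metis abs_ge_minus_self abs_mult)
  also have "\<dots> \<le> a * \<bar>Im z\<bar>" using assms by (intro mult_right_mono) auto
  finally have "2 * pi * (- (t * Im z)) \<le> 2 * pi * (a * \<bar>Im z\<bar>)" by (intro mult_left_mono) auto
  then show ?thesis unfolding cmod_fourier_exp by (simp add: mult_ac)
qed

lemma integrable_ft:
  assumes "band a B g"
  shows "integrable lborel (\<lambda>t. g t * fexp t z)"
  by (rule integrable_band_mult[OF assms _ cmod_fourier_exp_le]) auto

lemma ft_bound: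
  assumes "band a B g" "0 \<le> a"
  shows "cmod (ft g z) \<le> 2 * a * B * exp (2 * pi * a * \<bar>Im z\<bar>)"
proof -
  have "cmod (ft g z) \<le> (LINT t|lborel. B * exp (2 * pi * a * \<bar>Im z\<bar>) * indicator {-a..a} t)"
    unfolding ft_def by (rule integrable_band_mult[OF assms(1) _ cmod_fourier_exp_le]) auto
  also have "\<dots> = 2 * a * B * exp (2 * pi * a * \<bar>Im z\<bar>)" using assms(2) by simp
  finally show ?thesis .
qed

text \<open>The exponential series is integrated term by term. Its terms are dominated by (2 pi a
  |z|)^n / n!, so the transform is a power series converging on the whole plane.\<close>

lemma ft_holomorphic:
  assumes g: "band a B g" and a: "0 \<le> a"
  shows "ft g holomorphic_on UNIV"
proof -
  have B: "0 \<le> B" using order_trans[OF norm_ge_zero bandD(2)[OF g, of 0]] a by simp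
  define c where "c n = (LINT t|lborel. g t * ((2 * of_real pi * \<i> * of_real t) ^ n / fact n))" for n
  have sums: "(\<lambda>n. c n * (z - 0) ^ n) sums ft g z" for z
  proof -
    define f where "f n t = g t * ((2 * of_real pi * \<i> * of_real t) ^ n / fact n * z ^ n)" for n t
    have b: "cmod ((2 * of_real pi * \<i> * of_real t) ^ n / fact n * z ^ n) \<le> (2 * pi * a * cmod z) ^ n / fact n"
      if "t \<in> {-a..a}" for n t
    proof -
      have "cmod ((2 * of_real pi * \<i> * of_real t) ^ n / fact n * z ^ n) = (2 * pi * \<bar>t\<bar> * cmod z) ^ n / fact n"
        by (simp add: norm_mult norm_divide norm_power power_mult_distrib)
      also have "\<dots> \<le> (2 * pi * a * cmod z) ^ n / fact n"
        using that by (intro divide_right_mono power_mono mult_mono) auto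
      finally show ?thesis .
    qed
    have [measurable]: "g \<in> borel_measurable borel" by (rule bandD(1)[OF g])
    have int: "integrable lborel (f n)" for n
      unfolding f_def by (rule integrable_band_mult[OF g _ b]) auto
    have s1: "AE t in lborel. summable (\<lambda>n. norm (f n t))"
    proof (rule AE_I2)
      fix t
      have "summable (\<lambda>n. cmod (g t) * ((2 * pi * \<bar>t\<bar> * cmod z) ^ n / fact n))"
        using summable_exp[of "2 * pi * \<bar>t\<bar> * cmod z"] by (intro summable_mult) (simp add: divide_inverse mult.commute)
      then show "summable (\<lambda>n. norm (f n t))"
        by (simp add: f_def norm_mult norm_divide norm_power power_mult_distrib)
    qed
    have s2: "summable (\<lambda>n. LINT t|lborel. norm (f n t))"
    proof (rule summable_comparison_test)
      show "summable (\<lambda>n. 2 * a * B * ((2 * pi * a * cmod z) ^ n / fact n))"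
        using summable_exp[of "2 * pi * a * cmod z"] by (intro summable_mult) (simp add: divide_inverse mult.commute)
      have "norm (LINT t|lborel. norm (f n t)) \<le> 2 * a * B * ((2 * pi * a * cmod z) ^ n / fact n)" for n
      proof -
        have "(LINT t|lborel. norm (f n t)) \<le> (LINT t|lborel. B * ((2 * pi * a * cmod z) ^ n / fact n) * indicator {-a..a} t)"
        proof (rule integral_mono[OF integrable_norm[OF int] integrable_box])
          fix t
          show "norm (f n t) \<le> B * ((2 * pi * a * cmod z) ^ n / fact n) * indicator {-a..a} t"
          proof (cases "t \<in> {-a..a}")
            case True
            have "cmod (g t) \<le> B" using bandD(2)[OF g, of t] True by simp
            then have "norm (f n t) \<le> B * ((2 * pi * a * cmod z) ^ n / fact n)"
              unfolding f_def norm_mult[of "g t"] using b[OF True] B by (intro mult_mono) auto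
            then show ?thesis using True by simp
          qed (simp add: f_def bandD(3)[OF g])
        qed
        also have "\<dots> = 2 * a * B * ((2 * pi * a * cmod z) ^ n / fact n)" using a by simp
        finally show ?thesis by simp
      qed
      then show "\<exists>N. \<forall>n\<ge>N. norm (LINT t|lborel. norm (f n t)) \<le> 2 * a * B * ((2 * pi * a * cmod z) ^ n / fact n)"
        by blast
    qed
    have "(\<lambda>n. LINT t|lborel. f n t) sums (LINT t|lborel. (\<Sum>n. f n t))"
      by (rule sums_integral[OF int s1 s2])
    moreover have "(\<Sum>n. f n t) = g t * fexp t z" for t
    proof -
      have "(\<lambda>n. (2 * of_real pi * \<i> * of_real t * z) ^ n /\<^sub>R fact n) sums fexp t z"
        by (rule exp_converges)
      then have "(\<lambda>n. g t * ((2 * of_real pi * \<i> * of_real t * z) ^ n /\<^sub>R fact n)) sums (g t * fexp t z)"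
        by (rule sums_mult)
      moreover have "(\<lambda>n. g t * ((2 * of_real pi * \<i> * of_real t * z) ^ n /\<^sub>R fact n)) = (\<lambda>n. f n t)"
        by (simp add: f_def fun_eq_iff power_mult_distrib scaleR_conv_of_real divide_inverse)
      ultimately show ?thesis by (simp add: sums_iff)
    qed
    moreover have "(LINT t|lborel. f n t) = c n * (z - 0) ^ n" for n
      by (simp add: f_def c_def mult.assoc[symmetric] del: times_divide_eq_left times_divide_eq_right)
    ultimately show ?thesis by (simp add: ft_def)
  qed
  have "ft g field_differentiable at z" for z
  proof -
    have "ft g holomorphic_on ball 0 (cmod z + 1)"
      by (rule power_series_holomorphic[where a = c]) (use sums in auto)
    then show ?thesis
      by (rule holomorphic_on_imp_differentiable_at) auto
  qed
  then show ?thesis by (auto simp: holomorphic_on_def field_differentiable_at_within)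
qed

lemma LINT_exp:
  fixes c :: complex and a b :: real
  assumes "a \<le> b" "c \<noteq> 0"
  shows "(LINT t:{a..b}|lborel. exp (c * of_real t)) = (exp (c * of_real b) - exp (c * of_real a)) / c"
proof -
  have "((\<lambda>t. exp (c * of_real t) / c) has_vector_derivative exp (c * of_real t)) (at t within {a..b})" for t
    using assms(2) by (auto intro!: derivative_eq_intros has_vector_derivative_real_field)
  then have "((\<lambda>t. exp (c * of_real t)) has_integral (exp (c * of_real b) / c - exp (c * of_real a) / c)) {a..b}"
    using assms by (intro fundamental_theorem_of_calculus)
  moreover have "set_integrable lborel {a..b} (\<lambda>t. exp (c * of_real t))"
    by (intro borel_integrable_atLeastAtMost') (auto intro!: continuous_intros)
  ultimately show ?thesis
    by (simp add: set_borel_integral_eq_integral(2) integral_unique diff_divide_distrib)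
qed

lemma W_SO_fourier:
  "complex_of_real (W_SO x) = 1 + 1 / 2 * (LINT s:{-1..1}|lborel. exp (- (2 * of_real pi * \<i> * of_real x) * of_real s))"
proof (cases "x = 0")
  case True
  then show ?thesis by (simp add: W_SO_def set_lebesgue_integral_def scaleR_conv_of_real)
next
  case False
  have "(LINT s:{-1..1}|lborel. exp (- (2 * of_real pi * \<i> * of_real x) * of_real s))
      = (exp (- (2 * of_real pi * \<i> * of_real x)) - exp (2 * of_real pi * \<i> * of_real x)) / (- (2 * of_real pi * \<i> * of_real x))"
    using False by (subst LINT_exp) auto
  also have "exp (- (2 * of_real pi * \<i> * of_real x)) - exp (2 * of_real pi * \<i> * of_real x)
     = - 2 * \<i> * of_real (sin (2 * pi * x))"
    by (simp add: sin_exp_eq sin_of_real[symmetric] mult_ac minus_divide_left[symmetric] del: sin_of_real)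
      (simp add: field_simps)
  finally show ?thesis using False by (simp add: W_SO_def field_simps)
qed

text \<open>A majorant of product form bounds the inner integrals and the outer one at the same
  time; every exchange of two integrals below rests on it.\<close>

lemma integrable_product_dominated:
  fixes F :: "real \<Rightarrow> real \<Rightarrow> complex"
  assumes F[measurable]: "case_prod F \<in> borel_measurable (borel \<Otimes>\<^sub>M borel)"
    and u: "integrable lborel u" and v: "integrable lborel v"
    and le: "\<And>x t. cmod (F x t) \<le> u x * v t"
  shows "integrable (lborel \<Otimes>\<^sub>M lborel) (case_prod F)"
proof (rule lborel_pair.Fubini_integrable)
  have [measurable]: "u \<in> borel_measurable borel" "v \<in> borel_measurable borel"
    using u v by auto
  have Fx: "integrable lborel (F x)" for x
  proof (rule Bochner_Integration.integrable_bound)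
    show "integrable lborel (\<lambda>t. u x * v t)" by (intro integrable_mult_right v)
    show "AE t in lborel. norm (F x t) \<le> norm (u x * v t)"
      using order_trans[OF le abs_ge_self] by (intro AE_I2) simp
  qed simp
  then show "AE x in lborel. integrable lborel (\<lambda>y. case (x, y) of (x, y) \<Rightarrow> F x y)" by simp
  show "integrable lborel (\<lambda>x. LINT y|lborel. norm (case (x, y) of (x, y) \<Rightarrow> F x y))"
  proof (rule Bochner_Integration.integrable_bound)
    show "integrable lborel (\<lambda>x. u x * (LINT t|lborel. v t))" by (intro integrable_mult_left u)
    have "norm (LINT y|lborel. norm (F x y)) \<le> norm (u x * (LINT t|lborel. v t))" for x
    proof -
      have "(LINT y|lborel. norm (F x y)) \<le> (LINT y|lborel. u x * v y)"
        using Fx le v by (intro integral_mono integrable_norm) auto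
      then show ?thesis by (simp del: abs_mult)
    qed
    then show "AE x in lborel. norm (LINT y|lborel. norm (case (x, y) of (x, y) \<Rightarrow> F x y)) \<le> norm (u x * (LINT t|lborel. v t))"
      by simp
  qed simp
qed simp


section \<open>The integral equation, Parseval's identity and Fourier inversion\<close>

text \<open>Outside [- \<Delta>/2, \<Delta>/2] the density is 0 while its moving integral lives up
  to distance 1 beyond. The equation leaves that overhang free.\<close>

definition SO_solution :: "real \<Rightarrow> complex \<Rightarrow> (real \<Rightarrow> complex) \<Rightarrow> bool" where
  "SO_solution \<Delta> w g \<longleftrightarrow> (\<exists>B. band (\<Delta> / 2) B g) \<and>
     (\<forall>t\<in>{-\<Delta>/2..\<Delta>/2}. g t + 1 / 2 * (LINT s:{t - 1..t + 1}|lborel. g s)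
        = exp (- (2 * of_real pi * \<i> * cnj w * of_real t)))"

text \<open>Kept free of division so that u = 0 is covered; this is the shape in which
  \<open>reproducing\<close> asks for its kernel, with r = 2 pi a.\<close>

lemma ft_box_eq:
  assumes "0 \<le> a"
  shows "2 * of_real pi * \<i> * u * ft (indicator {-a..a}) u
    = exp (\<i> * of_real (2 * pi * a) * u) - exp (- (\<i> * of_real (2 * pi * a) * u))"
proof (cases "u = 0")
  case False
  have "ft (indicator {-a..a}) u = (LINT t:{-a..a}|lborel. exp ((2 * of_real pi * \<i> * u) * of_real t))"
    unfolding ft_def set_lebesgue_integral_def
    by (intro Bochner_Integration.integral_cong) (auto simp: indicator_def mult_ac)
  also have "\<dots> = (exp (2 * of_real pi * \<i> * u * of_real a) - exp (2 * of_real pi * \<i> * u * of_real (-a))) / (2 * of_real pi * \<i> * u)"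
    using False assms by (intro LINT_exp) auto
  finally show ?thesis using False by (simp add: mult_ac)
qed simp

context decaying_entire
begin

definition fourier :: "real \<Rightarrow> complex" where
  "fourier t = (LINT x|lborel. \<Phi> (of_real x) * nexp t x)"

lemma fourier_measurable [measurable]: "fourier \<in> borel_measurable borel"
  unfolding fourier_def[abs_def] by measurable

lemma fourier_eq_0:
  assumes "\<sigma> \<le> \<bar>2 * pi * t\<bar>"
  shows "fourier t = 0"
  using fourier_vanishes[of "- (2 * pi * t)"] assms by (simp add: fourier_def mult_ac)

text \<open>Parseval's identity in the form that Fubini gives: one factor is absolutely integrable,
  the other bounded with compact support.\<close>

lemma LINT_mult_ft:
  assumes g: "band a B g"
  shows "(LINT x|lborel. \<Phi> (of_real x) * (LINT t|lborel. g t * nexp t x))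
     = (LINT t|lborel. g t * fourier t)"
    and "integrable lborel (\<lambda>x. \<Phi> (of_real x) * (LINT t|lborel. g t * nexp t x))"
proof -
  note [measurable] = bandD(1)[OF g]
  have int: "integrable (lborel \<Otimes>\<^sub>M lborel) (\<lambda>(x, t). \<Phi> (of_real x) * (g t * nexp t x))"
  proof (rule integrable_product_dominated[where u = "\<lambda>x. cmod (\<Phi> (of_real x))" and v = "\<lambda>t. B * indicator {-a..a} t"])
    show "cmod (\<Phi> (of_real x) * (g t * nexp t x))
        \<le> cmod (\<Phi> (of_real x)) * (B * indicator {-a..a} t)" for x t
      using bandD(2)[OF g, of t] by (simp add: norm_mult mult_left_mono)
    show "integrable lborel (\<lambda>x. cmod (\<Phi> (of_real x)))" by (intro integrable_norm integrable_on_real)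
    show "integrable lborel (\<lambda>t. B * indicator {-a..a} t)" by (rule integrable_box)
  qed measurable
  from lborel_pair.integrable_fst[OF int]
  show "integrable lborel (\<lambda>x. \<Phi> (of_real x) * (LINT t|lborel. g t * nexp t x))"
    by simp
  have "(LINT x|lborel. \<Phi> (of_real x) * (LINT t|lborel. g t * nexp t x))
     = (LINT x|lborel. (LINT t|lborel. \<Phi> (of_real x) * (g t * nexp t x)))"
    by simp
  also have "\<dots> = (LINT t|lborel. (LINT x|lborel. \<Phi> (of_real x) * (g t * nexp t x)))"
    using lborel_pair.Fubini_integral[OF int] by simp
  also have "\<dots> = (LINT t|lborel. g t * fourier t)"
    by (simp add: fourier_def mult.left_commute)
  finally show "(LINT x|lborel. \<Phi> (of_real x) * (LINT t|lborel. g t * nexp t x))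
     = (LINT t|lborel. g t * fourier t)" .
qed

text \<open>The kernel E of \<open>reproducing\<close> can be taken as the transform of the
  indicator of [- a, a]. Parseval then moves that indicator onto \<open>fourier\<close>, and the
  formula holds at complex w as well because \<open>reproducing\<close> does.\<close>

lemma inversion:
  assumes a: "\<sigma> \<le> 2 * pi * a"
  shows "(LINT t:{-a..a}|lborel. fourier t * fexp t w) = \<Phi> w"
proof -
  have a0: "0 \<le> a" using a \<sigma> by (meson order_trans pi_gt_zero zero_le_mult_iff mult_pos_pos zero_less_numeral not_less)
  define g where "g t = indicator {-a..a} t * fexp t w" for t
  have gb: "band a (exp (2 * pi * a * \<bar>Im w\<bar>)) g"
    unfolding band_def
  proof (intro conjI allI)
    show "g \<in> borel_measurable borel" unfolding g_def[abs_def] by measurable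
    show "cmod (g t) \<le> exp (2 * pi * a * \<bar>Im w\<bar>) * indicator {-a..a} t" for t
      using cmod_fourier_exp_le[of t a w] by (auto simp: g_def indicator_def)
  qed
  let ?E = "\<lambda>u. ft (indicator {-a..a}) u"
  have box: "band a 1 (indicator {-a..a})"
    by (auto simp: band_def indicator_def)
  have E: "(LINT t|lborel. g t * nexp t x) = ?E (of_real x - w)" for x
  proof -
    \<comment> \<open>The reflection t -> - t adjusts the sign of the exponent; the box is
      symmetric.\<close>
    have "?E (of_real x - w) = (LINT t|lborel. indicator {-a..a} (- t) * fexp (- t) (of_real x - w))"
      unfolding ft_def using lborel_integral_real_affine[where c = "-1" and t = 0 and f = "\<lambda>t. indicator {-a..a} t * fexp t (of_real x - w)"]
      by simp
    also have "\<dots> = (LINT t|lborel. g t * nexp t x)"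
      by (intro Bochner_Integration.integral_cong)
        (auto simp: g_def indicator_def algebra_simps simp flip: exp_add exp_minus)
    finally show ?thesis by simp
  qed
  have "(LINT x|lborel. \<Phi> (of_real x) * ?E (of_real x - w)) = \<Phi> w"
  proof (rule reproducing)
    show "\<sigma> \<le> 2 * pi * a" by (rule a)
    show "?E holomorphic_on UNIV" by (rule ft_holomorphic[OF box a0])
    show "integrable lborel (\<lambda>x. \<Phi> (of_real x) * ?E (of_real x - w))"
      using LINT_mult_ft(2)[OF gb] by (simp add: E)
  qed (use ft_box_eq[OF a0] in auto)
  moreover have "(LINT t:{-a..a}|lborel. fourier t * fexp t w) = (LINT t|lborel. g t * fourier t)"
    unfolding set_lebesgue_integral_def
    by (intro Bochner_Integration.integral_cong) (auto simp: g_def indicator_def)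
  ultimately show ?thesis using LINT_mult_ft(1)[OF gb] by (simp add: E)
qed

end

lemma band_nonneg:
  assumes "band a B g" "0 \<le> a"
  shows "0 \<le> B" "cmod (g t) \<le> B"
proof -
  show "0 \<le> B" using order_trans[OF norm_ge_zero bandD(2)[OF assms(1), of 0]] assms(2) by simp
  then show "cmod (g t) \<le> B"
    using bandD(2)[OF assms(1), of t] by (cases "t \<in> {-a..a}") auto
qed

text \<open>The convolution theorem for a box: with r = t + s, the condition |s| <= 1 becomes t in
  [r - 1, r + 1]. Through it the sinc part of the weight turns into the moving integral.\<close>

lemma LINT_ft_mult_window:
  fixes x :: real
  assumes g: "band a B g" and a: "0 \<le> a"
  shows "(LINT t|lborel. g t * nexp t x)
      * (LINT s:{-1..1}|lborel. exp (- (2 * of_real pi * \<i> * of_real x) * of_real s))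
    = (LINT r|lborel. (LINT s:{r - 1..r + 1}|lborel. g s) * nexp r x)"
proof -
  note [measurable] = bandD(1)[OF g]
  let ?e = "\<lambda>t. nexp t x :: complex"
  have tr: "?e t * (LINT s:{-1..1}|lborel. exp (- (2 * of_real pi * \<i> * of_real x) * of_real s))
      = (LINT r|lborel. indicator {r - 1..r + 1} t * ?e r)" for t
  proof -
    have "(LINT r|lborel. indicator {r - 1..r + 1} t * ?e r)
        = (LINT s|lborel. indicator {t + s - 1..t + s + 1} t * ?e (t + s))"
      using lborel_integral_real_affine[where c = 1 and t = t and f = "\<lambda>r. indicator {r - 1..r + 1} t * ?e r"]
      by simp
    also have "\<dots> = (LINT s|lborel. ?e t * (indicator {-1..1} s *\<^sub>R exp (- (2 * of_real pi * \<i> * of_real x) * of_real s)))"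
      by (intro Bochner_Integration.integral_cong)
        (auto simp: indicator_def algebra_simps exp_add[symmetric] simp flip: exp_minus)
    also have "\<dots> = ?e t * (LINT s:{-1..1}|lborel. exp (- (2 * of_real pi * \<i> * of_real x) * of_real s))"
      unfolding set_lebesgue_integral_def by (rule integral_mult_right_zero)
    finally show ?thesis by simp
  qed
  have int: "integrable (lborel \<Otimes>\<^sub>M lborel) (\<lambda>(t, r). g t * (indicator {r - 1..r + 1} t * ?e r))"
  proof (rule integrable_product_dominated[where u = "\<lambda>t. B * indicator {-a..a} t" and v = "\<lambda>r. 1 * indicator {-a-1..a+1} r"])
    have "(\<lambda>(t, r). g t * ((if r - 1 \<le> t \<and> t \<le> r + 1 then 1 else 0) * ?e r)) \<in> borel_measurable (borel \<Otimes>\<^sub>M borel)"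
      by measurable
    then show "(\<lambda>(t, r). g t * (indicator {r - 1..r + 1} t * ?e r)) \<in> borel_measurable (borel \<Otimes>\<^sub>M borel)"
      by (simp add: indicator_def)
    show "cmod (g t * (indicator {r - 1..r + 1} t * ?e r)) \<le> (B * indicator {-a..a} t) * (1 * indicator {-a-1..a+1} r)" for t r
      using bandD(2)[OF g, of t] band_nonneg[OF g a] by (auto simp: norm_mult indicator_def split: if_splits)
  qed (rule integrable_box)+
  have "(LINT t|lborel. g t * ?e t) * (LINT s:{-1..1}|lborel. exp (- (2 * of_real pi * \<i> * of_real x) * of_real s))
     = (LINT t|lborel. g t * (?e t * (LINT s:{-1..1}|lborel. exp (- (2 * of_real pi * \<i> * of_real x) * of_real s))))"
    by (simp flip: integral_mult_left_zero mult.assoc)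
  also have "\<dots> = (LINT t|lborel. (LINT r|lborel. g t * (indicator {r - 1..r + 1} t * ?e r)))"
    unfolding tr by simp
  also have "\<dots> = (LINT r|lborel. (LINT t|lborel. g t * (indicator {r - 1..r + 1} t * ?e r)))"
    using lborel_pair.Fubini_integral[OF int] by simp
  also have "\<dots> = (LINT r|lborel. (LINT s:{r - 1..r + 1}|lborel. g s) * ?e r)"
  proof (intro Bochner_Integration.integral_cong refl)
    fix r
    have "(LINT t|lborel. g t * (indicator {r - 1..r + 1} t * ?e r)) = (LINT t|lborel. (indicator {r - 1..r + 1} t *\<^sub>R g t) * ?e r)"
      by (intro Bochner_Integration.integral_cong) (auto simp: indicator_def)
    also have "\<dots> = (LINT s:{r - 1..r + 1}|lborel. g s) * ?e r"
      unfolding set_lebesgue_integral_def by (rule integral_mult_left_zero)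
    finally show "(LINT t|lborel. g t * (indicator {r - 1..r + 1} t * ?e r)) = (LINT s:{r - 1..r + 1}|lborel. g s) * ?e r" .
  qed
  finally show ?thesis .
qed

lemma band_cnj: "band a B g \<Longrightarrow> band a B (\<lambda>t. cnj (g t))"
  by (auto simp: band_def intro: measurable_compose[OF _ borel_measurable_continuous_onI[OF continuous_on_cnj[OF continuous_on_id]]])

lemma window_measurable:
  fixes g :: "real \<Rightarrow> complex"
  assumes [measurable]: "g \<in> borel_measurable borel"
  shows "(\<lambda>r. LINT s:{r - 1..r + 1}|lborel. g s) \<in> borel_measurable borel"
proof -
  have "(\<lambda>r. LINT s|lborel. (if r - 1 \<le> s \<and> s \<le> r + 1 then g s else 0)) \<in> borel_measurable borel"
    by measurable
  moreover have "(\<lambda>s. if r - 1 \<le> s \<and> s \<le> r + 1 then g s else 0) = (\<lambda>s. indicator {r - 1..r + 1} s *\<^sub>R g s)" for r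
    by (auto simp: indicator_def)
  ultimately show ?thesis by (simp add: set_lebesgue_integral_def)
qed

lemma band_window:
  assumes g: "band a B g" and a: "0 \<le> a"
  shows "band (a + 1) (2 * B) (\<lambda>r. LINT s:{r - 1..r + 1}|lborel. g s)"
proof -
  note [measurable] = bandD(1)[OF g]
  have B: "0 \<le> B" using order_trans[OF norm_ge_zero bandD(2)[OF g, of 0]] a by simp
  have "cmod (LINT s:{r - 1..r + 1}|lborel. g s) \<le> 2 * B * indicator {-(a+1)..a+1} r" for r
  proof (cases "r \<in> {-(a+1)..a+1}")
    case True
    have "cmod (LINT s:{r - 1..r + 1}|lborel. g s) \<le> (LINT s|lborel. B * indicator {r - 1..r + 1} s)"
      unfolding set_lebesgue_integral_def
    proof (rule Bochner_Integration.integral_norm_bound_integral)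
      show "integrable lborel (\<lambda>s. indicator {r - 1..r + 1} s *\<^sub>R g s)"
        using integrable_band_mult(1)[OF g, of "\<lambda>_. 1" 1] by (intro integrable_mult_indicator) auto
      show "norm (indicator {r - 1..r + 1} s *\<^sub>R g s) \<le> B * indicator {r - 1..r + 1} s" for s
        using band_nonneg(2)[OF g a, of s] by (auto simp: indicator_def)
    qed (rule integrable_box)
    then show ?thesis using True by simp
  next
    case False
    have "indicator {r - 1..r + 1} s *\<^sub>R g s = 0" for s
      using False bandD(3)[OF g, of s] by (auto simp: indicator_def)
    then have "(LINT s:{r - 1..r + 1}|lborel. g s) = 0"
      by (simp only: set_lebesgue_integral_def) simp
    then show ?thesis using False by simp
  qed
  then show ?thesis using window_measurable[of g] by (simp add: band_def)
qed

text \<open>On the real line the conjugated kernel times the weight is the transform of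
  \<open>d\<close>, the left side of the conjugated integral equation. Parseval pairs
  \<open>d\<close> with \<open>fourier\<close>; on the support of the latter \<open>d\<close> is the
  exponential \<open>fexp t w\<close>, and inversion finishes.\<close>

lemma (in decaying_entire) inner_SO_ft:
  assumes \<sigma>\<Delta>: "\<sigma> = pi * \<Delta>" and \<Delta>: "0 < \<Delta>" and g: "SO_solution \<Delta> w g"
  shows "inner_SO \<Phi> (ft g) = \<Phi> w"
proof -
  obtain B where B: "band (\<Delta> / 2) B g" using g by (auto simp: SO_solution_def)
  have B0: "0 \<le> B" using order_trans[OF norm_ge_zero bandD(2)[OF B, of 0]] \<Delta> by simp
  let ?g = "\<lambda>t. cnj (g t)"
  let ?e = "\<lambda>t x. nexp t x :: complex"
  have gb: "band (\<Delta> / 2) B ?g" by (rule band_cnj[OF B])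
  define win where "win r = (LINT s:{r - 1..r + 1}|lborel. ?g s)" for r
  have wb: "band (\<Delta> / 2 + 1) (2 * B) win"
    unfolding win_def[abs_def] using band_window[OF gb] \<Delta> by simp
  define d where "d r = ?g r + 1 / 2 * win r" for r
  have db: "band (\<Delta> / 2 + 1) (2 * B) d"
    unfolding band_def
  proof (intro conjI allI)
    note [measurable] = bandD(1)[OF gb] bandD(1)[OF wb]
    show "d \<in> borel_measurable borel" unfolding d_def[abs_def] by measurable
    fix t
    have "cmod (d t) \<le> cmod (g t) + cmod (win t) / 2"
      unfolding d_def using norm_triangle_ineq[of "?g t" "1 / 2 * win t"] by (simp add: norm_mult)
    also have "\<dots> \<le> 2 * B * indicator {-(\<Delta> / 2 + 1)..\<Delta> / 2 + 1} t"
      using bandD(2)[OF wb, of t] bandD(3)[OF B, of t] band_nonneg(2)[OF B, of t] \<Delta>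
      by (cases "t \<in> {-(\<Delta> / 2 + 1)..\<Delta> / 2 + 1}") auto
    finally show "cmod (d t) \<le> 2 * B * indicator {-(\<Delta> / 2 + 1)..\<Delta> / 2 + 1} t" .
  qed
  have ig: "integrable lborel (\<lambda>t. ?g t * ?e t x)" and iw: "integrable lborel (\<lambda>t. win t * ?e t x)" for x
    by (intro integrable_band_mult(1)[OF gb, where C = 1] integrable_band_mult(1)[OF wb, where C = 1]; simp)+
  have "cnj (ft g (of_real x)) * of_real (W_SO x) = (LINT t|lborel. d t * ?e t x)" for x
  proof -
    have "cnj (ft g (of_real x)) = (LINT t|lborel. cnj (g t * fexp t (of_real x)))"
      unfolding ft_def by (rule Bochner_Integration.integral_cnj[symmetric])
    also have "\<dots> = (LINT t|lborel. ?g t * ?e t x)"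
      by (simp add: exp_cnj)
    finally have c: "cnj (ft g (of_real x)) = (LINT t|lborel. ?g t * ?e t x)" .
    have "cnj (ft g (of_real x)) * of_real (W_SO x)
       = (LINT t|lborel. ?g t * ?e t x) + 1 / 2 * (LINT t|lborel. win t * ?e t x)"
      unfolding c W_SO_fourier win_def LINT_ft_mult_window[OF gb less_imp_le[OF half_gt_zero[OF \<Delta>]], symmetric] by (simp add: algebra_simps)
    also have "\<dots> = (LINT t|lborel. ?g t * ?e t x + 1 / 2 * (win t * ?e t x))"
      using ig iw by (subst Bochner_Integration.integral_add) auto
    also have "\<dots> = (LINT t|lborel. d t * ?e t x)" by (simp add: d_def algebra_simps)
    finally show ?thesis .
  qed
  then have "inner_SO \<Phi> (ft g) = (LINT x|lborel. \<Phi> (of_real x) * (LINT t|lborel. d t * ?e t x))"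
    by (simp add: inner_SO_def mult.assoc)
  also have "\<dots> = (LINT t|lborel. d t * fourier t)" by (rule LINT_mult_ft(1)[OF db])
  also have "\<dots> = (LINT t:{-(\<Delta>/2)..\<Delta>/2}|lborel. fourier t * fexp t w)"
    unfolding set_lebesgue_integral_def
  proof (intro Bochner_Integration.integral_cong refl)
    fix t :: real
    show "d t * fourier t = indicator {-(\<Delta>/2)..\<Delta>/2} t *\<^sub>R (fourier t * fexp t w)"
    proof (cases "t \<in> {-(\<Delta>/2)..\<Delta>/2}")
      case True
      have "win t = cnj (LINT s:{t - 1..t + 1}|lborel. g s)"
        unfolding win_def set_lebesgue_integral_def by (simp flip: Bochner_Integration.integral_cnj)
      then have "d t = cnj (g t + 1 / 2 * (LINT s:{t - 1..t + 1}|lborel. g s))"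
        by (simp add: d_def)
      also have "\<dots> = fexp t w"
        using g True by (simp add: SO_solution_def exp_cnj mult_ac)
      finally show ?thesis using True by simp
    next
      case False
      \<comment> \<open>The equation says nothing about \<open>d\<close> here, but the transform of
        \<open>\<Phi>\<close> is 0.\<close>
      then have "\<Delta> / 2 \<le> \<bar>t\<bar>" by auto
      then have "\<sigma> \<le> \<bar>2 * pi * t\<bar>" using \<sigma>\<Delta> by (simp add: abs_mult mult.commute)
      then show ?thesis using False by (simp add: fourier_eq_0)
    qed
  qed
  also have "\<dots> = \<Phi> w" by (rule inversion) (simp add: \<sigma>\<Delta>)
  finally show ?thesis .
qed

section \<open>The reproducing property\<close>

lemma band_box: "band a 1 (indicator {-a..a})"
  by (auto simp: band_def indicator_def)

lemma ft_box_decay: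
  assumes "0 \<le> a"
  shows "cmod u * cmod (ft (indicator {-a..a}) u) \<le> exp (2 * pi * a * \<bar>Im u\<bar>) / pi"
proof -
  let ?E = "ft (indicator {-a..a}) u"
  have "2 * pi * (cmod u * cmod ?E) = cmod (2 * of_real pi * \<i> * u * ?E)"
    by (simp add: norm_mult)
  also have "\<dots> \<le> cmod (exp (\<i> * of_real (2 * pi * a) * u)) + cmod (exp (- (\<i> * of_real (2 * pi * a) * u)))"
    unfolding ft_box_eq[OF assms] by (rule norm_triangle_ineq4)
  also have "\<dots> \<le> exp (2 * pi * a * \<bar>Im u\<bar>) + exp (2 * pi * a * \<bar>Im u\<bar>)"
  proof (intro add_mono)
    show "cmod (exp (\<i> * of_real (2 * pi * a) * u)) \<le> exp (2 * pi * a * \<bar>Im u\<bar>)"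
      using cmod_fourier_exp_le[of a a u] assms by (simp add: mult_ac)
    show "cmod (exp (- (\<i> * of_real (2 * pi * a) * u))) \<le> exp (2 * pi * a * \<bar>Im u\<bar>)"
      using cmod_fourier_exp_le[of "-a" a u] assms by (simp add: mult_ac)
  qed
  finally show ?thesis by (simp add: field_simps)
qed

text \<open>The bound does not depend on the end points, so it can be integrated over a family of
  intervals.\<close>

lemma cmod_LINT_exp_interval:
  fixes x a b :: real
  assumes "x \<noteq> 0"
  shows "\<bar>x\<bar> * cmod (LINT t:{a..b}|lborel. fexp t (of_real x)) \<le> 1"
proof (cases "a \<le> b")
  case True
  have "(LINT t:{a..b}|lborel. fexp t (of_real x))
      = (LINT t:{a..b}|lborel. exp ((2 * of_real pi * \<i> * of_real x) * of_real t))"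
    by (simp add: mult_ac)
  also have "\<dots> = (exp (2 * of_real pi * \<i> * of_real x * of_real b) - exp (2 * of_real pi * \<i> * of_real x * of_real a)) / (2 * of_real pi * \<i> * of_real x)"
    using assms True by (intro LINT_exp) auto
  finally have "cmod (LINT t:{a..b}|lborel. fexp t (of_real x))
     = cmod (exp (2 * of_real pi * \<i> * of_real x * of_real b) - exp (2 * of_real pi * \<i> * of_real x * of_real a)) / (2 * pi * \<bar>x\<bar>)"
    by (simp add: norm_divide norm_mult)
  also have "\<dots> \<le> (1 + 1) / (2 * pi * \<bar>x\<bar>)"
    using norm_triangle_ineq4[of "exp (2 * of_real pi * \<i> * of_real x * of_real b)" "exp (2 * of_real pi * \<i> * of_real x * of_real a)"]
    by (intro divide_right_mono) auto
  finally have "\<bar>x\<bar> * cmod (LINT t:{a..b}|lborel. fexp t (of_real x)) \<le> \<bar>x\<bar> * ((1 + 1) / (2 * pi * \<bar>x\<bar>))"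
    by (intro mult_left_mono) auto
  also have "\<dots> = 1 / pi" using assms by (simp add: field_simps)
  also have "\<dots> \<le> 1" using pi_gt3 by simp
  finally show ?thesis .
qed (simp add: set_lebesgue_integral_def)

text \<open>No smoothness of g is assumed. After exchanging the integrals the inner one is an
  exponential over an interval that depends on s, and it is O(1/|x|) uniformly in s.\<close>

lemma ft_window_decay:
  assumes g: "band a B g" and a: "0 \<le> a"
  shows "\<bar>x\<bar> * cmod (ft (\<lambda>t. indicator {-a..a} t * (LINT s:{t - 1..t + 1}|lborel. g s)) (of_real x)) \<le> 2 * a * B"
proof (cases "x = 0")
  case True
  then show ?thesis using a band_nonneg[OF g a] by simp
next
  case x: False
  note [measurable] = bandD(1)[OF g]
  let ?e = "\<lambda>t. fexp t (of_real x) :: complex"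
  let ?c = "\<lambda>s t. indicator {-a..a} t * indicator {s - 1..s + 1} t :: complex"
  have int: "integrable (lborel \<Otimes>\<^sub>M lborel) (\<lambda>(t, s). g s * (?c s t * ?e t))"
  proof (rule integrable_product_dominated[where v = "\<lambda>t. B * indicator {-a..a} t" and u = "\<lambda>r. 1 * indicator {-a..a} r"])
    have "(\<lambda>(t, s). g s * (indicator {-a..a} t * (if s - 1 \<le> t \<and> t \<le> s + 1 then 1 else 0) * ?e t)) \<in> borel_measurable (borel \<Otimes>\<^sub>M borel)"
      by measurable
    then show "(\<lambda>(t, s). g s * (?c s t * ?e t)) \<in> borel_measurable (borel \<Otimes>\<^sub>M borel)"
      by (simp add: indicator_def)
    show "cmod (g s * (?c s t * ?e t)) \<le> (1 * indicator {-a..a} t) * (B * indicator {-a..a} s)" for t s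
      using bandD(2)[OF g, of s] band_nonneg[OF g a] by (auto simp: norm_mult indicator_def split: if_splits)
  qed (rule integrable_box)+
  have "ft (\<lambda>t. indicator {-a..a} t * (LINT s:{t - 1..t + 1}|lborel. g s)) (of_real x)
     = (LINT t|lborel. (LINT s|lborel. g s * (?c s t * ?e t)))"
    unfolding ft_def
  proof (intro Bochner_Integration.integral_cong refl)
    fix t
    have "(LINT s|lborel. g s * (?c s t * ?e t)) = (LINT s|lborel. (indicator {-a..a} t * ?e t) * (indicator {t - 1..t + 1} s *\<^sub>R g s))"
      by (intro Bochner_Integration.integral_cong) (auto simp: indicator_def)
    also have "\<dots> = (indicator {-a..a} t * ?e t) * (LINT s:{t - 1..t + 1}|lborel. g s)"
      unfolding set_lebesgue_integral_def by (rule integral_mult_right_zero)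
    finally show "indicator {-a..a} t * (LINT s:{t - 1..t + 1}|lborel. g s) * ?e t = (LINT s|lborel. g s * (?c s t * ?e t))"
      by simp
  qed
  also have "\<dots> = (LINT s|lborel. (LINT t|lborel. g s * (?c s t * ?e t)))"
    using lborel_pair.Fubini_integral[OF int] by simp
  also have "\<dots> = (LINT s|lborel. g s * (LINT t:{max (-a) (s - 1)..min a (s + 1)}|lborel. ?e t))"
  proof (intro Bochner_Integration.integral_cong refl)
    fix s
    have "(LINT t|lborel. g s * (?c s t * ?e t)) = g s * (LINT t|lborel. ?c s t * ?e t)"
      by (rule integral_mult_right_zero)
    also have "(LINT t|lborel. ?c s t * ?e t) = (LINT t:{max (-a) (s - 1)..min a (s + 1)}|lborel. ?e t)"
      unfolding set_lebesgue_integral_def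
      by (intro Bochner_Integration.integral_cong) (auto simp: indicator_def)
    finally show "(LINT t|lborel. g s * (?c s t * ?e t)) = g s * (LINT t:{max (-a) (s - 1)..min a (s + 1)}|lborel. ?e t)" .
  qed
  finally have eq: "ft (\<lambda>t. indicator {-a..a} t * (LINT s:{t - 1..t + 1}|lborel. g s)) (of_real x)
     = (LINT s|lborel. g s * (LINT t:{max (-a) (s - 1)..min a (s + 1)}|lborel. ?e t))" .
  have meas: "(\<lambda>s. (LINT t:{max (-a) (s - 1)..min a (s + 1)}|lborel. ?e t)) \<in> borel_measurable borel"
  proof -
    have "(\<lambda>s. LINT t|lborel. (if max (-a) (s - 1) \<le> t \<and> t \<le> min a (s + 1) then ?e t else 0)) \<in> borel_measurable borel"
      by measurable
    moreover have "(\<lambda>t. if max (-a) (s - 1) \<le> t \<and> t \<le> min a (s + 1) then ?e t else 0)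
        = (\<lambda>t. indicator {max (-a) (s - 1)..min a (s + 1)} t *\<^sub>R ?e t)" for s
      by (auto simp: indicator_def)
    ultimately show ?thesis by (simp only: set_lebesgue_integral_def)
  qed
  have "cmod (LINT s|lborel. g s * (LINT t:{max (-a) (s - 1)..min a (s + 1)}|lborel. ?e t)) \<le> (LINT t|lborel. B * (1 / \<bar>x\<bar>) * indicator {-a..a} t)"
  proof (rule integrable_band_mult(2)[OF g meas])
    show "cmod (LINT t:{max (-a) (s - 1)..min a (s + 1)}|lborel. ?e t) \<le> 1 / \<bar>x\<bar>" for s
      using cmod_LINT_exp_interval[OF x, of "max (-a) (s - 1)" "min a (s + 1)"] x
      by (subst pos_le_divide_eq) (simp_all add: mult.commute)
  qed
  also have "\<dots> = 2 * a * B / \<bar>x\<bar>" using a by simp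
  finally show ?thesis unfolding eq using x by (simp add: field_simps)
qed

text \<open>The integral equation itself supplies the decay: on its support g is an exponential
  minus half a moving integral, and the transforms of both truncated parts are O(1/|x|) on the real
  line.\<close>

lemma SO_solution_decay:
  assumes g: "SO_solution \<Delta> w g" and \<Delta>: "0 < \<Delta>"
  obtains C where "0 < C" "\<And>x::real. cmod (ft g (of_real x)) \<le> C / (1 + \<bar>x\<bar>)"
proof -
  obtain B where B: "band (\<Delta> / 2) B g" using g by (auto simp: SO_solution_def)
  have a: "0 \<le> \<Delta> / 2" using \<Delta> by simp
  have B0: "0 \<le> B" by (rule band_nonneg[OF B a])
  note [measurable] = bandD(1)[OF B]
  let ?I = "{-(\<Delta>/2)..\<Delta>/2}"
  let ?win = "\<lambda>t. LINT s:{t - 1..t + 1}|lborel. g s"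
  let ?E = "exp (2 * pi * (\<Delta> / 2) * \<bar>Im w\<bar>)"
  have wb: "band (\<Delta> / 2 + 1) (2 * B) ?win" by (rule band_window[OF B a])
  note [measurable] = bandD(1)[OF wb]
  have wI: "band (\<Delta> / 2) (2 * B) (\<lambda>t. indicator ?I t * ?win t)"
    unfolding band_def
  proof (intro conjI allI)
    show "(\<lambda>t. indicator ?I t * ?win t) \<in> borel_measurable borel" by measurable
    show "cmod (indicator ?I t * ?win t) \<le> 2 * B * indicator ?I t" for t
      using band_nonneg(2)[OF wb, of t] a by (auto simp: indicator_def)
  qed
  have eq: "ft g (of_real x) = ft (indicator ?I) (of_real x - cnj w)
      - 1 / 2 * ft (\<lambda>t. indicator ?I t * ?win t) (of_real x)" for x
  proof -
    have "g t * fexp t (of_real x)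
       = indicator ?I t * fexp t (of_real x - cnj w)
         - 1 / 2 * (indicator ?I t * ?win t * fexp t (of_real x))" for t
    proof (cases "t \<in> ?I")
      case True
      then have "g t + 1 / 2 * ?win t = exp (- (2 * of_real pi * \<i> * cnj w * of_real t))"
        using g by (simp add: SO_solution_def)
      then have "g t = exp (- (2 * of_real pi * \<i> * cnj w * of_real t)) - 1 / 2 * ?win t"
        by (simp only: eq_diff_eq)
      then have "g t * fexp t (of_real x) =
        exp (- (2 * of_real pi * \<i> * cnj w * of_real t)) * fexp t (of_real x)
         - 1 / 2 * (?win t * fexp t (of_real x))"
        by (simp only: left_diff_distrib mult.assoc)
      also have "exp (- (2 * of_real pi * \<i> * cnj w * of_real t)) * fexp t (of_real x)
          = fexp t (of_real x - cnj w)"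
        by (simp add: algebra_simps flip: exp_add)
      finally show ?thesis using True by simp
    qed (simp add: bandD(3)[OF B])
    then have "ft g (of_real x) = (LINT t|lborel. indicator ?I t * fexp t (of_real x - cnj w)
         - 1 / 2 * (indicator ?I t * ?win t * fexp t (of_real x)))"
      unfolding ft_def by (simp only:)
    also have "\<dots> = ft (indicator ?I) (of_real x - cnj w) - (LINT t|lborel. 1 / 2 * (indicator ?I t * ?win t * fexp t (of_real x)))"
      unfolding ft_def by (intro Bochner_Integration.integral_diff integrable_mult_right integrable_ft[OF wI] integrable_ft[OF band_box])
    finally show ?thesis unfolding integral_mult_right_zero ft_def .
  qed
  have E1: "cmod (ft (indicator ?I) (of_real x - cnj w)) \<le> \<Delta> * ?E" for x
    using ft_bound[OF band_box a, of "of_real x - cnj w"] by simp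
  have E2: "\<bar>x\<bar> * cmod (ft (indicator ?I) (of_real x - cnj w)) \<le> ?E / pi + cmod w * (\<Delta> * ?E)" for x
  proof -
    have "\<bar>x\<bar> \<le> cmod (of_real x - cnj w) + cmod w"
      using norm_triangle_ineq[of "of_real x - cnj w" "cnj w"] by simp
    then have "\<bar>x\<bar> * cmod (ft (indicator ?I) (of_real x - cnj w))
      \<le> (cmod (of_real x - cnj w) + cmod w) * cmod (ft (indicator ?I) (of_real x - cnj w))"
      by (intro mult_right_mono) auto
    also have "\<dots> = cmod (of_real x - cnj w) * cmod (ft (indicator ?I) (of_real x - cnj w)) + cmod w * cmod (ft (indicator ?I) (of_real x - cnj w))"
      by (simp add: algebra_simps)
    also have "\<dots> \<le> ?E / pi + cmod w * (\<Delta> * ?E)"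
      using ft_box_decay[OF a, of "of_real x - cnj w"] E1 by (intro add_mono mult_left_mono) auto
    finally show ?thesis .
  qed
  \<comment> \<open>The first summand bounds the transform itself, the next three bound |x| times
    it, and the 1 makes C positive.\<close>
  define C where "C = \<Delta> * B + ?E / pi + cmod w * (\<Delta> * ?E) + \<Delta> * B + 1"
  have C0: "0 < C" using \<Delta> B0 by (auto simp: C_def intro!: add_nonneg_pos add_nonneg_nonneg)
  have "cmod (ft g (of_real x)) \<le> C / (1 + \<bar>x\<bar>)" for x
  proof -
    have "cmod (ft g (of_real x)) \<le> \<Delta> * B"
      using ft_bound[OF B a, of "of_real x"] by simp
    moreover have "\<bar>x\<bar> * cmod (ft g (of_real x)) \<le> ?E / pi + cmod w * (\<Delta> * ?E) + \<Delta> * B"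
    proof -
      have "\<bar>x\<bar> * cmod (ft g (of_real x)) \<le> \<bar>x\<bar> * (cmod (ft (indicator ?I) (of_real x - cnj w))
         + cmod (1 / 2 * ft (\<lambda>t. indicator ?I t * ?win t) (of_real x)))"
        unfolding eq by (intro mult_left_mono norm_triangle_ineq4) auto
      also have "\<dots> = \<bar>x\<bar> * cmod (ft (indicator ?I) (of_real x - cnj w)) + 1 / 2 * (\<bar>x\<bar> * cmod (ft (\<lambda>t. indicator ?I t * ?win t) (of_real x)))"
        by (simp add: norm_mult algebra_simps)
      also have "\<dots> \<le> (?E / pi + cmod w * (\<Delta> * ?E)) + 1 / 2 * (2 * (\<Delta> / 2) * B)"
        by (intro add_mono mult_left_mono E2 ft_window_decay[OF B a]) auto
      also have "\<dots> \<le> ?E / pi + cmod w * (\<Delta> * ?E) + \<Delta> * B" using \<Delta> B0 by simp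
      finally show ?thesis .
    qed
    ultimately have "cmod (ft g (of_real x)) * (1 + \<bar>x\<bar>) \<le> C"
      by (simp add: C_def algebra_simps)
    then show ?thesis by (subst pos_le_divide_eq) auto
  qed
  then show ?thesis using C0 that by blast
qed

lemma integrable_square_decay:
  assumes h[measurable]: "h \<in> borel_measurable borel" and le: "\<And>x::real. cmod (h x) \<le> C / (1 + \<bar>x\<bar>)"
  shows "integrable lborel (\<lambda>x. (cmod (h x))\<^sup>2)"
proof (rule Bochner_Integration.integrable_bound)
  show "integrable lborel (\<lambda>x::real. C\<^sup>2 * (1 / (1 + x\<^sup>2)))"
    by (intro integrable_mult_right integrable_inverse_one_plus_square)
  have "(cmod (h x))\<^sup>2 \<le> C\<^sup>2 * (1 / (1 + x\<^sup>2))" for x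
  proof -
    have "(cmod (h x))\<^sup>2 \<le> (C / (1 + \<bar>x\<bar>))\<^sup>2" by (intro power_mono le) auto
    also have "\<dots> = C\<^sup>2 / (1 + \<bar>x\<bar>)\<^sup>2" by (simp add: power_divide)
    also have "\<dots> \<le> C\<^sup>2 / (1 + x\<^sup>2)"
      by (intro divide_left_mono) (auto simp: power2_sum add_pos_nonneg)
    finally show ?thesis by simp
  qed
  then show "AE x in lborel. norm ((cmod (h x))\<^sup>2) \<le> norm (C\<^sup>2 * (1 / (1 + x\<^sup>2)))"
    by (intro AE_I2) (simp add: abs_mult)
qed simp

text \<open>The type is read off from the support of g, square integrability from the 1/(1 + |x|)
  decay.\<close>

lemma SO_solution_in_H_SO:
  assumes g: "SO_solution \<Delta> w g" and \<Delta>: "0 < \<Delta>"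
  shows "ft g \<in> H_SO \<Delta>"
proof -
  obtain B where B: "band (\<Delta> / 2) B g" using g by (auto simp: SO_solution_def)
  have a: "0 \<le> \<Delta> / 2" using \<Delta> by simp
  have hol: "ft g holomorphic_on UNIV" by (rule ft_holomorphic[OF B a])
  have "cmod (ft g z) \<le> \<Delta> * B * exp ((pi * \<Delta> + \<epsilon>) * cmod z)" if "0 < \<epsilon>" for \<epsilon> z
  proof -
    have "cmod (ft g z) \<le> \<Delta> * B * exp (pi * \<Delta> * \<bar>Im z\<bar>)" using ft_bound[OF B a, of z] by simp
    also have "\<dots> \<le> \<Delta> * B * exp ((pi * \<Delta> + \<epsilon>) * cmod z)"
    proof -
      have "pi * \<Delta> * \<bar>Im z\<bar> \<le> (pi * \<Delta> + \<epsilon>) * cmod z"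
        using \<Delta> that abs_Im_le_cmod[of z] by (intro mult_mono) auto
      then show ?thesis using \<Delta> band_nonneg(1)[OF B a] by (intro mult_left_mono) auto
    qed
    finally show ?thesis .
  qed
  then have et: "exp_type_le (ft g) (pi * \<Delta>)" using hol by (auto simp: exp_type_le_def)
  obtain C where C: "\<And>x::real. cmod (ft g (of_real x)) \<le> C / (1 + \<bar>x\<bar>)"
    using SO_solution_decay[OF g \<Delta>] by metis
  show ?thesis unfolding H_SO_iff
    using et integrable_square_decay[OF entire_measurable_on_real[OF hol] C] by simp
qed


lemma sinc_bound:
  "(1 + cmod u) * cmod (ft (indicator {-(1/2)..1/2}) u) \<le> 2 * exp (pi * \<bar>Im u\<bar>)"
proof -
  have "cmod (ft (indicator {-(1/2)..1/2}) u) \<le> exp (pi * \<bar>Im u\<bar>)"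
    using ft_bound[OF band_box[of "1/2"], of u] by simp
  moreover have "cmod u * cmod (ft (indicator {-(1/2)..1/2}) u) \<le> exp (pi * \<bar>Im u\<bar>) / pi"
    using ft_box_decay[of "1/2" u] by simp
  moreover have "exp (pi * \<bar>Im u\<bar>) / pi \<le> exp (pi * \<bar>Im u\<bar>) / 1"
    using pi_gt3 by (intro divide_left_mono) auto
  ultimately show ?thesis by (simp add: algebra_simps)
qed

text \<open>Dilating \<open>F\<close> by \<open>1 - \<delta>\<close> makes room in the exponential type for the \<open>\<epsilon>\<close> of the growth bound and for a cubed
  sinc factor.\<close>
lemma dilated_damped_decaying:
  assumes F: "F \<in> H_SO \<Delta>" and \<Delta>: "0 < \<Delta>" "\<Delta> \<le> 2" and \<delta>: "0 < \<delta>" "\<delta> < 1"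
  shows "\<exists>M. decaying_entire (\<lambda>z. F (of_real (1 - \<delta>) * z) * (ft (indicator {-(1/2)..1/2}) (of_real (\<delta>\<^sup>2 * \<Delta> / 3) * z)) ^ 3) M (pi * \<Delta>)"
proof -
  \<comment> \<open>With \<epsilon> = pi \<Delta> \<delta> the dilated F has type pi \<Delta> (1 -
    \<delta>^2), so pi \<Delta> \<delta>^2 is left for the three sincs of type pi \<eta> each. One
    of the three powers of 1/(1 + |z|) pays for the linear growth of F, two remain. The bound \<eta>
    <= 1 is used for \<eta> (1 + |z|) <= 1 + |\<eta> z|.\<close>
  define \<eta> where "\<eta> = \<delta>\<^sup>2 * \<Delta> / 3"
  have "\<delta>\<^sup>2 \<le> 1" using \<delta> by (simp add: power_le_one)
  then have "\<delta>\<^sup>2 * \<Delta> \<le> 1 * 2" using \<Delta> by (intro mult_mono) auto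
  then have \<eta>: "0 < \<eta>" "\<eta> \<le> 1" using \<Delta> \<delta> by (auto simp: \<eta>_def)
  let ?S = "ft (indicator {-(1/2)..1/2})"
  have hS: "?S holomorphic_on UNIV" using ft_holomorphic[OF band_box[of "1/2"]] by simp
  have hF: "F holomorphic_on UNIV" using F by (simp add: H_SO_iff exp_type_le_def)
  have comp: "(\<lambda>z. f (c * z)) holomorphic_on UNIV" if "f holomorphic_on UNIV" for f and c :: complex
    using holomorphic_on_compose_gen[OF holomorphic_on_mult[OF holomorphic_on_const holomorphic_on_ident] that, of c UNIV]
    by (simp add: o_def)
  obtain M where M: "0 < M" "\<And>z. cmod (F z) \<le> M * (1 + cmod z) * exp ((pi * \<Delta> + pi * \<Delta> * \<delta>) * \<bar>Im z\<bar>)"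
    using H_SO_growth[OF F \<Delta>(1), of "pi * \<Delta> * \<delta>"] \<Delta> \<delta> by auto
  have "decaying_entire (\<lambda>z. F (of_real (1 - \<delta>) * z) * (?S (of_real \<eta> * z)) ^ 3) (M * (2 / \<eta>) ^ 3) (pi * \<Delta>)"
  proof
    show "(\<lambda>z. F (of_real (1 - \<delta>) * z) * (?S (of_real \<eta> * z)) ^ 3) holomorphic_on UNIV"
      by (intro holomorphic_intros comp hS hF)
    show "0 \<le> pi * \<Delta>" using \<Delta> by simp
    fix z
    let ?p = "1 + cmod z"
    have p: "0 < ?p" by (simp add: add_pos_nonneg)
    have "cmod (F (of_real (1 - \<delta>) * z)) \<le> M * (1 + cmod (of_real (1 - \<delta>) * z)) * exp ((pi * \<Delta> + pi * \<Delta> * \<delta>) * \<bar>Im (of_real (1 - \<delta>) * z)\<bar>)"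
      by (rule M)
    also have "\<dots> \<le> M * ?p * exp ((pi * \<Delta> + pi * \<Delta> * \<delta>) * \<bar>Im (of_real (1 - \<delta>) * z)\<bar>)"
    proof (intro mult_right_mono mult_left_mono)
      have "(1 - \<delta>) * cmod z \<le> 1 * cmod z" using \<delta> by (intro mult_right_mono) auto
      moreover have "cmod (of_real (1 - \<delta>) * z) = (1 - \<delta>) * cmod z" using \<delta> unfolding norm_mult norm_of_real by simp
      ultimately show "1 + cmod (of_real (1 - \<delta>) * z) \<le> ?p" by simp
    qed (use M in auto)
    also have "\<bar>Im (of_real (1 - \<delta>) * z)\<bar> = (1 - \<delta>) * \<bar>Im z\<bar>" using \<delta> by (simp add: abs_mult)
    finally have f: "cmod (F (of_real (1 - \<delta>) * z)) \<le> M * ?p * exp ((pi * \<Delta> + pi * \<Delta> * \<delta>) * ((1 - \<delta>) * \<bar>Im z\<bar>))" .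
    have "cmod (?S (of_real \<eta> * z)) \<le> 2 / \<eta> * exp (pi * \<eta> * \<bar>Im z\<bar>) / ?p"
    proof -
      have "\<eta> * ?p * cmod (?S (of_real \<eta> * z)) \<le> (1 + cmod (of_real \<eta> * z)) * cmod (?S (of_real \<eta> * z))"
        using \<eta> by (intro mult_right_mono) (auto simp: norm_mult algebra_simps)
      also have "\<dots> \<le> 2 * exp (pi * \<eta> * \<bar>Im z\<bar>)"
        using sinc_bound[of "of_real \<eta> * z"] \<eta> by (simp add: abs_mult mult_ac)
      finally have "cmod (?S (of_real \<eta> * z)) \<le> 2 * exp (pi * \<eta> * \<bar>Im z\<bar>) / (\<eta> * ?p)"
        using \<eta> p by (subst pos_le_divide_eq) (auto simp only: mult_pos_pos mult.commute)
      then show ?thesis by simp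
    qed
    then have "cmod (?S (of_real \<eta> * z)) ^ 3 \<le> (2 / \<eta> * exp (pi * \<eta> * \<bar>Im z\<bar>) / ?p) ^ 3"
      by (intro power_mono) auto
    also have "\<dots> = (2 / \<eta>) ^ 3 * exp (pi * \<eta> * \<bar>Im z\<bar> * 3) / ?p ^ 3"
      by (simp add: power_mult_distrib power_divide exp_of_nat_mult[symmetric] mult_ac)
    finally have s: "cmod (?S (of_real \<eta> * z)) ^ 3 \<le> (2 / \<eta>) ^ 3 * exp (pi * \<eta> * \<bar>Im z\<bar> * 3) / ?p ^ 3" .
    have "cmod (F (of_real (1 - \<delta>) * z) * (?S (of_real \<eta> * z)) ^ 3)
       \<le> (M * ?p * exp ((pi * \<Delta> + pi * \<Delta> * \<delta>) * ((1 - \<delta>) * \<bar>Im z\<bar>))) * ((2 / \<eta>) ^ 3 * exp (pi * \<eta> * \<bar>Im z\<bar> * 3) / ?p ^ 3)"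
      unfolding norm_mult norm_power using f s M by (intro mult_mono) auto
    also have "\<dots> = M * (2 / \<eta>) ^ 3 * (exp ((pi * \<Delta> + pi * \<Delta> * \<delta>) * ((1 - \<delta>) * \<bar>Im z\<bar>)) * exp (pi * \<eta> * \<bar>Im z\<bar> * 3)) * (?p / ?p ^ 3)"
      by simp
    also have "exp ((pi * \<Delta> + pi * \<Delta> * \<delta>) * ((1 - \<delta>) * \<bar>Im z\<bar>)) * exp (pi * \<eta> * \<bar>Im z\<bar> * 3) = exp (pi * \<Delta> * \<bar>Im z\<bar>)"
      by (simp add: \<eta>_def algebra_simps power2_eq_square flip: exp_add)
    also have "?p / ?p ^ 3 = 1 / ?p\<^sup>2" using p by (simp add: power2_eq_square power3_eq_cube)
    also have "M * (2 / \<eta>) ^ 3 * exp (pi * \<Delta> * \<bar>Im z\<bar>) * (1 / ?p\<^sup>2) \<le> M * (2 / \<eta>) ^ 3 * exp (pi * \<Delta> * \<bar>Im z\<bar>) * (1 / (1 + (cmod z)\<^sup>2))"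
      using M \<eta> by (intro mult_left_mono divide_left_mono) (auto simp: power2_sum add_pos_nonneg)
    finally show "cmod (F (of_real (1 - \<delta>) * z) * (?S (of_real \<eta> * z)) ^ 3) \<le> M * (2 / \<eta>) ^ 3 * exp (pi * \<Delta> * \<bar>Im z\<bar>) / (1 + (cmod z)\<^sup>2)"
      by simp
  qed
  then show ?thesis unfolding \<eta>_def by blast
qed

lemma W_SO_tendsto_dilation:
  assumes "b \<longlonglongrightarrow> 1" "\<And>n. b n \<noteq> 0"
  shows "(\<lambda>n. W_SO (b n * y)) \<longlonglongrightarrow> W_SO y"
proof (cases "y = 0")
  case False
  have "(\<lambda>n. 1 + sin (2 * pi * (b n * y)) / (2 * pi * (b n * y))) \<longlonglongrightarrow> 1 + sin (2 * pi * (1 * y)) / (2 * pi * (1 * y))"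
    using assms False by (intro tendsto_intros) auto
  then show ?thesis using assms False by (simp add: W_SO_def)
qed simp

text \<open>The substitution x = b n * y leaves F fixed and dilates the kernel instead. As b n >= 1,
  the kernel stays below 2 C / (1 + |y|) for all n, and its product with |F| is dominated by the sum
  of two squares, both integrable.\<close>

lemma reproducing_property:
  assumes F: "F \<in> H_SO \<Delta>" and \<Delta>: "0 < \<Delta>" "\<Delta> \<le> 2" and g: "SO_solution \<Delta> w g"
  shows "inner_SO F (ft g) = F w"
proof -
  \<comment> \<open>The offset 2 keeps \<delta> at most 1/2, hence the dilation factor b at most
    2.\<close>
  define \<delta> where "\<delta> n = 1 / (real n + 2)" for n
  define \<eta> where "\<eta> n = (\<delta> n)\<^sup>2 * \<Delta> / 3" for n
  let ?S = "ft (indicator {-(1/2)..1/2})"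
  have \<delta>: "0 < \<delta> n" "\<delta> n \<le> 1 / 2" for n by (auto simp: \<delta>_def field_simps)
  have \<delta>0: "\<delta> \<longlonglongrightarrow> 0" unfolding \<delta>_def by real_asymp
  have \<eta>0: "\<eta> \<longlonglongrightarrow> 0"
    unfolding \<eta>_def using tendsto_divide[OF tendsto_mult[OF tendsto_power[OF \<delta>0, of 2] tendsto_const[of \<Delta>]] tendsto_const[of "3::real"]] by simp
  define b where "b n = 1 / (1 - \<delta> n)" for n
  have b: "1 \<le> b n" "b n \<le> 2" for n using \<delta>[of n] by (auto simp: b_def field_simps)
  have b1: "b \<longlonglongrightarrow> 1" unfolding b_def using tendsto_divide[OF tendsto_const[of 1] tendsto_diff[OF tendsto_const[of 1] \<delta>0]] by simp
  have hS: "?S holomorphic_on UNIV" using ft_holomorphic[OF band_box[of "1/2"]] by simp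
  have hF: "F holomorphic_on UNIV" using F by (simp add: H_SO_iff exp_type_le_def)
  have L2: "integrable lborel (\<lambda>x::real. (cmod (F (of_real x)))\<^sup>2)" using F by (simp add: H_SO_iff)
  obtain B where B: "band (\<Delta> / 2) B g" using g by (auto simp: SO_solution_def)
  have hK: "ft g holomorphic_on UNIV" using ft_holomorphic[OF B] \<Delta> by simp
  note [measurable] = entire_measurable_on_real[OF hF] entire_measurable_on_real[OF hS] entire_measurable_on_real[OF hK]
  have cS: "isCont ?S z" and cF: "isCont F z" and cK: "isCont (ft g) z" for z
    using hS hF hK by (auto intro: continuous_on_interior holomorphic_on_imp_continuous_on simp: continuous_on_eq_continuous_at)
  have S0: "?S 0 = 1"
  proof -
    have "(indicator {-(1/2)..1/2} :: real \<Rightarrow> complex) = (\<lambda>t. of_real (indicator {-(1/2)..1/2} t))"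
      by (auto simp: indicator_def)
    then show ?thesis by (simp add: ft_def)
  qed
  have S1: "cmod (?S (of_real x)) \<le> 1" for x
    using ft_bound[OF band_box[of "1/2"], of "of_real x"] by simp
  define Fn where "Fn n z = F (of_real (1 - \<delta> n) * z) * (?S (of_real (\<eta> n) * z)) ^ 3" for n z
  have rep: "inner_SO (Fn n) (ft g) = Fn n w" for n
  proof -
    have "\<exists>M. decaying_entire (Fn n) M (pi * \<Delta>)"
      using dilated_damped_decaying[OF F \<Delta>, of "\<delta> n"] \<delta>[of n] by (simp add: Fn_def[abs_def] \<eta>_def)
    then show ?thesis using decaying_entire.inner_SO_ft[OF _ refl \<Delta>(1) g] by blast
  qed
  have lim1: "(\<lambda>n. Fn n w) \<longlonglongrightarrow> F w"
  proof -
    have "(\<lambda>n. complex_of_real (1 - \<delta> n) * w) \<longlonglongrightarrow> of_real (1 - 0) * w" by (intro tendsto_intros \<delta>0)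
    then have a: "(\<lambda>n. F (of_real (1 - \<delta> n) * w)) \<longlonglongrightarrow> F w"
      using isCont_tendsto_compose[OF cF] by fastforce
    have "(\<lambda>n. complex_of_real (\<eta> n) * w) \<longlonglongrightarrow> of_real 0 * w" by (intro tendsto_intros \<eta>0)
    then have c: "(\<lambda>n. ?S (of_real (\<eta> n) * w)) \<longlonglongrightarrow> ?S 0"
      using isCont_tendsto_compose[OF cS] by fastforce
    have "(\<lambda>n. Fn n w) \<longlonglongrightarrow> F w * (?S 0) ^ 3"
      unfolding Fn_def by (intro tendsto_intros a c)
    then show ?thesis by (simp add: S0)
  qed
  obtain C where C: "0 < C" "\<And>x::real. cmod (ft g (of_real x)) \<le> C / (1 + \<bar>x\<bar>)"
    using SO_solution_decay[OF g \<Delta>(1)] by metis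
  define k where "k x = cnj (ft g (of_real x)) * of_real (W_SO x)" for x :: real
  have [measurable]: "(\<lambda>x::real. cnj (ft g (of_real x))) \<in> borel_measurable borel"
    by (rule measurable_compose[OF entire_measurable_on_real[OF hK] borel_measurable_continuous_onI[OF continuous_on_cnj[OF continuous_on_id]]])
  have [measurable]: "k \<in> borel_measurable borel" unfolding k_def[abs_def] by measurable
  have kb: "cmod (k x) \<le> 2 * C / (1 + \<bar>x\<bar>)" for x
  proof -
    have "cmod (k x) \<le> (C / (1 + \<bar>x\<bar>)) * 2"
      unfolding k_def norm_mult using C W_SO_upper[of x] W_SO_lower[of x] by (intro mult_mono) auto
    then show ?thesis by (simp add: mult.commute)
  qed
  have sub: "inner_SO (Fn n) (ft g) = (LINT y|lborel. of_real (b n) * (F (of_real y) * (?S (of_real (\<eta> n * b n * y))) ^ 3 * k (b n * y)))" for n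
  proof -
    have "inner_SO (Fn n) (ft g) = (LINT x|lborel. Fn n (of_real x) * k x)"
      by (simp add: inner_SO_def k_def mult.assoc)
    also have "\<dots> = \<bar>b n\<bar> *\<^sub>R (LINT y|lborel. Fn n (of_real (0 + b n * y)) * k (0 + b n * y))"
      using b[of n] by (intro lborel_integral_real_affine) auto
    also have "\<dots> = (LINT y|lborel. of_real (b n) * (Fn n (of_real (b n * y)) * k (b n * y)))"
      using b[of n] by (simp add: scaleR_conv_of_real)
    also have "\<dots> = (LINT y|lborel. of_real (b n) * (F (of_real y) * (?S (of_real (\<eta> n * b n * y))) ^ 3 * k (b n * y)))"
    proof -
      have "(1 - \<delta> n) * b n = 1" using \<delta>[of n] by (simp add: b_def)
      then have "complex_of_real (1 - \<delta> n) * of_real (b n * y) = of_real y" for y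
        by (simp only: mult.assoc[symmetric] of_real_mult[symmetric] mult_1_left)
      then have "Fn n (of_real (b n * y)) = F (of_real y) * (?S (of_real (\<eta> n * b n * y))) ^ 3" for y
        by (simp only: Fn_def of_real_mult[symmetric] mult.assoc)
      then show ?thesis by (simp only: mult.assoc)
    qed
    finally show ?thesis .
  qed
  have "(\<lambda>n. LINT y|lborel. of_real (b n) * (F (of_real y) * (?S (of_real (\<eta> n * b n * y))) ^ 3 * k (b n * y)))
     \<longlonglongrightarrow> (LINT y|lborel. F (of_real y) * k y)"
  proof (rule integral_dominated_convergence)
    show "(\<lambda>y. F (of_real y) * k y) \<in> borel_measurable lborel" by measurable
    show "(\<lambda>y. of_real (b n) * (F (of_real y) * (?S (of_real (\<eta> n * b n * y))) ^ 3 * k (b n * y))) \<in> borel_measurable lborel" for n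
      by measurable
    have "integrable lborel (\<lambda>x::real. (cmod (of_real (1 / (1 + \<bar>x\<bar>)))) ^ 2)"
      by (rule integrable_square_decay[where C = 1]) (measurable, simp only: norm_of_real, simp)
    then have "integrable lborel (\<lambda>x::real. (1 / (1 + \<bar>x\<bar>))\<^sup>2)"
      by (simp only: norm_of_real power2_abs)
    then show "integrable lborel (\<lambda>x::real. 4 * C * ((cmod (F (of_real x)))\<^sup>2 + (1 / (1 + \<bar>x\<bar>))\<^sup>2))"
      using L2 by (intro integrable_mult_right Bochner_Integration.integrable_add)
    show "AE y in lborel. (\<lambda>n. of_real (b n) * (F (of_real y) * (?S (of_real (\<eta> n * b n * y))) ^ 3 * k (b n * y))) \<longlonglongrightarrow> F (of_real y) * k y"
    proof (rule AE_I2)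
      fix y :: real
      have "(\<lambda>n. complex_of_real (\<eta> n * b n * y)) \<longlonglongrightarrow> of_real (0 * 1 * y)"
        by (intro tendsto_intros \<eta>0 b1)
      then have a: "(\<lambda>n. ?S (of_real (\<eta> n * b n * y))) \<longlonglongrightarrow> ?S 0"
        using isCont_tendsto_compose[OF cS] by fastforce
      have "(\<lambda>n. complex_of_real (b n * y)) \<longlonglongrightarrow> of_real (1 * y)"
        by (intro tendsto_intros b1)
      then have "(\<lambda>n. ft g (of_real (b n * y))) \<longlonglongrightarrow> ft g (of_real y)"
        using isCont_tendsto_compose[OF cK] by fastforce
      moreover have "b n \<noteq> 0" for n using b(1)[of n] by auto
      ultimately have c: "(\<lambda>n. k (b n * y)) \<longlonglongrightarrow> k y"
        unfolding k_def by (intro tendsto_intros W_SO_tendsto_dilation[OF b1])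
      have "(\<lambda>n. of_real (b n) * (F (of_real y) * (?S (of_real (\<eta> n * b n * y))) ^ 3 * k (b n * y))) \<longlonglongrightarrow> of_real 1 * (F (of_real y) * (?S 0) ^ 3 * k y)"
        by (intro tendsto_intros a c b1)
      then show "(\<lambda>n. of_real (b n) * (F (of_real y) * (?S (of_real (\<eta> n * b n * y))) ^ 3 * k (b n * y))) \<longlonglongrightarrow> F (of_real y) * k y"
        by (simp add: S0)
    qed
    show "AE y in lborel. norm (of_real (b n) * (F (of_real y) * (?S (of_real (\<eta> n * b n * y))) ^ 3 * k (b n * y)))
        \<le> 4 * C * ((cmod (F (of_real y)))\<^sup>2 + (1 / (1 + \<bar>y\<bar>))\<^sup>2)" for n
    proof (rule AE_I2)
      fix y :: real
      let ?f = "cmod (F (of_real y))" and ?q = "1 / (1 + \<bar>y\<bar>)"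
      have "\<bar>y\<bar> \<le> \<bar>b n * y\<bar>" using b(1)[of n] mult_right_mono[of 1 "b n" "\<bar>y\<bar>"] by (simp add: abs_mult)
      then have "2 * C / (1 + \<bar>b n * y\<bar>) \<le> 2 * C / (1 + \<bar>y\<bar>)"
        using C(1) by (intro divide_left_mono mult_pos_pos) auto
      then have kk: "cmod (k (b n * y)) \<le> 2 * C * ?q" using kb[of "b n * y"] by simp
      have "norm (of_real (b n) * (F (of_real y) * (?S (of_real (\<eta> n * b n * y))) ^ 3 * k (b n * y)))
         = \<bar>b n\<bar> * (?f * cmod (?S (of_real (\<eta> n * b n * y))) ^ 3 * cmod (k (b n * y)))"
        by (simp add: norm_mult norm_power del: of_real_mult)
      also have "\<dots> \<le> 2 * (?f * 1 * (2 * C * ?q))"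
        using b[of n] kk S1[of "\<eta> n * b n * y"] C(1)
        by (intro mult_mono power_le_one) auto
      also have "\<dots> = 4 * C * (?f * ?q)" by simp
      also have "\<dots> \<le> 4 * C * (?f\<^sup>2 + ?q\<^sup>2)"
      proof (intro mult_left_mono)
        have "2 * (?f * ?q) \<le> ?f\<^sup>2 + ?q\<^sup>2" using zero_le_power2[of "?f - ?q"] by (simp add: power2_diff)
        moreover have "0 \<le> ?f * ?q" by simp
        ultimately show "?f * ?q \<le> ?f\<^sup>2 + ?q\<^sup>2" by linarith
      qed (use C in auto)
      finally show "norm (of_real (b n) * (F (of_real y) * (?S (of_real (\<eta> n * b n * y))) ^ 3 * k (b n * y)))
        \<le> 4 * C * (?f\<^sup>2 + ?q\<^sup>2)" .
    qed
  qed
  then have "(\<lambda>n. Fn n w) \<longlonglongrightarrow> inner_SO F (ft g)"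
    unfolding sub[symmetric] rep by (simp add: inner_SO_def k_def mult.assoc)
  then show ?thesis using lim1 LIMSEQ_unique by blast
qed

section \<open>Uniqueness of the reproducing kernel\<close>

lemma inner_SO_commute: "inner_SO F G = cnj (inner_SO G F)"
  unfolding inner_SO_def by (simp flip: Bochner_Integration.integral_cnj) (simp add: mult_ac)

text \<open>Hermitian symmetry of the inner product lets K z be evaluated at w through k, and k at z
  through K z; the two values are conjugate. Only a single w is concerned.\<close>

lemma K_SO_eqI:
  assumes "is_repr_kernel \<Delta> K" and k: "k \<in> H_SO \<Delta>" "\<And>F. F \<in> H_SO \<Delta> \<Longrightarrow> F w = inner_SO F k"
  shows "K w = k"
proof
  fix z
  have KH: "K v \<in> H_SO \<Delta>" and rep: "F \<in> H_SO \<Delta> \<Longrightarrow> F v = inner_SO F (K v)" for F v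
    using assms(1) by (auto simp: is_repr_kernel_def)
  have "K w z = inner_SO (K w) (K z)" by (rule rep[OF KH])
  also have "\<dots> = cnj (inner_SO (K z) (K w))" by (rule inner_SO_commute)
  also have "inner_SO (K z) (K w) = K z w" by (rule rep[OF KH, symmetric])
  also have "K z w = inner_SO (K z) k" by (rule k(2)[OF KH])
  also have "cnj \<dots> = inner_SO k (K z)" by (rule inner_SO_commute[symmetric])
  also have "\<dots> = k z" by (rule rep[OF k(1), symmetric])
  finally show "K w z = k z" .
qed

lemma K_SO_eq:
  assumes "is_repr_kernel \<Delta> K"
  shows "K_SO \<Delta> = K"
  unfolding K_SO_def
proof (rule the_equality)
  show "is_repr_kernel \<Delta> K" by (rule assms)
next
  fix K' assume K': "is_repr_kernel \<Delta> K'"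
  show "K' = K"
  proof
    fix w
    show "K' w = K w"
      using assms by (intro K_SO_eqI[OF K']) (auto simp: is_repr_kernel_def)
  qed
qed

lemma is_repr_kernel_ft:
  assumes \<Delta>: "0 < \<Delta>" "\<Delta> \<le> 2" and "\<And>w. SO_solution \<Delta> w (g w)"
  shows "is_repr_kernel \<Delta> (\<lambda>w. ft (g w))"
  unfolding is_repr_kernel_def
  using SO_solution_in_H_SO[OF assms(3) \<Delta>(1)] reproducing_property[OF _ \<Delta> assms(3)] by auto

section \<open>Solving the integral equation\<close>

text \<open>At \<open>\<Delta> = 2\<close> the integral operator has norm 1 for the plain supremum norm; for the norm weighted by
  \<open>3 - t\<^sup>2\<close> it is a contraction with factor 9/10 uniformly in \<open>\<Delta> \<le> 2\<close>.\<close>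
lemma weight_window_le:
  fixes t :: real
  assumes t: "t \<in> {-1..1}"
  shows "(LINT s:{max (-1) (t - 1)..min 1 (t + 1)}|lborel. 3 - s\<^sup>2) \<le> 9 / 5 * (3 - t\<^sup>2)"
proof -
  let ?P = "\<lambda>s::real. 3 * s - s ^ 3 / 3"
  have ftc: "(LINT s:{lo..hi}|lborel. 3 - s\<^sup>2) = ?P hi - ?P lo" if "lo \<le> hi" for lo hi :: real
  proof -
    have "(?P has_vector_derivative 3 - s\<^sup>2) (at s within {lo..hi})" for s
      unfolding has_real_derivative_iff_has_vector_derivative[symmetric]
      by (auto intro!: derivative_eq_intros)
    then have "((\<lambda>s. 3 - s\<^sup>2) has_integral ?P hi - ?P lo) {lo..hi}"
      using that by (intro fundamental_theorem_of_calculus)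
    moreover have "set_integrable lborel {lo..hi} (\<lambda>s::real. 3 - s\<^sup>2)"
      by (intro borel_integrable_atLeastAtMost') (auto intro!: continuous_intros)
    ultimately show ?thesis by (simp add: set_borel_integral_eq_integral(2) integral_unique)
  qed
  \<comment> \<open>At r = 0 the sides are 16/3 and 27/5, so the factor 9/5 lies just above the 16/9
    forced there.\<close>
  have poly: "3 * 1 - 1 / 3 - (3 * (r - 1) - (r - 1) ^ 3 / 3) \<le> 9 / 5 * (3 - r\<^sup>2)" if "0 \<le> r" "r \<le> 1" for r :: real
  proof -
    have "r ^ 3 \<le> r" "r\<^sup>2 \<le> r"
      using that power_decreasing[of 1 3 r] power_decreasing[of 1 2 r] by auto
    moreover have "(r - 1) ^ 3 = r ^ 3 - 3 * r\<^sup>2 + 3 * r - 1"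
      by (simp add: power3_eq_cube power2_eq_square algebra_simps)
    ultimately show ?thesis using that by (simp add: field_simps)
  qed
  show ?thesis
  proof (cases "0 \<le> t")
    case True
    then have "max (-1) (t - 1) = t - 1" "min 1 (t + 1) = 1" by auto
    then show ?thesis using ftc[of "t - 1" 1] poly[of t] True t by simp
  next
    case False
    then have e: "max (-1) (t - 1) = -1" "min 1 (t + 1) = t + 1" by auto
    have "(1 + t) ^ 3 = - ((- t - 1) ^ 3)"
      by (simp add: power3_eq_cube algebra_simps)
    then show ?thesis unfolding e using ftc[of "-1" "t + 1"] poly[of "-t"] False t
      by (simp add: add.commute)
  qed
qed

text \<open>Each term is cut off to [- a, a] again, since the equation is posed on that interval
  only.\<close>

primrec neum :: "real \<Rightarrow> (real \<Rightarrow> complex) \<Rightarrow> nat \<Rightarrow> real \<Rightarrow> complex" where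
  "neum a e 0 = (\<lambda>t. indicator {-a..a} t * e t)"
| "neum a e (Suc n) = (\<lambda>t. indicator {-a..a} t * (- (1 / 2) * (LINT s:{t - 1..t + 1}|lborel. neum a e n s)))"

definition neumann :: "real \<Rightarrow> (real \<Rightarrow> complex) \<Rightarrow> real \<Rightarrow> complex" where
  "neumann a e t = (\<Sum>n. neum a e n t)"

lemma neum_measurable:
  assumes [measurable]: "e \<in> borel_measurable borel"
  shows "neum a e n \<in> borel_measurable borel"
proof (induction n)
  case (Suc n)
  note [measurable] = window_measurable[OF Suc]
  show ?case by simp
qed simp

text \<open>Half the factor 9/5 of the weighted window estimate gives the ratio 9/10. The start E/2
  is due to 3 - t^2 >= 2 on [- 1, 1], and a <= 1 keeps the support inside that interval.\<close>

lemma neum_bound: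
  assumes e: "e \<in> borel_measurable borel" and E: "\<And>t. t \<in> {-a..a} \<Longrightarrow> cmod (e t) \<le> E" and a: "0 \<le> a" "a \<le> 1"
  shows "cmod (neum a e n t) \<le> E / 2 * (9 / 10) ^ n * (3 - t\<^sup>2) * indicator {-a..a} t"
proof (induction n arbitrary: t)
  have E0: "0 \<le> E" using E[of 0] a order_trans[OF norm_ge_zero] by force
  have sq: "t\<^sup>2 \<le> 1" if "t \<in> {-a..a}" for t
    using that a by (simp add: abs_square_le_1 abs_le_iff)
  {
    case 0
    show ?case
    proof (cases "t \<in> {-a..a}")
      case True
      have "cmod (e t) \<le> E / 2 * 2" using E[OF True] by simp
      also have "\<dots> \<le> E / 2 * (3 - t\<^sup>2)" using E0 sq[OF True] by (intro mult_left_mono) auto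
      finally show ?thesis using True by simp
    qed simp
  next
    case (Suc n)
    define c where "c = E / 2 * (9 / 10) ^ n"
    have c0: "0 \<le> c" using E0 by (simp add: c_def)
    show ?case
    proof (cases "t \<in> {-a..a}")
      case True
      then have t: "t \<in> {-1..1}" using a by auto
      have le: "cmod (indicator {t - 1..t + 1} s *\<^sub>R neum a e n s)
           \<le> c * (indicator {max (-1) (t - 1)..min 1 (t + 1)} s *\<^sub>R (3 - s\<^sup>2))" for s
      proof (cases "s \<in> {-a..a}")
        case s: True
        show ?thesis using Suc.IH[of s] s a c0 sq[OF s] by (auto simp: c_def indicator_def split: if_splits)
      next
        case s: False
        have "0 \<le> 3 - s\<^sup>2" if "s \<in> {-1..1}" using that by (simp add: abs_square_le_1 abs_le_iff order_trans[of _ 1])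
        moreover have "neum a e n s = 0" using Suc.IH[of s] s by simp
        ultimately show ?thesis using c0 by (auto simp: indicator_def)
      qed
      have int: "integrable lborel (\<lambda>s. c * (indicator {max (-1) (t - 1)..min 1 (t + 1)} s *\<^sub>R (3 - s\<^sup>2)))"
      proof (intro integrable_mult_right)
        have "continuous_on {max (-1) (t - 1)..min 1 (t + 1)} (\<lambda>s::real. 3 - s\<^sup>2)"
          by (intro continuous_intros)
        then show "integrable lborel (\<lambda>s. indicator {max (-1) (t - 1)..min 1 (t + 1)} s *\<^sub>R (3 - s\<^sup>2))"
          using borel_integrable_atLeastAtMost' unfolding set_integrable_def by blast
      qed
      have m: "(\<lambda>s. indicator {t - 1..t + 1} s *\<^sub>R neum a e n s) \<in> borel_measurable lborel"
        using neum_measurable[OF e, of a n] by measurable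
      have "cmod (LINT s:{t - 1..t + 1}|lborel. neum a e n s)
          \<le> (LINT s|lborel. c * (indicator {max (-1) (t - 1)..min 1 (t + 1)} s *\<^sub>R (3 - s\<^sup>2)))"
        unfolding set_lebesgue_integral_def
      proof (rule Bochner_Integration.integral_norm_bound_integral[OF _ int le])
        show "integrable lborel (\<lambda>s. indicator {t - 1..t + 1} s *\<^sub>R neum a e n s)"
          by (rule Bochner_Integration.integrable_bound[OF int m]) (intro AE_I2 order_trans[OF le], simp)
      qed
      also have "\<dots> = c * (LINT s:{max (-1) (t - 1)..min 1 (t + 1)}|lborel. 3 - s\<^sup>2)"
        unfolding set_lebesgue_integral_def by (rule integral_mult_right_zero)
      also have "\<dots> \<le> c * (9 / 5 * (3 - t\<^sup>2))"
        using c0 by (intro mult_left_mono weight_window_le[OF t])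
      finally have "cmod (LINT s:{t - 1..t + 1}|lborel. neum a e n s) \<le> c * (9 / 5 * (3 - t\<^sup>2))" .
      then show ?thesis using True by (simp add: norm_mult c_def algebra_simps)
    qed simp
  }
qed

lemma neum_bound':
  assumes "e \<in> borel_measurable borel" "\<And>t. t \<in> {-a..a} \<Longrightarrow> cmod (e t) \<le> E" "0 \<le> a" "a \<le> 1"
  shows "cmod (neum a e n t) \<le> 3 / 2 * E * (9 / 10) ^ n * indicator {-a..a} t"
proof -
  have E0: "0 \<le> E" using assms(2)[of 0] assms(3) order_trans[OF norm_ge_zero] by force
  have "E / 2 * (9 / 10) ^ n * (3 - t\<^sup>2) * indicator {-a..a} t \<le> E / 2 * (9 / 10) ^ n * 3 * indicator {-a..a} t"
    using E0 by (intro mult_right_mono mult_left_mono) auto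
  then show ?thesis using neum_bound[OF assms, of n t] by (simp add: mult_ac)
qed

lemma summable_neum:
  assumes "e \<in> borel_measurable borel" "\<And>t. t \<in> {-a..a} \<Longrightarrow> cmod (e t) \<le> E" "0 \<le> a" "a \<le> 1"
  shows "summable (\<lambda>n. cmod (neum a e n t))"
proof (rule summable_comparison_test)
  show "summable (\<lambda>n. 3 / 2 * E * (9 / 10) ^ n * indicator {-a..a} t)"
    by (intro summable_mult summable_mult2 summable_geometric) simp
qed (use neum_bound'[OF assms] in auto)

text \<open>The 15 is 3/2, from the weight being at most 3, times the geometric sum 10.\<close>

lemma band_neumann:
  assumes "e \<in> borel_measurable borel" "\<And>t. t \<in> {-a..a} \<Longrightarrow> cmod (e t) \<le> E" "0 \<le> a" "a \<le> 1"
  shows "band a (15 * E) (neumann a e)"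
  unfolding band_def
proof (intro conjI allI)
  note [measurable] = neum_measurable[OF assms(1)]
  show "neumann a e \<in> borel_measurable borel" unfolding neumann_def[abs_def] by measurable
  fix t
  have "cmod (neumann a e t) \<le> (\<Sum>n. cmod (neum a e n t))"
    unfolding neumann_def by (rule summable_norm[OF summable_neum[OF assms]])
  also have "\<dots> \<le> (\<Sum>n. 3 / 2 * E * indicator {-a..a} t * (9 / 10) ^ n)"
  proof (rule suminf_le)
    show "cmod (neum a e n t) \<le> 3 / 2 * E * indicator {-a..a} t * (9 / 10) ^ n" for n
      using neum_bound'[OF assms, of n t] by (simp add: mult_ac)
    show "summable (\<lambda>n. 3 / 2 * E * indicator {-a..a} t * (9 / 10) ^ n)"
      by (intro summable_mult summable_geometric) simp
  qed (rule summable_neum[OF assms])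
  also have "\<dots> = 3 / 2 * E * indicator {-a..a} t * (\<Sum>n. (9 / 10) ^ n)"
    by (intro suminf_mult summable_geometric) simp
  also have "(\<Sum>n. (9 / 10 :: real) ^ n) = 10"
    by (subst suminf_geometric) auto
  finally show "cmod (neumann a e t) \<le> 15 * E * indicator {-a..a} t" by simp
qed

text \<open>The geometric majorant allows the moving integral to be taken term by term, where it
  shifts the index by one; the sum telescopes to the zeroth term e.\<close>

lemma neumann_equation:
  assumes e: "e \<in> borel_measurable borel" "\<And>t. t \<in> {-a..a} \<Longrightarrow> cmod (e t) \<le> E" "0 \<le> a" "a \<le> 1"
    and t: "t \<in> {-a..a}"
  shows "neumann a e t + 1 / 2 * (LINT s:{t - 1..t + 1}|lborel. neumann a e s) = e t"
proof -
  note [measurable] = neum_measurable[OF e(1)]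
  let ?f = "\<lambda>n s. indicator {t - 1..t + 1} s *\<^sub>R neum a e n s"
  have E0: "0 \<le> E" using e(2)[of 0] e(3) order_trans[OF norm_ge_zero] by force
  have le: "norm (?f n s) \<le> 3 / 2 * E * (9 / 10) ^ n * indicator {-a..a} s" for n s
    using neum_bound'[OF e, of n s] E0 by (auto simp: indicator_def)
  have int: "integrable lborel (?f n)" for n
  proof (rule Bochner_Integration.integrable_bound[OF integrable_box[of "3 / 2 * E * (9 / 10) ^ n" "-a" a]])
    show "AE s in lborel. norm (?f n s) \<le> norm (3 / 2 * E * (9 / 10) ^ n * indicator {-a..a} s)"
      by (intro AE_I2 order_trans[OF le]) (simp only: real_norm_def abs_ge_self)
  qed measurable
  have s1: "AE s in lborel. summable (\<lambda>n. norm (?f n s))"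
    by (intro AE_I2) (simp only: norm_scaleR, intro summable_mult summable_neum[OF e])
  have s2: "summable (\<lambda>n. LINT s|lborel. norm (?f n s))"
  proof (rule summable_comparison_test)
    show "summable (\<lambda>n. 2 * a * (3 / 2 * E) * (9 / 10) ^ n)"
      by (intro summable_mult summable_geometric) simp
    have "norm (LINT s|lborel. norm (?f n s)) \<le> 2 * a * (3 / 2 * E) * (9 / 10) ^ n" for n
    proof -
      have "(LINT s|lborel. norm (?f n s)) \<le> (LINT s|lborel. 3 / 2 * E * (9 / 10) ^ n * indicator {-a..a} s)"
        by (rule integral_mono[OF integrable_norm[OF int] integrable_box le])
      then show ?thesis using e(3) by (simp add: mult_ac)
    qed
    then show "\<exists>N. \<forall>n\<ge>N. norm (LINT s|lborel. norm (?f n s)) \<le> 2 * a * (3 / 2 * E) * (9 / 10) ^ n" by blast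
  qed
  have "(\<lambda>n. LINT s|lborel. ?f n s) sums (LINT s|lborel. (\<Sum>n. ?f n s))"
    by (rule sums_integral[OF int s1 s2])
  moreover have "(\<Sum>n. ?f n s) = indicator {t - 1..t + 1} s *\<^sub>R neumann a e s" for s
    unfolding neumann_def by (intro suminf_scaleR_right[symmetric] summable_norm_cancel[OF summable_neum[OF e]])
  ultimately have "(\<lambda>n. LINT s:{t - 1..t + 1}|lborel. neum a e n s) sums (LINT s:{t - 1..t + 1}|lborel. neumann a e s)"
    by (simp add: set_lebesgue_integral_def)
  then have "(\<lambda>n. - (1 / 2) * (LINT s:{t - 1..t + 1}|lborel. neum a e n s)) sums (- (1 / 2) * (LINT s:{t - 1..t + 1}|lborel. neumann a e s))"
    by (rule sums_mult)
  then have "(\<lambda>n. neum a e (Suc n) t) sums (- (1 / 2) * (LINT s:{t - 1..t + 1}|lborel. neumann a e s))"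
    using t by simp
  then have "(\<lambda>n. neum a e n t) sums (- (1 / 2) * (LINT s:{t - 1..t + 1}|lborel. neumann a e s) + neum a e 0 t)"
    by (rule sums_Suc)
  then have "neumann a e t = - (1 / 2) * (LINT s:{t - 1..t + 1}|lborel. neumann a e s) + e t"
    using t by (simp add: neumann_def sums_iff)
  then show ?thesis by simp
qed

text \<open>Linearity in the right-hand side: it converts closeness of two exponentials into
  closeness of the corresponding densities.\<close>

lemma neum_diff:
  assumes e: "e \<in> borel_measurable borel" "\<And>t. t \<in> {-a..a} \<Longrightarrow> cmod (e t) \<le> E"
    and e': "e' \<in> borel_measurable borel" "\<And>t. t \<in> {-a..a} \<Longrightarrow> cmod (e' t) \<le> E'" and a: "0 \<le> a" "a \<le> 1"
  shows "neum a (\<lambda>t. e t - e' t) n t = neum a e n t - neum a e' n t"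
proof (induction n arbitrary: t)
  case (Suc n)
  have int: "set_integrable lborel {t - 1..t + 1} (neum a h n)"
    if h: "h \<in> borel_measurable borel" "\<And>t. t \<in> {-a..a} \<Longrightarrow> cmod (h t) \<le> H" for h H
    unfolding set_integrable_def
  proof (intro integrable_mult_indicator)
    show "integrable lborel (neum a h n)"
    proof (rule Bochner_Integration.integrable_bound[OF integrable_box[of "3 / 2 * H * (9 / 10) ^ n" "-a" a]])
      show "AE s in lborel. norm (neum a h n s) \<le> norm (3 / 2 * H * (9 / 10) ^ n * indicator {-a..a} s)"
        by (intro AE_I2 order_trans[OF neum_bound'[OF h a]]) (simp_all only: real_norm_def abs_ge_self)
    qed (use neum_measurable[OF h(1)] in measurable)
  qed simp
  have "(LINT s:{t - 1..t + 1}|lborel. neum a (\<lambda>t. e t - e' t) n s)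
      = (LINT s:{t - 1..t + 1}|lborel. neum a e n s) - (LINT s:{t - 1..t + 1}|lborel. neum a e' n s)"
    unfolding Suc by (rule set_integral_diff(2)[OF int[OF e] int[OF e']])
  then show ?case by (simp only: neum.simps right_diff_distrib)
qed (simp add: algebra_simps)

lemma neumann_diff:
  assumes e: "e \<in> borel_measurable borel" "\<And>t. t \<in> {-a..a} \<Longrightarrow> cmod (e t) \<le> E"
    and e': "e' \<in> borel_measurable borel" "\<And>t. t \<in> {-a..a} \<Longrightarrow> cmod (e' t) \<le> E'" and a: "0 \<le> a" "a \<le> 1"
  shows "neumann a (\<lambda>t. e t - e' t) t = neumann a e t - neumann a e' t"
  unfolding neumann_def
  by (subst neum_diff[OF assms], assumption+) (intro suminf_diff[symmetric] summable_norm_cancel[OF summable_neum[OF e a]] summable_norm_cancel[OF summable_neum[OF e' a]])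

section \<open>The density of the kernel and its dependence on w\<close>

definition char_exp :: "complex \<Rightarrow> real \<Rightarrow> complex" where
  "char_exp w t = exp (- (2 * of_real pi * \<i> * cnj w * of_real t))"

definition SO_density :: "real \<Rightarrow> complex \<Rightarrow> real \<Rightarrow> complex" where
  "SO_density \<Delta> w = neumann (\<Delta> / 2) (char_exp w)"

lemma char_exp_measurable: "char_exp w \<in> borel_measurable borel"
  unfolding char_exp_def[abs_def] by measurable

lemma char_exp_arg_bound:
  assumes "t \<in> {-(\<Delta>/2)..\<Delta>/2}"
  shows "cmod (- (2 * of_real pi * \<i> * cnj w * of_real t)) \<le> pi * \<Delta> * cmod w"
proof -
  have "cmod (- (2 * of_real pi * \<i> * cnj w * of_real t)) = 2 * pi * cmod w * \<bar>t\<bar>" by (simp add: norm_mult)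
  also have "\<dots> \<le> 2 * pi * cmod w * (\<Delta> / 2)" using assms by (intro mult_left_mono) auto
  finally show ?thesis by (simp add: mult_ac)
qed

lemma char_exp_bound:
  assumes "t \<in> {-(\<Delta>/2)..\<Delta>/2}"
  shows "cmod (char_exp w t) \<le> exp (pi * \<Delta> * cmod w)"
  unfolding char_exp_def using norm_exp[of "- (2 * of_real pi * \<i> * cnj w * of_real t)"] char_exp_arg_bound[OF assms, of w]
  by (meson exp_le_cancel_iff order_trans)

lemma char_exp_diff_bound:
  assumes t: "t \<in> {-(\<Delta>/2)..\<Delta>/2}" and R: "cmod w \<le> R" "cmod w' \<le> R" and \<Delta>: "0 < \<Delta>"
  shows "cmod (char_exp w t - char_exp w' t) \<le> exp (pi * \<Delta> * R) * (pi * \<Delta> * cmod (w - w'))"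
proof -
  let ?x = "\<lambda>w. - (2 * of_real pi * \<i> * cnj w * of_real t)"
  have R': "cmod (?x v) \<le> pi * \<Delta> * R" if "cmod v \<le> R" for v
    using order_trans[OF char_exp_arg_bound[OF t, of v] mult_left_mono[OF that, of "pi * \<Delta>"]] \<Delta> by simp
  have "cmod (exp (?x w) - exp (?x w')) \<le> exp (pi * \<Delta> * R) * cmod (?x w - ?x w')"
  proof (rule field_differentiable_bound[where S = "cball 0 (pi * \<Delta> * R)" and f' = exp])
    show "cmod (exp z) \<le> exp (pi * \<Delta> * R)" if "z \<in> cball 0 (pi * \<Delta> * R)" for z
      using norm_exp[of z] that by (auto intro: order_trans)
    show "?x w \<in> cball 0 (pi * \<Delta> * R)" "?x w' \<in> cball 0 (pi * \<Delta> * R)"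
      using R' R by (auto simp del: norm_minus_cancel)
  qed (auto intro: has_field_derivative_at_within DERIV_exp)
  also have "?x w - ?x w' = ?x (w - w')" by (simp add: algebra_simps)
  also have "exp (pi * \<Delta> * R) * cmod (?x (w - w')) \<le> exp (pi * \<Delta> * R) * (pi * \<Delta> * cmod (w - w'))"
    by (intro mult_left_mono char_exp_arg_bound[OF t]) simp
  finally show ?thesis unfolding char_exp_def .
qed

lemma SO_solution_SO_density:
  assumes \<Delta>: "0 < \<Delta>" "\<Delta> \<le> 2"
  shows "SO_solution \<Delta> w (SO_density \<Delta> w)"
proof -
  have a: "0 \<le> \<Delta> / 2" "\<Delta> / 2 \<le> 1" using \<Delta> by auto
  show ?thesis
    unfolding SO_solution_def SO_density_def
  proof (intro conjI exI ballI)
    show "band (\<Delta> / 2) (15 * exp (pi * \<Delta> * cmod w)) (neumann (\<Delta> / 2) (char_exp w))"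
      by (rule band_neumann[OF char_exp_measurable char_exp_bound a])
    fix t assume "t \<in> {-\<Delta>/2..\<Delta>/2}"
    then have "neumann (\<Delta> / 2) (char_exp w) t + 1 / 2 * (LINT s:{t - 1..t + 1}|lborel. neumann (\<Delta> / 2) (char_exp w) s) = char_exp w t"
      by (intro neumann_equation[OF char_exp_measurable char_exp_bound[where \<Delta> = \<Delta> and w = w] a]) auto
    then show "neumann (\<Delta> / 2) (char_exp w) t + 1 / 2 * (LINT s:{t - 1..t + 1}|lborel. neumann (\<Delta> / 2) (char_exp w) s)
        = exp (- (2 * of_real pi * \<i> * cnj w * of_real t))" by (simp only: char_exp_def)
  qed
qed

lemma K_SO_eq_ft:
  assumes \<Delta>: "0 < \<Delta>" "\<Delta> \<le> 2"
  shows "K_SO \<Delta> = (\<lambda>w. ft (SO_density \<Delta> w))"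
  by (intro K_SO_eq is_repr_kernel_ft SO_solution_SO_density \<Delta>)

text \<open>A solution at one point w identifies \<open>K_SO \<Delta> w\<close>, the kernel at the
  other points being supplied by the Neumann series. This is what allows closed forms valid at
  generic w only.\<close>

lemma K_SO_eq_ft_solution:
  assumes \<Delta>: "0 < \<Delta>" "\<Delta> \<le> 2" and g: "SO_solution \<Delta> w g"
  shows "K_SO \<Delta> w = ft g"
proof -
  have "is_repr_kernel \<Delta> (K_SO \<Delta>)"
    unfolding K_SO_eq_ft[OF \<Delta>] by (intro is_repr_kernel_ft SO_solution_SO_density \<Delta>)
  then show ?thesis
    using SO_solution_in_H_SO[OF g \<Delta>(1)] reproducing_property[OF _ \<Delta> g] by (intro K_SO_eqI) auto
qed

text \<open>Moving w costs a multiple of |v - w|, locally uniformly in the second variable, by the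
  bound for the Neumann solution of a difference of exponentials; moving z is continuity of one
  entire function. Both variables may thus move together and along any set.\<close>

lemma continuous_K_SO:
  assumes \<Delta>: "0 < \<Delta>" "\<Delta> \<le> 2"
  shows "((\<lambda>q. K_SO \<Delta> (fst q) (snd q)) \<longlongrightarrow> K_SO \<Delta> w z) (at (w, z) within S)"
proof -
  have a: "0 \<le> \<Delta> / 2" "\<Delta> / 2 \<le> 1" using \<Delta> by auto
  let ?g = "SO_density \<Delta>"
  define R where "R = cmod w + 1"
  define X where "X = exp (pi * \<Delta> * R)"
  have b: "band (\<Delta> / 2) (15 * exp (pi * \<Delta> * cmod v)) (?g v)" for v
    unfolding SO_density_def by (rule band_neumann[OF char_exp_measurable char_exp_bound a])
  have hol: "ft (?g w) holomorphic_on UNIV" by (rule ft_holomorphic[OF b a(1)])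
  have diff: "cmod (ft (?g v) y - ft (?g w) y) \<le> \<Delta> * (15 * (X * (pi * \<Delta> * cmod (v - w)))) * exp (pi * \<Delta> * \<bar>Im y\<bar>)"
    if v: "cmod v \<le> R" for v y
  proof -
    have wR: "cmod w \<le> R" by (simp add: R_def)
    have m: "(\<lambda>t. char_exp v t - char_exp w t) \<in> borel_measurable borel"
      using char_exp_measurable[of v] char_exp_measurable[of w] by measurable
    have "band (\<Delta> / 2) (15 * (X * (pi * \<Delta> * cmod (v - w)))) (neumann (\<Delta> / 2) (\<lambda>t. char_exp v t - char_exp w t))"
      unfolding X_def by (rule band_neumann[OF m char_exp_diff_bound[OF _ v wR \<Delta>(1)] a])
    also have "neumann (\<Delta> / 2) (\<lambda>t. char_exp v t - char_exp w t) = (\<lambda>t. ?g v t - ?g w t)"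
      unfolding SO_density_def
      by (rule ext) (rule neumann_diff[OF char_exp_measurable char_exp_bound char_exp_measurable char_exp_bound a])
    finally have "cmod (ft (\<lambda>t. ?g v t - ?g w t) y) \<le> \<Delta> * (15 * (X * (pi * \<Delta> * cmod (v - w)))) * exp (pi * \<Delta> * \<bar>Im y\<bar>)"
      using ft_bound[OF _ a(1), of _ "\<lambda>t. ?g v t - ?g w t" y] by fastforce
    moreover have "ft (\<lambda>t. ?g v t - ?g w t) y = ft (?g v) y - ft (?g w) y"
      unfolding ft_def left_diff_distrib
      by (rule Bochner_Integration.integral_diff[OF integrable_ft[OF b] integrable_ft[OF b]])
    ultimately show ?thesis by simp
  qed
  let ?F = "at (w, z) within S"
  have fst: "(fst \<longlongrightarrow> w) ?F" and snd: "(snd \<longlongrightarrow> z) ?F"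
    using tendsto_fst[OF tendsto_ident_at[of "(w, z)" S]] tendsto_snd[OF tendsto_ident_at[of "(w, z)" S]]
    by (simp_all add: o_def)
  have "((\<lambda>q. \<Delta> * (15 * (X * (pi * \<Delta> * cmod (fst q - w)))) * exp (pi * \<Delta> * \<bar>Im (snd q)\<bar>))
        \<longlongrightarrow> \<Delta> * (15 * (X * (pi * \<Delta> * cmod (w - w)))) * exp (pi * \<Delta> * \<bar>Im z\<bar>)) ?F"
    by (intro tendsto_intros fst snd)
  then have lim: "((\<lambda>q. \<Delta> * (15 * (X * (pi * \<Delta> * cmod (fst q - w)))) * exp (pi * \<Delta> * \<bar>Im (snd q)\<bar>)) \<longlongrightarrow> 0) ?F"
    by simp
  have "((\<lambda>q. ft (?g (fst q)) (snd q) - ft (?g w) (snd q)) \<longlongrightarrow> 0) ?F"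
  proof (rule Lim_null_comparison[OF _ lim])
    have "eventually (\<lambda>q. dist (fst q) w < 1) ?F" using fst by (rule tendstoD) simp
    then show "eventually (\<lambda>q. norm (ft (?g (fst q)) (snd q) - ft (?g w) (snd q))
       \<le> \<Delta> * (15 * (X * (pi * \<Delta> * cmod (fst q - w)))) * exp (pi * \<Delta> * \<bar>Im (snd q)\<bar>)) ?F"
    proof eventually_elim
      case (elim q)
      have "cmod (fst q) \<le> R" using elim norm_triangle_ineq2[of "fst q" w] by (simp add: R_def dist_norm)
      then show ?case by (rule diff)
    qed
  qed
  moreover have "isCont (ft (?g w)) z"
    using holomorphic_on_imp_continuous_on[OF hol] by (simp add: continuous_on_eq_continuous_at)
  then have "((\<lambda>q. ft (?g w) (snd q)) \<longlongrightarrow> ft (?g w) z) ?F"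
    by (rule isCont_tendsto_compose[OF _ snd])
  ultimately have "((\<lambda>q. (ft (?g (fst q)) (snd q) - ft (?g w) (snd q)) + ft (?g w) (snd q)) \<longlongrightarrow> 0 + ft (?g w) z) ?F"
    by (rule tendsto_add)
  then show ?thesis by (simp add: K_SO_eq_ft[OF \<Delta>])
qed

section \<open>Explicit kernels\<close>

lemma ft_box:
  assumes "0 \<le> a" "u \<noteq> 0"
  shows "ft (indicator {-a..a}) u = sin (of_real pi * of_real (2 * a) * u) / (of_real pi * u)"
proof -
  have "2 * of_real pi * \<i> * u * ft (indicator {-a..a}) u = 2 * \<i> * sin (of_real pi * of_real (2 * a) * u)"
    unfolding ft_box_eq[OF assms(1)] sin_exp_eq by (simp add: mult_ac)
  then have "\<i> * (of_real pi * u * ft (indicator {-a..a}) u) = \<i> * sin (of_real pi * of_real (2 * a) * u)" by (simp add: mult.assoc)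
  then have "of_real pi * u * ft (indicator {-a..a}) u = sin (of_real pi * of_real (2 * a) * u)"
    by (simp only: mult_cancel_left complex_i_not_zero simp_thms)
  then show ?thesis using assms(2) by (simp add: field_simps)
qed

text \<open>Two points of the support are at most \<Delta> <= 1 apart, so every window contains the
  whole support and the moving integral is the total mass. The density can then differ from the
  exponential only by a constant.\<close>

lemma K_SO_small:
  assumes \<Delta>: "0 < \<Delta>" "\<Delta> \<le> 1" and gen: "gen1 w z"
  shows "K_SO \<Delta> w z = kform1 \<Delta> w z"
proof -
  let ?a = "\<Delta> / 2" and ?I = "{-(\<Delta> / 2)..\<Delta> / 2}"
  have a: "0 \<le> ?a" using \<Delta> by simp
  have z: "z \<noteq> cnj w" "z \<noteq> 0" "cnj w \<noteq> 0" using gen by (auto simp: gen1_def)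
  define S where "S = ft (indicator ?I) (- cnj w)"
  \<comment> \<open>Truncated to the support, the exponential minus c has total mass S - c \<Delta>,
    and the equation wants this to be 2 c.\<close>
  define c where "c = S / (2 + of_real \<Delta>)"
  have d2: "2 + complex_of_real \<Delta> \<noteq> 0"
  proof -
    have "complex_of_real (2 + \<Delta>) \<noteq> 0" using \<Delta> by (simp del: of_real_add)
    then show ?thesis by simp
  qed
  define g where "g t = indicator ?I t * (char_exp w t - c)" for t
  have ge: "g t * fexp t u = indicator ?I t * fexp t (u - cnj w)
        - c * (indicator ?I t * fexp t u)" for t u
    by (simp add: g_def char_exp_def algebra_simps flip: exp_add)
  have ftg: "ft g u = ft (indicator ?I) (u - cnj w) - c * ft (indicator ?I) u" for u
    unfolding ft_def ge using integrable_ft[OF band_box[of ?a]]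
    by (subst Bochner_Integration.integral_diff) auto
  have "SO_solution \<Delta> w g"
    unfolding SO_solution_def
  proof (intro conjI exI ballI)
    show "band ?a (exp (pi * \<Delta> * cmod w) + cmod c) g"
      unfolding band_def
    proof (intro conjI allI)
      show "g \<in> borel_measurable borel"
        unfolding g_def[abs_def] using char_exp_measurable[of w] by measurable
      show "cmod (g t) \<le> (exp (pi * \<Delta> * cmod w) + cmod c) * indicator ?I t" for t
      proof (cases "t \<in> ?I")
        case True
        then show ?thesis
          using char_exp_bound[OF True, of w] norm_triangle_ineq4[of "char_exp w t" c] by (simp add: g_def)
      qed (simp add: g_def)
    qed
    fix t assume t: "t \<in> {-\<Delta>/2..\<Delta>/2}"
    have "(LINT s:{t - 1..t + 1}|lborel. g s) = ft g 0"
      unfolding set_lebesgue_integral_def ft_def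
    proof (intro Bochner_Integration.integral_cong refl)
      fix s
      show "indicator {t - 1..t + 1} s *\<^sub>R g s = g s * exp (2 * of_real pi * \<i> * of_real s * 0)"
        using t \<Delta> by (auto simp: g_def indicator_def)
    qed
    also have "\<dots> = S - c * of_real \<Delta>"
    proof -
      have "(indicator ?I :: real \<Rightarrow> complex) = (\<lambda>t. of_real (indicator ?I t))"
        by (auto simp: indicator_def)
      then have "ft (indicator ?I) 0 = of_real \<Delta>" using \<Delta> by (simp add: ft_def)
      then show ?thesis unfolding ftg by (simp add: S_def)
    qed
    finally have "(LINT s:{t - 1..t + 1}|lborel. g s) = S - c * of_real \<Delta>" .
    moreover have "S = c * (2 + of_real \<Delta>)" using d2 by (simp add: c_def)
    ultimately show "g t + 1 / 2 * (LINT s:{t - 1..t + 1}|lborel. g s) = exp (- (2 * of_real pi * \<i> * cnj w * of_real t))"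
      using t by (simp add: g_def char_exp_def algebra_simps)
  qed
  then have "K_SO \<Delta> w z = ft g z" using K_SO_eq_ft_solution \<Delta> by simp
  also have "\<dots> = kform1 \<Delta> w z"
    unfolding ftg kform1_def Let_def c_def S_def
    using z by (subst (1 2 3) ft_box[OF a]) (auto simp: mult_ac)
  finally show ?thesis .
qed

section \<open>Three-piece exponential densities for \<Delta> > 1\<close>

lemma three_piece_has_integral:
  fixes g f1 f2 f3 :: "real \<Rightarrow> complex"
  assumes "lo \<le> - m" "0 \<le> m" "m \<le> hi"
    and "(f1 has_integral I1) {lo..-m}" "(f2 has_integral I2) {-m..m}" "(f3 has_integral I3) {m..hi}"
    and "\<And>t. lo \<le> t \<Longrightarrow> t < - m \<Longrightarrow> g t = f1 t" "\<And>t. - m \<le> t \<Longrightarrow> t \<le> m \<Longrightarrow> g t = f2 t" "\<And>t. m < t \<Longrightarrow> t \<le> hi \<Longrightarrow> g t = f3 t"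
  shows "(g has_integral (I1 + I2 + I3)) {lo..hi}"
proof -
  have 1: "(g has_integral I1) {lo..-m}"
    by (rule has_integral_spike_finite[OF _ _ assms(4), of "{-m}"]) (use assms(7) in auto)
  have 2: "(g has_integral I2) {-m..m}"
    by (rule has_integral_spike_finite[OF _ _ assms(5), of "{}"]) (use assms(8) in auto)
  have 3: "(g has_integral I3) {m..hi}"
    by (rule has_integral_spike_finite[OF _ _ assms(6), of "{m}"]) (use assms(9) in auto)
  have "(g has_integral (I1 + I2)) {lo..m}"
    using assms by (intro has_integral_combine[OF _ _ 1 2]) auto
  then show ?thesis using assms by (intro has_integral_combine[OF _ _ _ 3]) auto
qed

lemma exp_has_integral:
  fixes k c :: complex
  assumes "c \<noteq> 0" "lo \<le> hi"
  shows "((\<lambda>t. k * exp (c * of_real t)) has_integral (k * (exp (c * of_real hi) / c) - k * (exp (c * of_real lo) / c))) {lo..hi}"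
proof (rule fundamental_theorem_of_calculus[OF assms(2)])
  show "((\<lambda>t. k * (exp (c * of_real t) / c)) has_vector_derivative k * exp (c * of_real t)) (at t within {lo..hi})" for t
    using assms(1) by (auto intro!: derivative_eq_intros has_vector_derivative_real_field)
qed

lemma band_window_has_integral:
  assumes g: "band a B g" and i: "(g has_integral J) {lo..hi}" and s: "{t - 1..t + 1} \<inter> {-a..a} = {lo..hi}"
  shows "(LINT s:{t - 1..t + 1}|lborel. g s) = J"
proof -
  have "(LINT s:{t - 1..t + 1}|lborel. g s) = (LINT s:{lo..hi}|lborel. g s)"
    unfolding set_lebesgue_integral_def s[symmetric]
    using bandD(3)[OF g] by (intro Bochner_Integration.integral_cong) (auto simp: indicator_def)
  moreover have "set_integrable lborel {lo..hi} g"
    unfolding set_integrable_def using integrable_band_mult(1)[OF g, of "\<lambda>_. 1" 1]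
    by (intro integrable_mult_indicator) auto
  ultimately show ?thesis using i by (simp add: set_borel_integral_eq_integral(2) integral_unique)
qed

lemma ft_has_integral:
  assumes g: "band a B g" and i: "((\<lambda>t. g t * fexp t z) has_integral J) {-a..a}"
  shows "ft g z = J"
proof -
  have "ft g z = (LINT t:{-a..a}|lborel. g t * fexp t z)"
    unfolding ft_def set_lebesgue_integral_def
    using bandD(3)[OF g] by (intro Bochner_Integration.integral_cong) (auto simp: indicator_def)
  moreover have "set_integrable lborel {-a..a} (\<lambda>t. g t * fexp t z)"
    unfolding set_integrable_def using integrable_ft[OF g] by (intro integrable_mult_indicator) auto
  ultimately show ?thesis using i by (simp add: set_borel_integral_eq_integral(2) integral_unique)
qed

text \<open>All exponentials enter as independent nonzero variables, so what remains is rational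
  algebra. C1 and C2 are the solution of the first two equations; L1 and L2 are the linear system
  for A and B, and L3 defines D. The conclusions are the hypotheses of
  \<open>SO_solution_piecewise\<close>.\<close>

lemma coefficient_identities:
  fixes p q x y V \<kappa> A B D C1 C2 F G Gs :: complex
  assumes nz: "p \<noteq> 0" "q \<noteq> 0" "x \<noteq> 0" "y \<noteq> 0" "V \<noteq> 0" "1 - V\<^sup>2 \<noteq> 0"
    and C1: "C1 = (- V\<^sup>2 - \<i> * V * (x * y)) / (1 - V\<^sup>2)"
    and C2: "C2 = (- V\<^sup>2 + \<i> * V / (x * y)) / (1 - V\<^sup>2)"
    and F: "F = ((y + 1 / y) + \<i> * V * (x - 1 / x)) / (1 - V\<^sup>2)"
    and G: "G = ((x + 1 / x) + \<i> * V / x - y) / (1 - V\<^sup>2) - (y - 1 / y) / (\<i> * V * (1 - V\<^sup>2)) + \<kappa> * F"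
    and Gs: "Gs = ((x + 1 / x) - \<i> * V * x - 1 / y) / (1 - V\<^sup>2) - (y - 1 / y) / (\<i> * V * (1 - V\<^sup>2)) + \<kappa> * F"
    and L1: "(1 / p - \<i> / q + \<i> / p + \<kappa> * (1 / q - \<i> / p)) * A + (p + \<i> * q - \<i> * p + \<kappa> * (q + \<i> * p)) * B = Gs"
    and L2: "(1 / p - \<i> / q - 1 / q + \<kappa> * (1 / q - \<i> / p)) * A + (p + \<i> * q - q + \<kappa> * (q + \<i> * p)) * B = G"
    and L3: "2 * D = (1 / q - \<i> / p) * A + (q + \<i> * p) * B - F"
  shows "C1 - 1 - \<i> * C2 * (x * y) / V = 0"
    and "C2 - 1 + \<i> * C1 / (x * y) / V = 0"
    and "- 2 * \<i> * A / p + 2 * \<i> * B * p + 2 * \<i> / V * (C2 * x) = 2 * D"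
    and "- 2 * A / q - 2 * B * q + 2 * \<i> / V * (C1 / x) = - 2 * D"
    and "(- 2 * \<i> * A / q + 2 * \<i> * B * q + 2 * \<i> / V * (C2 * y)) - (- 2 * A / p - 2 * B * p + 2 * \<i> / V * (C1 / y))
        + 4 * \<kappa> * D + 2 * \<i> / V * (1 / y - y) = 2 * D"
proof -
  define N where "N = 1 - V\<^sup>2"
  have N: "N \<noteq> 0" using nz by (simp add: N_def)
  show "C1 - 1 - \<i> * C2 * (x * y) / V = 0" "C2 - 1 + \<i> * C1 / (x * y) / V = 0"
    unfolding C1 C2 using nz by (simp_all add: field_simps power2_eq_square)
  have F1: "F * (\<i> * V) = C2 * x - C1 / x"
    unfolding F C1 C2 N_def[symmetric] using nz N by (simp add: field_simps power2_eq_square)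
  have G1: "(G - Gs) * (\<i> * V) = C2 * x + C1 / x"
    unfolding G Gs C1 C2 N_def[symmetric] using nz N by (simp add: field_simps power2_eq_square)
  \<comment> \<open>Treating 1/N as a symbol makes the next identities polynomial in it; N h = 1 is
    applied once, at the end of \<open>G2\<close>.\<close>
  define h where "h = 1 / N"
  have h: "h - V\<^sup>2 * h - 1 = 0" using N by (simp add: h_def N_def field_simps)
  have e1: "C2 * y - C1 / y = (- (V\<^sup>2 * (y - 1 / y)) + \<i> * V * (x + 1 / x)) * h"
    unfolding C1 C2 N_def[symmetric] h_def using nz N by (simp add: field_simps power2_eq_square)
  have e2: "G + Gs + (1 - 2 * \<kappa>) * F = 2 * (x + 1 / x) * h + 2 * \<i> / V * (y - 1 / y) * h"
  proof -
    \<comment> \<open>The multiples of \<kappa> cancel, and the remaining F removes the terms in y +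
      1/y and x - 1/x.\<close>
    have "G + Gs + (1 - 2 * \<kappa>) * F = ((2 * (x + 1 / x) - \<i> * V * (x - 1 / x) - (y + 1 / y)) / N
        - 2 * ((y - 1 / y) / (\<i> * V * N))) + F"
      unfolding G Gs N_def[symmetric] by (simp add: algebra_simps diff_divide_distrib add_divide_distrib)
    also have "\<dots> = 2 * (x + 1 / x) * h - 2 * ((y - 1 / y) / (\<i> * V * N))"
      unfolding F N_def[symmetric] h_def by (simp add: algebra_simps diff_divide_distrib add_divide_distrib)
    also have "(y - 1 / y) / (\<i> * V * N) = - \<i> / V * (y - 1 / y) * h"
      unfolding h_def by (simp add: divide_inverse mult_ac)
    finally show ?thesis by (simp add: algebra_simps diff_divide_distrib)
  qed
  have G2: "G + Gs + 2 * \<i> / V * (C2 * y - C1 / y) + (1 - 2 * \<kappa>) * F + 2 * \<i> / V * (1 / y - y) = 0"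
  proof -
    have "G + Gs + 2 * \<i> / V * (C2 * y - C1 / y) + (1 - 2 * \<kappa>) * F + 2 * \<i> / V * (1 / y - y)
      = (G + Gs + (1 - 2 * \<kappa>) * F) + 2 * \<i> / V * (C2 * y - C1 / y) + 2 * \<i> / V * (1 / y - y)" by (simp only: add_ac)
    also have "\<dots> = 2 * \<i> / V * (y - 1 / y) * (h - V\<^sup>2 * h - 1)"
      unfolding e1 e2 using nz by (simp add: algebra_simps diff_divide_distrib add_divide_distrib)
    finally show ?thesis unfolding h by simp
  qed
  have ii: "- \<i> / V * (X * (\<i> * V)) = X" for X using nz by (simp add: algebra_simps)
  have F1': "F = - \<i> / V * (C2 * x - C1 / x)" unfolding F1[symmetric] ii ..
  have G1': "G - Gs = - \<i> / V * (C2 * x + C1 / x)" unfolding G1[symmetric] ii ..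
  \<comment> \<open>S is L2 minus L1, and L is L3, after G - Gs and F are expressed through C1 and
    C2. The third conclusion is then S - L and the fourth S + L.\<close>
  define S where "S = (- \<i> / p - 1 / q) * A + (\<i> * p - q) * B - (- \<i> / V * (C2 * x + C1 / x))"
  define L where "L = 2 * D - ((1 / q - \<i> / p) * A + (q + \<i> * p) * B - (- \<i> / V * (C2 * x - C1 / x)))"
  have S: "S = 0"
    unfolding S_def G1'[symmetric] unfolding L1[symmetric] L2[symmetric] by (simp add: algebra_simps)
  have L: "L = 0" unfolding L_def F1'[symmetric] L3 by simp
  have "- 2 * \<i> * A / p + 2 * \<i> * B * p + 2 * \<i> / V * (C2 * x) - 2 * D = S - L"
    unfolding S_def L_def by (simp add: algebra_simps)
  then show "- 2 * \<i> * A / p + 2 * \<i> * B * p + 2 * \<i> / V * (C2 * x) = 2 * D"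
    unfolding S L by simp
  have "- 2 * A / q - 2 * B * q + 2 * \<i> / V * (C1 / x) - (- 2 * D) = S + L"
    unfolding S_def L_def by (simp add: algebra_simps)
  then have "- 2 * A / q - 2 * B * q + 2 * \<i> / V * (C1 / x) - (- 2 * D) = 0"
    unfolding S L by (simp only: add_0)
  then show "- 2 * A / q - 2 * B * q + 2 * \<i> / V * (C1 / x) = - 2 * D"
    by (rule right_minus_eq[THEN iffD1])
  \<comment> \<open>Q is L1 plus L2, with the part proportional to 1 - 2 \<kappa> replaced by means
    of L3.\<close>
  define Q where "Q = (2 / p - 2 * \<i> / q) * A + (2 * p + 2 * \<i> * q) * B - (1 - 2 * \<kappa>) * (2 * D + F) - (G + Gs)"
  have Q: "Q = 0"
    unfolding Q_def L1[symmetric] L2[symmetric] L3 by (simp add: algebra_simps)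
  have "(- 2 * \<i> * A / q + 2 * \<i> * B * q + 2 * \<i> / V * (C2 * y)) - (- 2 * A / p - 2 * B * p + 2 * \<i> / V * (C1 / y))
        + 4 * \<kappa> * D + 2 * \<i> / V * (1 / y - y) - 2 * D
      = Q + (G + Gs + 2 * \<i> / V * (C2 * y - C1 / y) + (1 - 2 * \<kappa>) * F + 2 * \<i> / V * (1 / y - y))"
    unfolding Q_def by (simp add: algebra_simps diff_divide_distrib add_divide_distrib)
  then show "(- 2 * \<i> * A / q + 2 * \<i> * B * q + 2 * \<i> / V * (C2 * y)) - (- 2 * A / p - 2 * B * p + 2 * \<i> / V * (C1 / y))
        + 4 * \<kappa> * D + 2 * \<i> / V * (1 / y - y) = 2 * D"
    unfolding Q G2 by simp
qed

text \<open>The determinant is u - cnj u for u = cnj a * b, so Im u decides. With \<theta> = (1 -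
  \<Delta>)/2 in [- 1/2, 0) it equals 2 - 2 sin \<theta> - (\<Delta>/2) cos \<theta>, where sin
  \<theta> <= 0 and the last product is at most 1.\<close>

lemma det_nonzero:
  assumes \<Delta>: "1 < \<Delta>" "\<Delta> \<le> 2"
  shows "cnj (ac \<Delta>) * bc \<Delta> - ac \<Delta> * cnj (bc \<Delta>) \<noteq> 0"
proof -
  define s1 c1 s2 c2 k where "s1 = sin (\<Delta> / 4)" and "c1 = cos (\<Delta> / 4)"
    and "s2 = sin ((2 - \<Delta>) / 4)" and "c2 = cos ((2 - \<Delta>) / 4)" and "k = (2 - \<Delta>) / 4"
  have e: "exp (complex_of_real \<Delta> * \<i> / 4) = Complex c1 s1"
      "exp ((2 - complex_of_real \<Delta>) * \<i> / 4) = Complex c2 s2"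
    by (simp_all add: complex_eq_iff Re_exp Im_exp s1_def c1_def s2_def c2_def)
  have k: "(2 - complex_of_real \<Delta>) / 4 = of_real k" by (simp add: k_def)
  have a: "Re (ac \<Delta>) = c1 - s2 + s1 + k * (c2 - s1)" "Im (ac \<Delta>) = s1 + c2 - c1 + k * (s2 + c1)"
   and b: "Re (bc \<Delta>) = c1 - s2 - c2 + k * (c2 - s1)" "Im (bc \<Delta>) = s1 + c2 - s2 + k * (s2 + c1)"
    unfolding ac_def bc_def tauc_def Let_def e k by simp_all
  have p: "s1\<^sup>2 + c1\<^sup>2 = 1" "s2\<^sup>2 + c2\<^sup>2 = 1" by (simp_all add: s1_def c1_def s2_def c2_def)
  have "Im (cnj (ac \<Delta>) * bc \<Delta>) = 2 - 2 * (s2 * c1 - c2 * s1) - (1 - 2 * k) * (c2 * c1 + s2 * s1)"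
    using p by (simp add: a b) algebra
  also have "s2 * c1 - c2 * s1 = sin ((2 - \<Delta>) / 4 - \<Delta> / 4)"
    by (simp add: sin_diff s1_def c1_def s2_def c2_def)
  also have "c2 * c1 + s2 * s1 = cos ((2 - \<Delta>) / 4 - \<Delta> / 4)"
    by (simp add: cos_diff s1_def c1_def s2_def c2_def)
  also have "2 - 2 * sin ((2 - \<Delta>) / 4 - \<Delta> / 4) - (1 - 2 * k) * cos ((2 - \<Delta>) / 4 - \<Delta> / 4) > 0"
  proof -
    have "0 \<le> sin (- ((2 - \<Delta>) / 4 - \<Delta> / 4))"
    proof (rule sin_ge_zero)
      show "0 \<le> - ((2 - \<Delta>) / 4 - \<Delta> / 4)" "- ((2 - \<Delta>) / 4 - \<Delta> / 4) \<le> pi"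
        using \<Delta> pi_gt3 by (simp_all add: field_simps)
    qed
    then have "sin ((2 - \<Delta>) / 4 - \<Delta> / 4) \<le> 0" by (simp only: sin_minus)
    moreover have "(1 - 2 * k) * cos ((2 - \<Delta>) / 4 - \<Delta> / 4) \<le> 1 * 1"
      using \<Delta> by (intro order_trans[OF mult_left_mono[OF cos_le_one]]) (auto simp: k_def)
    moreover have "0 < 2 - 2 * s - t" if "s \<le> 0" "t \<le> 1 * 1" for s t :: real using that by linarith
    ultimately show ?thesis by blast
  qed
  finally have pos: "0 < Im (cnj (ac \<Delta>) * bc \<Delta>)" .
  have "Im (cnj (ac \<Delta>) * bc \<Delta> - ac \<Delta> * cnj (bc \<Delta>)) = 2 * Im (cnj (ac \<Delta>) * bc \<Delta>)" by simp
  then have "Im (cnj (ac \<Delta>) * bc \<Delta> - ac \<Delta> * cnj (bc \<Delta>)) \<noteq> 0" using pos by linarith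
  then show ?thesis by (metis zero_complex.sel(2))
qed

text \<open>The definitions of \<open>Af\<close> and \<open>Bf\<close> are Cramer's rule for this
  system.\<close>

lemma Af_Bf_system:
  assumes \<Delta>: "1 < \<Delta>" "\<Delta> \<le> 2"
  shows "ac \<Delta> * Af \<Delta> w + cnj (ac \<Delta>) * Bf \<Delta> w = Gf \<Delta> w"
    and "bc \<Delta> * Af \<Delta> w + cnj (bc \<Delta>) * Bf \<Delta> w = cnj (Gf \<Delta> (cnj w))"
proof -
  define det where "det = cnj (ac \<Delta>) * bc \<Delta> - ac \<Delta> * cnj (bc \<Delta>)"
  have d: "det \<noteq> 0" unfolding det_def by (rule det_nonzero[OF \<Delta>])
  have "ac \<Delta> * Af \<Delta> w + cnj (ac \<Delta>) * Bf \<Delta> w = Gf \<Delta> w * det / det"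
    unfolding Af_def Bf_def det_def[symmetric] times_divide_eq_right add_divide_distrib[symmetric]
    by (simp add: det_def algebra_simps)
  then show "ac \<Delta> * Af \<Delta> w + cnj (ac \<Delta>) * Bf \<Delta> w = Gf \<Delta> w" using d by simp
  have "bc \<Delta> * Af \<Delta> w + cnj (bc \<Delta>) * Bf \<Delta> w = cnj (Gf \<Delta> (cnj w)) * det / det"
    unfolding Af_def Bf_def det_def[symmetric] times_divide_eq_right add_divide_distrib[symmetric]
    by (simp add: det_def algebra_simps)
  then show "bc \<Delta> * Af \<Delta> w + cnj (bc \<Delta>) * Bf \<Delta> w = cnj (Gf \<Delta> (cnj w))" using d by simp
qed

text \<open>Trigonometric functions are traded for x, y and their inverses, the variables of
  \<open>coefficient_identities\<close>. The parameter u is free because both w and cnj w are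
  needed.\<close>

lemma coefficient_functions_exp:
  fixes \<Delta> :: real and u :: complex
  defines "x \<equiv> exp (\<i> * of_real pi * of_real \<Delta> * u)" and "y \<equiv> exp (\<i> * of_real pi * (2 - of_real \<Delta>) * u)"
    and "V \<equiv> 4 * of_real pi * u" and "\<kappa> \<equiv> (2 - complex_of_real \<Delta>) / 4"
  shows "Cf u = (- V\<^sup>2 - \<i> * V * (x * y)) / (1 - V\<^sup>2)"
    and "Ff \<Delta> u = ((y + 1 / y) + \<i> * V * (x - 1 / x)) / (1 - V\<^sup>2)"
    and "Gf \<Delta> u = ((x + 1 / x) + \<i> * V / x - y) / (1 - V\<^sup>2) - (y - 1 / y) / (\<i> * V * (1 - V\<^sup>2)) + \<kappa> * Ff \<Delta> u"
proof -
  have V2: "16 * (of_real pi)\<^sup>2 * u\<^sup>2 = V\<^sup>2" by (simp add: V_def power_mult_distrib)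
  have xy: "exp (2 * of_real pi * \<i> * u) = x * y"
    by (simp add: x_def y_def algebra_simps flip: exp_add)
  have cx: "2 * cos (of_real pi * of_real \<Delta> * u) = x + 1 / x" and cy: "2 * cos (of_real pi * (2 - of_real \<Delta>) * u) = y + 1 / y"
   and sx: "2 * sin (of_real pi * of_real \<Delta> * u) = - \<i> * (x - 1 / x)" and sy: "2 * sin (of_real pi * (2 - of_real \<Delta>) * u) = - \<i> * (y - 1 / y)"
    by (simp_all add: x_def y_def cos_exp_eq sin_exp_eq exp_minus inverse_eq_divide mult.assoc)
  show "Cf u = (- V\<^sup>2 - \<i> * V * (x * y)) / (1 - V\<^sup>2)"
    unfolding Cf_def Let_def V2 xy by (simp add: V2 flip: V2) (simp add: V_def mult_ac)
  have "8 * of_real pi * u * sin (of_real pi * of_real \<Delta> * u) = V * (2 * sin (of_real pi * of_real \<Delta> * u))"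
    by (simp add: V_def)
  then have n: "8 * of_real pi * u * sin (of_real pi * of_real \<Delta> * u) = - (\<i> * V * (x - 1 / x))"
    unfolding sx by simp
  show "Ff \<Delta> u = ((y + 1 / y) + \<i> * V * (x - 1 / x)) / (1 - V\<^sup>2)"
    unfolding Ff_def Let_def V2 cy n by simp
  have ex: "exp (- of_real pi * of_real \<Delta> * \<i> * u) = 1 / x"
    by (simp add: x_def exp_minus inverse_eq_divide mult_ac)
  have ey: "exp (of_real pi * (2 - of_real \<Delta>) * \<i> * u) = y" by (simp add: y_def mult_ac)
  have s: "sin (of_real pi * (2 - of_real \<Delta>) * u) / (2 * of_real pi * u * (1 - V\<^sup>2)) = (y - 1 / y) / (\<i> * V * (1 - V\<^sup>2))"
  proof -
    have "sin (of_real pi * (2 - of_real \<Delta>) * u) / (2 * of_real pi * u * (1 - V\<^sup>2))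
       = (2 * sin (of_real pi * (2 - of_real \<Delta>) * u)) / (V * (1 - V\<^sup>2))"
      by (simp add: V_def)
    then show ?thesis unfolding sy by (simp add: divide_inverse mult_ac)
  qed
  show "Gf \<Delta> u = ((x + 1 / x) + \<i> * V / x - y) / (1 - V\<^sup>2) - (y - 1 / y) / (\<i> * V * (1 - V\<^sup>2)) + \<kappa> * Ff \<Delta> u"
    unfolding Gf_def Let_def V2 cx ex ey s \<kappa>_def by (simp add: V_def mult_ac)
qed


text \<open>\<open>A\<close>, \<open>B\<close>, \<open>D\<close>, \<open>C2\<close> are instantiated with the conjugates of \<open>A(w)\<close>, \<open>B(w)\<close>, \<open>D(w)\<close>, \<open>C(w)\<close>, and \<open>C1\<close> with
  \<open>C(cnj w)\<close>. On the outer pieces the differentiated integral equation couples values at distance 1 and forces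
  the exponentials of frequency \<open>\<plusminus> 1 / 2\<close>; \<open>E1\<close>, \<open>E2\<close> and \<open>E3\<close> are the remaining conditions at \<open>\<bar>t\<bar> = 1 - \<Delta> / 2\<close> and
  on the total mass.\<close>
lemma SO_solution_piecewise:
  fixes \<Delta> :: real and w A B D C1 C2 :: complex
  defines "a \<equiv> \<Delta> / 2" and "m \<equiv> 1 - \<Delta> / 2"
    and "p \<equiv> exp (of_real \<Delta> * \<i> / 4)" and "q \<equiv> exp ((2 - of_real \<Delta>) * \<i> / 4)"
    and "x \<equiv> exp (\<i> * of_real pi * of_real \<Delta> * cnj w)" and "y \<equiv> exp (\<i> * of_real pi * (2 - of_real \<Delta>) * cnj w)"
    and "V \<equiv> 4 * of_real pi * cnj w" and "\<kappa> \<equiv> (2 - complex_of_real \<Delta>) / 4"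
    and "gL \<equiv> \<lambda>t. A * exp (\<i> / 2 * of_real t) + B * exp (- (\<i> / 2) * of_real t) + C2 * exp (- (2 * of_real pi * \<i> * cnj w) * of_real t)"
    and "gR \<equiv> \<lambda>t. (- \<i> * exp (- (\<i> / 2)) * A) * exp (\<i> / 2 * of_real t) + (\<i> * exp (\<i> / 2) * B) * exp (- (\<i> / 2) * of_real t)
               + C1 * exp (- (2 * of_real pi * \<i> * cnj w) * of_real t)"
  defines "g \<equiv> \<lambda>t. if \<bar>t\<bar> \<le> m then D + exp (- (2 * of_real pi * \<i> * cnj w) * of_real t)
       else if m < t \<and> t \<le> a then gR t else if - a \<le> t \<and> t < - m then gL t else 0"
  assumes \<Delta>: "1 < \<Delta>" "\<Delta> \<le> 2" and w: "w \<noteq> 0"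
    and R: "C1 - 1 - \<i> * C2 * (x * y) / V = 0"
    and L: "C2 - 1 + \<i> * C1 / (x * y) / V = 0"
    and E1: "- 2 * \<i> * A / p + 2 * \<i> * B * p + 2 * \<i> / V * (C2 * x) = 2 * D"
    and E2: "- 2 * A / q - 2 * B * q + 2 * \<i> / V * (C1 / x) = - 2 * D"
    and E3: "(- 2 * \<i> * A / q + 2 * \<i> * B * q + 2 * \<i> / V * (C2 * y)) - (- 2 * A / p - 2 * B * p + 2 * \<i> / V * (C1 / y))
        + 4 * \<kappa> * D + 2 * \<i> / V * (1 / y - y) = 2 * D"
  shows "\<exists>K. band a K g" and "SO_solution \<Delta> w g"
proof -
  define cE where "cE = - (2 * of_real pi * \<i> * cnj w)"
  have V0: "V \<noteq> 0" using w by (simp add: V_def)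
  have cE0: "cE \<noteq> 0" using w by (simp add: cE_def)
  have cEV: "1 / cE = 2 * \<i> / V" using w by (simp add: cE_def V_def field_simps)
  have am: "0 \<le> m" "m \<le> a" "0 \<le> a" "a = 1 - m" using \<Delta> by (auto simp: a_def m_def)
  have nz: "p \<noteq> 0" "q \<noteq> 0" "x \<noteq> 0" "y \<noteq> 0" by (simp_all add: p_def q_def x_def y_def)
  define e where "e t = exp (cE * of_real t)" for t :: real
  define AR BR where "AR = - \<i> * exp (- (\<i> / 2)) * A" and "BR = \<i> * exp (\<i> / 2) * B"
  have gL: "gL t = A * exp (\<i> / 2 * of_real t) + B * exp (- (\<i> / 2) * of_real t) + C2 * exp (cE * of_real t)" for t
    by (simp only: gL_def cE_def)
  have gR: "gR t = AR * exp (\<i> / 2 * of_real t) + BR * exp (- (\<i> / 2) * of_real t) + C1 * exp (cE * of_real t)" for t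
    by (simp only: gR_def cE_def AR_def BR_def)
  have ga: "g t = D + e t" if "- m \<le> t" "t \<le> m" for t using that by (auto simp: g_def e_def cE_def)
  have gb: "g t = gR t" if "m < t" "t \<le> a" for t using that am by (auto simp: g_def)
  have gc: "g t = gL t" if "- a \<le> t" "t < - m" for t using that am by (auto simp: g_def)
  have gd: "g t = 0" if "t \<notin> {-a..a}" for t using that am by (auto simp: g_def)
  have eb: "cmod (e t) \<le> exp (pi * \<Delta> * cmod w)" if "t \<in> {-a..a}" for t
    using char_exp_bound[of t \<Delta> w] that by (simp add: e_def cE_def char_exp_def a_def)
  define K where "K = cmod A + cmod B + cmod AR + cmod BR + cmod D + (1 + cmod C1 + cmod C2) * exp (pi * \<Delta> * cmod w)"
  have band: "band a K g"
    unfolding band_def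
  proof (intro conjI allI)
    have "g = (\<lambda>t. if \<bar>t\<bar> \<le> m then D + exp (cE * of_real t) else if m < t \<and> t \<le> a then gR t else if - a \<le> t \<and> t < - m then gL t else 0)"
      by (simp only: g_def cE_def)
    moreover have "\<dots> \<in> borel_measurable borel" unfolding gL gR by measurable
    ultimately show "g \<in> borel_measurable borel" by simp
    fix t
    show "cmod (g t) \<le> K * indicator {-a..a} t"
    proof (cases "t \<in> {-a..a}")
      case True
      define X where "X = exp (pi * \<Delta> * cmod w)"
      have X0: "0 \<le> X" by (simp add: X_def)
      have eX: "cmod (e t) \<le> X" unfolding X_def by (rule eb[OF True])
      have lin: "cmod (k1 * exp (\<i> / 2 * of_real t) + k2 * exp (- (\<i> / 2) * of_real t) + k3 * exp (cE * of_real t)) \<le> cmod k1 + cmod k2 + cmod k3 * X" for k1 k2 k3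
      proof -
        have "cmod (k1 * exp (\<i> / 2 * of_real t) + k2 * exp (- (\<i> / 2) * of_real t) + k3 * exp (cE * of_real t))
          \<le> cmod (k1 * exp (\<i> / 2 * of_real t)) + cmod (k2 * exp (- (\<i> / 2) * of_real t)) + cmod (k3 * exp (cE * of_real t))"
          by (intro norm_triangle_mono order_refl norm_triangle_ineq)
        also have "cmod (k3 * exp (cE * of_real t)) \<le> cmod k3 * X"
          unfolding norm_mult using eX by (intro mult_left_mono) (auto simp: e_def)
        finally show ?thesis by (simp add: norm_mult)
      qed
      consider "\<bar>t\<bar> \<le> m" | "m < t" "t \<le> a" | "- a \<le> t" "t < - m" using True by fastforce
      then have "cmod (g t) \<le> K"
      proof cases
        case 1
        then have "g t = D + e t" by (intro ga) auto
        then have "cmod (g t) \<le> cmod D + X" using norm_triangle_ineq[of D "e t"] eX by simp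
        moreover have "0 \<le> cmod C1 * X" "0 \<le> cmod C2 * X" using X0 by auto
        ultimately show ?thesis unfolding K_def X_def[symmetric] distrib_right mult_1_left
          using norm_ge_zero[of A] norm_ge_zero[of B] norm_ge_zero[of AR] norm_ge_zero[of BR] by linarith
      next
        case 2
        have "0 \<le> cmod C2 * X" using X0 by auto
        then show ?thesis unfolding gb[OF 2] gR K_def X_def[symmetric] distrib_right
          using lin[of AR BR C1] norm_ge_zero[of A] norm_ge_zero[of B] norm_ge_zero[of D] X0 by linarith
      next
        case 3
        have "0 \<le> cmod C1 * X" using X0 by auto
        then show ?thesis unfolding gc[OF 3] gL K_def X_def[symmetric] distrib_right
          using lin[of A B C2] norm_ge_zero[of AR] norm_ge_zero[of BR] norm_ge_zero[of D] X0 by linarith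
      qed
      then show ?thesis using True by simp
    qed (simp add: gd)
  qed
  then show "\<exists>K. band a K g" by blast
  \<comment> \<open>\<open>PL\<close> and \<open>PR\<close> are primitives of the outer pieces,
    their constants chosen so that a shift by 1 of \<open>PL\<close> is again a combination of the
    exponentials in \<open>gR\<close>, and conversely.\<close>
  define PL where "PL t = A * (exp (\<i> / 2 * of_real t) / (\<i> / 2)) + B * (exp (- (\<i> / 2) * of_real t) / (- (\<i> / 2))) + C2 * (exp (cE * of_real t) / cE)" for t :: real
  define PR where "PR t = AR * (exp (\<i> / 2 * of_real t) / (\<i> / 2)) + BR * (exp (- (\<i> / 2) * of_real t) / (- (\<i> / 2))) + C1 * (exp (cE * of_real t) / cE)" for t :: real
  have iL: "(gL has_integral PL hi - PL lo) {lo..hi}" if "lo \<le> hi" for lo hi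
  proof -
    have "(gL has_integral (A * (exp (\<i> / 2 * of_real hi) / (\<i> / 2)) - A * (exp (\<i> / 2 * of_real lo) / (\<i> / 2)))
       + (B * (exp (- (\<i> / 2) * of_real hi) / (- (\<i> / 2))) - B * (exp (- (\<i> / 2) * of_real lo) / (- (\<i> / 2))))
       + (C2 * (exp (cE * of_real hi) / cE) - C2 * (exp (cE * of_real lo) / cE))) {lo..hi}"
      unfolding gL_def cE_def[symmetric] using cE0 that by (intro has_integral_add exp_has_integral) auto
    then show ?thesis by (simp only: PL_def add_diff_add)
  qed
  have iR: "(gR has_integral PR hi - PR lo) {lo..hi}" if "lo \<le> hi" for lo hi
  proof -
    have "(gR has_integral (AR * (exp (\<i> / 2 * of_real hi) / (\<i> / 2)) - AR * (exp (\<i> / 2 * of_real lo) / (\<i> / 2)))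
       + (BR * (exp (- (\<i> / 2) * of_real hi) / (- (\<i> / 2))) - BR * (exp (- (\<i> / 2) * of_real lo) / (- (\<i> / 2))))
       + (C1 * (exp (cE * of_real hi) / cE) - C1 * (exp (cE * of_real lo) / cE))) {lo..hi}"
      unfolding gR_def cE_def[symmetric] AR_def[symmetric] BR_def[symmetric] using cE0 that by (intro has_integral_add exp_has_integral) auto
    then show ?thesis by (simp only: PR_def add_diff_add)
  qed
  have iM: "((\<lambda>t. D + e t) has_integral 2 * of_real m * D + (e m / cE - e (- m) / cE)) {-m..m}"
  proof -
    have "((\<lambda>t. D) has_integral 2 * of_real m * D) {-m..m}"
      using has_integral_const_real[of D "-m" m] am by (simp add: scaleR_conv_of_real)
    moreover have "((\<lambda>t. 1 * exp (cE * of_real t)) has_integral 1 * (exp (cE * of_real m) / cE) - 1 * (exp (cE * of_real (-m)) / cE)) {-m..m}"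
      using cE0 am by (intro exp_has_integral) auto
    ultimately have "((\<lambda>t. D + 1 * exp (cE * of_real t)) has_integral 2 * of_real m * D + (1 * (exp (cE * of_real m) / cE) - 1 * (exp (cE * of_real (-m)) / cE))) {-m..m}"
      by (rule has_integral_add)
    then show ?thesis by (simp add: e_def)
  qed
  \<comment> \<open>Because a + m = 1, every window centred in the support meets it in an interval
    that contains [- m, m]: all of it for |t| <= m, [t - 1, a] to the right and [- a, t + 1] to the
    left. \<open>J\<close> is the integral of g over such an interval.\<close>
  define J where "J lo hi = (PL (- m) - PL lo) + (2 * of_real m * D + (e m / cE - e (- m) / cE)) + (PR hi - PR m)" for lo hi
  have int: "(g has_integral J lo hi) {lo..hi}" if "- a \<le> lo" "lo \<le> - m" "m \<le> hi" "hi \<le> a" for lo hi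
    unfolding J_def using that am
    by (intro three_piece_has_integral[OF _ _ _ iL iM iR]) (auto intro: ga gb gc)
  have ex: "exp (\<i> / 2 * complex_of_real a) = p" "exp (\<i> / 2 * complex_of_real (- a)) = 1 / p"
     "exp (- (\<i> / 2) * complex_of_real a) = 1 / p" "exp (- (\<i> / 2) * complex_of_real (- a)) = p"
     "exp (\<i> / 2 * complex_of_real m) = q" "exp (\<i> / 2 * complex_of_real (- m)) = 1 / q"
     "exp (- (\<i> / 2) * complex_of_real m) = 1 / q" "exp (- (\<i> / 2) * complex_of_real (- m)) = q"
    by (simp_all add: p_def q_def a_def m_def exp_minus[symmetric] inverse_eq_divide[symmetric] algebra_simps diff_divide_distrib)
  have ee: "exp (cE * complex_of_real a) = 1 / x" "exp (cE * complex_of_real (- a)) = x"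
     "exp (cE * complex_of_real m) = 1 / y" "exp (cE * complex_of_real (- m)) = y"
    by (simp_all add: x_def y_def cE_def a_def m_def exp_minus[symmetric] inverse_eq_divide[symmetric] algebra_simps)
  have pq: "exp (\<i> / 2) = p * q" "exp (- (\<i> / 2)) = 1 / (p * q)"
    by (simp_all add: p_def q_def algebra_simps diff_divide_distrib exp_minus[symmetric] inverse_eq_divide[symmetric] flip: exp_add)
  have exy: "exp (- cE) = x * y"
    by (simp add: x_def y_def cE_def algebra_simps flip: exp_add)
  have di: "u / (\<i> / 2) = - 2 * \<i> * u" "u / (- (\<i> / 2)) = 2 * \<i> * u" and dc: "u / cE = 2 * \<i> / V * u" for u
    by (simp_all add: cEV[symmetric])
  have AB: "AR = - \<i> * A / (p * q)" "BR = \<i> * B * (p * q)"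
    by (simp_all add: AR_def BR_def pq)
  have ABp: "AR * p = - \<i> * A / q" "BR * (1 / p) = \<i> * B * q" "AR * q = - \<i> * A / p" "BR * (1 / q) = \<i> * B * p"
    unfolding AB using nz by simp_all
  have PRx: "PR t = - 2 * \<i> * (AR * exp (\<i> / 2 * of_real t)) + 2 * \<i> * (BR * exp (- (\<i> / 2) * of_real t)) + 2 * \<i> / V * (C1 * exp (cE * of_real t))" for t
    unfolding PR_def di dc by (simp add: mult_ac)
  have PLx: "PL t = - 2 * \<i> * (A * exp (\<i> / 2 * of_real t)) + 2 * \<i> * (B * exp (- (\<i> / 2) * of_real t)) + 2 * \<i> / V * (C2 * exp (cE * of_real t))" for t
    unfolding PL_def di dc by (simp add: mult_ac)
  \<comment> \<open>E1 and E2 fix the primitives at the ends of the support, and with them E3 makes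
    the total mass - 2 D. That balances the constant D in the middle, and on the outer pieces it
    cancels the boundary terms.\<close>
  have PLa: "PL (- a) = 2 * D"
    unfolding PLx ex ee E1[symmetric] by simp
  have PRa: "PR a = - 2 * D"
    unfolding PRx ex ee ABp E2[symmetric] by (simp add: mult.assoc)
  have Jt: "J (- a) a = - 2 * D"
  proof -
    have PLm: "PL (- m) = - 2 * \<i> * A / q + 2 * \<i> * B * q + 2 * \<i> / V * (C2 * y)"
      unfolding PLx ex ee by simp
    have PRm: "PR m = - 2 * A / p - 2 * B * p + 2 * \<i> / V * (C1 / y)"
      unfolding PRx ex ee ABp by (simp add: mult.assoc)
    have km: "2 * complex_of_real m = 4 * \<kappa>" by (simp add: m_def \<kappa>_def)
    have em: "e m / cE - e (- m) / cE = 2 * \<i> / V * (1 / y - y)"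
      unfolding e_def ee diff_divide_distrib[symmetric] cEV[symmetric] by simp
    have "J (- a) a = (PL (- m) - PR m + 4 * \<kappa> * D + 2 * \<i> / V * (1 / y - y)) - PL (- a) + PR a"
      unfolding J_def em km by (simp add: algebra_simps)
    also have "\<dots> = - 2 * D" unfolding PLm PRm E3 PLa PRa by simp
    finally show ?thesis .
  qed
  have sh: "e (t - 1) = e t * (x * y)" "e (t + 1) = e t / (x * y)" for t
    unfolding exy[symmetric] e_def by (simp_all add: exp_minus algebra_simps exp_add exp_diff inverse_eq_divide)
  have shA: "exp (\<i> / 2 * complex_of_real (t - 1)) = exp (\<i> / 2 * of_real t) / (p * q)"
      "exp (- (\<i> / 2) * complex_of_real (t - 1)) = exp (- (\<i> / 2) * of_real t) * (p * q)"
      "exp (\<i> / 2 * complex_of_real (t + 1)) = exp (\<i> / 2 * of_real t) * (p * q)"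
      "exp (- (\<i> / 2) * complex_of_real (t + 1)) = exp (- (\<i> / 2) * of_real t) / (p * q)" for t
    unfolding pq(1)[symmetric] by (simp_all add: algebra_simps exp_add exp_diff exp_minus inverse_eq_divide diff_divide_distrib add_divide_distrib)
  \<comment> \<open>For t > m the window integral reduces to - PL (t - 1). Matching coefficients
    gives AR and BR from A and B, while the equation in C1 and C2 settles the third exponential. A
    and B themselves remain free for E1 to E3.\<close>
  have eqR: "gR t - 1 / 2 * PL (t - 1) = e t" for t
  proof -
    have "gR t - 1 / 2 * PL (t - 1) - e t = (AR + \<i> * A / (p * q)) * exp (\<i> / 2 * of_real t)
       + (BR - \<i> * B * (p * q)) * exp (- (\<i> / 2) * of_real t) + (C1 - 1 - \<i> * C2 * (x * y) / V) * e t"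
      unfolding gR PLx shA e_def[symmetric] sh by (simp add: algebra_simps)
    also have "\<dots> = 0" unfolding R AB by simp
    finally show ?thesis by simp
  qed
  have eqL: "gL t + 1 / 2 * PR (t + 1) = e t" for t
  proof -
    have "gL t + 1 / 2 * PR (t + 1) - e t = (A - \<i> * (AR * (p * q))) * exp (\<i> / 2 * of_real t)
       + (B + \<i> * (BR / (p * q))) * exp (- (\<i> / 2) * of_real t) + (C2 - 1 + \<i> * C1 / (x * y) / V) * e t"
      unfolding gL PRx shA e_def[symmetric] sh by (simp add: algebra_simps)
    also have "\<dots> = 0" unfolding L AB using nz by simp
    finally show ?thesis by simp
  qed
  show "SO_solution \<Delta> w g"
    unfolding SO_solution_def
  proof (intro conjI ballI)
    show "\<exists>B. band (\<Delta> / 2) B g" using band unfolding a_def by blast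
    fix t assume "t \<in> {- \<Delta> / 2..\<Delta> / 2}"
    then have t: "- a \<le> t" "t \<le> a" by (auto simp: a_def)
    have et: "exp (- (2 * of_real pi * \<i> * cnj w * of_real t)) = e t" by (simp add: e_def cE_def)
    consider "- m \<le> t" "t \<le> m" | "m < t" | "t < - m" by linarith
    then show "g t + 1 / 2 * (LINT s:{t - 1..t + 1}|lborel. g s) = exp (- (2 * of_real pi * \<i> * cnj w * of_real t))"
    proof cases
      case 1
      have "(LINT s:{t - 1..t + 1}|lborel. g s) = J (- a) a"
        using 1 am by (intro band_window_has_integral[OF band int]) auto
      then show ?thesis unfolding et Jt ga[OF 1] by simp
    next
      case 2
      have "(LINT s:{t - 1..t + 1}|lborel. g s) = J (t - 1) a"
        using 2 am t by (intro band_window_has_integral[OF band int]) auto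
      also have "\<dots> = J (- a) a + PL (- a) - PL (t - 1)" by (simp add: J_def)
      finally have "(LINT s:{t - 1..t + 1}|lborel. g s) = - PL (t - 1)" unfolding Jt PLa by simp
      then show ?thesis unfolding et gb[OF 2 t(2)] using eqR[of t] by simp
    next
      case 3
      have "(LINT s:{t - 1..t + 1}|lborel. g s) = J (- a) (t + 1)"
        using 3 am t by (intro band_window_has_integral[OF band int]) auto
      also have "\<dots> = J (- a) a - PR a + PR (t + 1)" by (simp add: J_def)
      finally have "(LINT s:{t - 1..t + 1}|lborel. g s) = PR (t + 1)" unfolding Jt PRa by simp
      then show ?thesis unfolding et gc[OF t(1) 3] using eqL[of t] by simp
    qed
  qed
qed

text \<open>The density depends on w through cnj w, hence the conjugated coefficients. Its transform
  is a sum of elementary integrals: each of the first three terms of the formula joins a left and a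
  right outer piece, and the last two come from the middle.\<close>

lemma K_SO_large:
  assumes \<Delta>: "1 < \<Delta>" "\<Delta> \<le> 2" and gen: "gen2 w z"
  shows "K_SO \<Delta> w z = kform2 \<Delta> w z"
proof -
  define v where "v = cnj w"
  define p where "p = exp (of_real \<Delta> * \<i> / 4)"
  define q where "q = exp ((2 - of_real \<Delta>) * \<i> / 4)"
  define x where "x = exp (\<i> * of_real pi * of_real \<Delta> * cnj w)"
  define y where "y = exp (\<i> * of_real pi * (2 - of_real \<Delta>) * cnj w)"
  define V where "V = 4 * of_real pi * cnj w"
  define \<kappa> where "\<kappa> = (2 - complex_of_real \<Delta>) / 4"
  define A where "A = cnj (Af \<Delta> w)"
  define B where "B = cnj (Bf \<Delta> w)"
  define D where "D = cnj (Df \<Delta> w)"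
  define C1 where "C1 = Cf v"
  define C2 where "C2 = cnj (Cf w)"
  define F where "F = Ff \<Delta> v"
  define G where "G = Gf \<Delta> v"
  define Gs where "Gs = cnj (Gf \<Delta> w)"
  have w0: "w \<noteq> 0" and z0: "z \<noteq> 0" and zv: "z - v \<noteq> 0"
    and zp: "2 * of_real pi * \<i> * z + \<i> / 2 \<noteq> 0" and zm: "2 * of_real pi * \<i> * z - \<i> / 2 \<noteq> 0"
    and N: "1 - V\<^sup>2 \<noteq> 0"
    using gen by (auto simp: gen2_def Let_def v_def V_def power_mult_distrib)
  have nz: "p \<noteq> 0" "q \<noteq> 0" "x \<noteq> 0" "y \<noteq> 0" "V \<noteq> 0"
    using w0 by (simp_all add: p_def q_def x_def y_def V_def)
  \<comment> \<open>Conjugation inverts p and q, which have modulus 1, and turns X, Y into 1/x, 1/y.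
    So conjugated functions of w remain rational in the same variables.\<close>
  have cp: "cnj p = 1 / p" "cnj q = 1 / q"
    by (simp_all add: p_def q_def exp_cnj exp_minus inverse_eq_divide[symmetric] diff_divide_distrib algebra_simps flip: exp_minus)
  define X where "X = exp (\<i> * of_real pi * of_real \<Delta> * w)"
  define Y where "Y = exp (\<i> * of_real pi * (2 - of_real \<Delta>) * w)"
  define U where "U = 4 * of_real pi * w"
  have cX: "cnj X = 1 / x" "cnj Y = 1 / y" "cnj U = V"
    by (simp_all add: X_def Y_def U_def V_def x_def y_def exp_cnj exp_minus inverse_eq_divide[symmetric] flip: exp_minus)
  note fw = coefficient_functions_exp[where u = w and \<Delta> = \<Delta>, folded X_def Y_def U_def \<kappa>_def]
  have ck: "cnj \<kappa> = \<kappa>" by (simp add: \<kappa>_def)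
  have C1: "C1 = (- V\<^sup>2 - \<i> * V * (x * y)) / (1 - V\<^sup>2)"
    unfolding C1_def v_def using coefficient_functions_exp(1)[of "cnj w" \<Delta>] by (simp only: x_def y_def V_def)
  have C2: "C2 = (- V\<^sup>2 + \<i> * V / (x * y)) / (1 - V\<^sup>2)"
    unfolding C2_def fw(1)[folded X_def Y_def U_def] by (simp add: cX)
  have F: "F = ((y + 1 / y) + \<i> * V * (x - 1 / x)) / (1 - V\<^sup>2)"
    unfolding F_def v_def coefficient_functions_exp(2) by (simp only: x_def y_def V_def)
  have cF: "cnj (Ff \<Delta> w) = F"
    unfolding fw(2) F by (simp add: cX algebra_simps)
  have G: "G = ((x + 1 / x) + \<i> * V / x - y) / (1 - V\<^sup>2) - (y - 1 / y) / (\<i> * V * (1 - V\<^sup>2)) + \<kappa> * F"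
    unfolding G_def F_def v_def coefficient_functions_exp(3) by (simp only: x_def y_def V_def \<kappa>_def)
  have Gs: "Gs = ((x + 1 / x) - \<i> * V * x - 1 / y) / (1 - V\<^sup>2) - (y - 1 / y) / (\<i> * V * (1 - V\<^sup>2)) + \<kappa> * F"
  proof -
    have "Gs = ((1 / x + x) - \<i> * V * x - 1 / y) / (1 - V\<^sup>2) - (1 / y - y) / (- (\<i> * V) * (1 - V\<^sup>2)) + \<kappa> * F"
      unfolding Gs_def fw(3) by (simp add: cX ck cF)
    also have "(1 / y - y) / (- (\<i> * V) * (1 - V\<^sup>2)) = (y - 1 / y) / (\<i> * V * (1 - V\<^sup>2))"
      unfolding minus_mult_left[symmetric] divide_minus_right minus_divide_left[symmetric] by (simp only: minus_divide_left minus_diff_eq)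
    finally show ?thesis by (simp only: add.commute)
  qed
  have tau: "tauc \<Delta> = q + \<i> * p" by (simp add: tauc_def Let_def p_def q_def)
  have ac: "ac \<Delta> = p + \<i> * q - \<i> * p + \<kappa> * (q + \<i> * p)"
    unfolding tau[symmetric] by (simp add: ac_def Let_def p_def q_def \<kappa>_def)
  have bc: "bc \<Delta> = p + \<i> * q - q + \<kappa> * (q + \<i> * p)"
    unfolding tau[symmetric] by (simp add: bc_def Let_def p_def q_def \<kappa>_def)
  \<comment> \<open>Conjugating the system interchanges the arguments on the right: its first
    equation now carries cnj (G(w)), its second G(cnj w).\<close>
  have "cnj (ac \<Delta>) * A + ac \<Delta> * B = Gs"
    unfolding A_def B_def Gs_def Af_Bf_system(1)[OF \<Delta>, of w, symmetric] by simp
  then have L1: "(1 / p - \<i> / q + \<i> / p + \<kappa> * (1 / q - \<i> / p)) * A + (p + \<i> * q - \<i> * p + \<kappa> * (q + \<i> * p)) * B = Gs"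
    unfolding ac by (simp add: cp ck)
  have "cnj (bc \<Delta>) * A + bc \<Delta> * B = cnj (bc \<Delta> * Af \<Delta> w + cnj (bc \<Delta>) * Bf \<Delta> w)"
    unfolding A_def B_def by simp
  also have "\<dots> = G" unfolding Af_Bf_system(2)[OF \<Delta>] G_def v_def by simp
  finally have L2: "(1 / p - \<i> / q - 1 / q + \<kappa> * (1 / q - \<i> / p)) * A + (p + \<i> * q - q + \<kappa> * (q + \<i> * p)) * B = G"
    unfolding bc by (simp add: cp ck)
  have "2 * D = cnj (tauc \<Delta>) * A + tauc \<Delta> * B - F"
    unfolding D_def Df_def A_def B_def cF[symmetric] by simp
  then have L3: "2 * D = (1 / q - \<i> / p) * A + (q + \<i> * p) * B - F"
    unfolding tau by (simp add: cp)
  note ids = coefficient_identities[OF nz N C1 C2 F G Gs L1 L2 L3]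
  define a where "a = \<Delta> / 2"
  define m where "m = 1 - \<Delta> / 2"
  define gL where "gL = (\<lambda>t. A * exp (\<i> / 2 * of_real t) + B * exp (- (\<i> / 2) * of_real t) + C2 * exp (- (2 * of_real pi * \<i> * cnj w) * of_real t))"
  define AR where "AR = - \<i> * exp (- (\<i> / 2)) * A"
  define BR where "BR = \<i> * exp (\<i> / 2) * B"
  define gR where "gR = (\<lambda>t. AR * exp (\<i> / 2 * of_real t) + BR * exp (- (\<i> / 2) * of_real t) + C1 * exp (- (2 * of_real pi * \<i> * cnj w) * of_real t))"
  define g where "g = (\<lambda>t. if \<bar>t\<bar> \<le> m then D + exp (- (2 * of_real pi * \<i> * cnj w) * of_real t)
       else if m < t \<and> t \<le> a then gR t else if - a \<le> t \<and> t < - m then gL t else 0)"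
  note sol = SO_solution_piecewise[OF \<Delta> w0, of C1 C2 A B D, folded p_def q_def x_def y_def V_def \<kappa>_def, OF ids,
      folded AR_def BR_def a_def m_def]
  have "SO_solution \<Delta> w g" unfolding g_def gL_def gR_def by (rule sol(2))
  then have K: "K_SO \<Delta> w z = ft g z" using K_SO_eq_ft_solution[OF _ \<Delta>(2)] \<Delta> by simp
  have "\<exists>K. band a K g" unfolding g_def gL_def gR_def by (rule sol(1))
  then obtain K where band: "band a K g" by blast
  have am: "0 \<le> m" "m \<le> a" "0 \<le> a" "a = 1 - m" using \<Delta> by (auto simp: a_def m_def)
  define c1 where "c1 = 2 * of_real pi * \<i> * z + \<i> / 2"
  define c2 where "c2 = 2 * of_real pi * \<i> * z - \<i> / 2"
  define c3 where "c3 = 2 * of_real pi * \<i> * (z - v)"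
  define c4 where "c4 = 2 * of_real pi * \<i> * z"
  have c0: "c1 \<noteq> 0" "c2 \<noteq> 0" "c3 \<noteq> 0" "c4 \<noteq> 0" using zp zm zv z0 by (simp_all add: c1_def c2_def c3_def c4_def)
  let ?E = "\<lambda>t. fexp t z"
  have mult: "exp (\<i> / 2 * of_real t) * ?E t = exp (c1 * of_real t)" "exp (- (\<i> / 2) * of_real t) * ?E t = exp (c2 * of_real t)"
     "exp (- (2 * of_real pi * \<i> * cnj w) * of_real t) * ?E t = exp (c3 * of_real t)" "?E t = exp (c4 * of_real t)" for t
    by (simp_all add: c1_def c2_def c3_def c4_def v_def algebra_simps flip: exp_add)
  define T where "T k c lo hi = k * (exp (c * of_real hi) / c) - k * (exp (c * of_real lo) / c)" for k c :: complex and lo hi :: real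
  have iT: "((\<lambda>t. k * exp (c * of_real t)) has_integral T k c lo hi) {lo..hi}" if "c \<noteq> 0" "lo \<le> hi" for k c lo hi
    unfolding T_def by (rule exp_has_integral[OF that])
  have "((\<lambda>t. g t * ?E t) has_integral ((T A c1 (- a) (- m) + T B c2 (- a) (- m) + T C2 c3 (- a) (- m))
      + (T D c4 (- m) m + T 1 c3 (- m) m) + (T AR c1 m a + T BR c2 m a + T C1 c3 m a))) {- a..a}"
  proof (rule three_piece_has_integral)
    show "((\<lambda>t. A * exp (c1 * of_real t) + B * exp (c2 * of_real t) + C2 * exp (c3 * of_real t)) has_integral
       (T A c1 (- a) (- m) + T B c2 (- a) (- m) + T C2 c3 (- a) (- m))) {- a..- m}"
      using am by (intro has_integral_add iT c0) auto
    show "((\<lambda>t. D * exp (c4 * of_real t) + 1 * exp (c3 * of_real t)) has_integral (T D c4 (- m) m + T 1 c3 (- m) m)) {- m..m}"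
      using am by (intro has_integral_add iT c0) auto
    show "((\<lambda>t. AR * exp (c1 * of_real t) + BR * exp (c2 * of_real t) + C1 * exp (c3 * of_real t)) has_integral
       (T AR c1 m a + T BR c2 m a + T C1 c3 m a)) {m..a}"
      using am by (intro has_integral_add iT c0) auto
    show "g t * ?E t = A * exp (c1 * of_real t) + B * exp (c2 * of_real t) + C2 * exp (c3 * of_real t)" if "- a \<le> t" "t < - m" for t
    proof -
      have "g t = gL t" using that am by (auto simp: g_def)
      then show ?thesis unfolding mult(1-3)[symmetric] by (simp only: gL_def distrib_right mult.assoc)
    qed
    show "g t * ?E t = AR * exp (c1 * of_real t) + BR * exp (c2 * of_real t) + C1 * exp (c3 * of_real t)" if "m < t" "t \<le> a" for t
    proof -
      have "g t = gR t" using that am by (auto simp: g_def)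
      then show ?thesis unfolding mult(1-3)[symmetric] by (simp only: gR_def distrib_right mult.assoc)
    qed
    show "g t * ?E t = D * exp (c4 * of_real t) + 1 * exp (c3 * of_real t)" if "- m \<le> t" "t \<le> m" for t
    proof -
      have "g t = D + exp (- (2 * of_real pi * \<i> * cnj w) * of_real t)" using that by (auto simp: g_def)
      then show ?thesis unfolding mult(3,4)[symmetric] by (simp only: distrib_right mult_1_left)
    qed
  qed (use am in auto)
  then have ft: "ft g z = (T A c1 (- a) (- m) + T B c2 (- a) (- m) + T C2 c3 (- a) (- m))
      + (T D c4 (- m) m + T 1 c3 (- m) m) + (T AR c1 m a + T BR c2 m a + T C1 c3 m a)"
    by (rule ft_has_integral[OF band])
  \<comment> \<open>All boundary values are P, Q or their inverses, and a + m = 1 gives P c * Q c =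
    exp c.\<close>
  define P where "P c = exp (c * of_real a)" for c :: complex
  define Q where "Q c = exp (c * of_real m)" for c :: complex
  have PQ: "exp (c * of_real (- a)) = 1 / P c" "exp (c * of_real (- m)) = 1 / Q c" "P c \<noteq> 0" "Q c \<noteq> 0" "P c * Q c = exp c" for c
  proof -
    show "exp (c * of_real (- a)) = 1 / P c" "exp (c * of_real (- m)) = 1 / Q c" "P c \<noteq> 0" "Q c \<noteq> 0"
      by (simp_all add: P_def Q_def exp_minus inverse_eq_divide)
    have "P c * Q c = exp (c * of_real (a + m))" by (simp add: P_def Q_def algebra_simps flip: exp_add)
    then show "P c * Q c = exp c" using am by simp
  qed
  have t1: "T A c1 (- a) (- m) + T AR c1 m a = A * (\<i> * exp (2 * of_real pi * \<i> * z) - 1) * (1 / P c1 - 1 / Q c1) / c1"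
  proof -
    \<comment> \<open>The half-period factor in AR completes exp c1 to exp (2 pi i z), so the right
      outer piece becomes a multiple of the left one. The term with \<open>c2\<close> works in the
      same way.\<close>
    have "exp (- (\<i> / 2)) * (P c1 * Q c1) = exp (2 * of_real pi * \<i> * z)"
      unfolding PQ by (simp add: c1_def flip: exp_add)
    then have "\<i> * exp (2 * of_real pi * \<i> * z) * (1 / P c1 - 1 / Q c1) = \<i> * exp (- (\<i> / 2)) * (Q c1 - P c1)"
      using PQ(3,4)[of c1] by (simp add: field_simps)
    then have "A * (\<i> * exp (2 * of_real pi * \<i> * z) - 1) * (1 / P c1 - 1 / Q c1) / c1
        = A * (\<i> * exp (- (\<i> / 2)) * (Q c1 - P c1) - (1 / P c1 - 1 / Q c1)) / c1"
      by (simp only: mult.assoc left_diff_distrib mult_1_left)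
    also have "\<dots> = T A c1 (- a) (- m) + T AR c1 m a"
      unfolding T_def PQ(1,2) P_def[symmetric] Q_def[symmetric] AR_def by (simp add: algebra_simps diff_divide_distrib add_divide_distrib)
    finally show ?thesis by simp
  qed
  have t2: "T B c2 (- a) (- m) + T BR c2 m a = B * (- \<i> * exp (2 * of_real pi * \<i> * z) - 1) * (1 / P c2 - 1 / Q c2) / c2"
  proof -
    have "exp (\<i> / 2) * (P c2 * Q c2) = exp (2 * of_real pi * \<i> * z)"
      unfolding PQ by (simp add: c2_def flip: exp_add)
    then have "- \<i> * exp (2 * of_real pi * \<i> * z) * (1 / P c2 - 1 / Q c2) = - \<i> * exp (\<i> / 2) * (Q c2 - P c2)"
      using PQ(3,4)[of c2] by (simp add: field_simps)
    then have "B * (- \<i> * exp (2 * of_real pi * \<i> * z) - 1) * (1 / P c2 - 1 / Q c2) / c2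
        = B * (- \<i> * exp (\<i> / 2) * (Q c2 - P c2) - (1 / P c2 - 1 / Q c2)) / c2"
      by (simp only: mult.assoc left_diff_distrib mult_1_left)
    also have "\<dots> = T B c2 (- a) (- m) + T BR c2 m a"
      unfolding T_def PQ(1,2) P_def[symmetric] Q_def[symmetric] BR_def by (simp add: algebra_simps diff_divide_distrib add_divide_distrib)
    finally show ?thesis by simp
  qed
  have t3: "T C2 c3 (- a) (- m) + T C1 c3 m a = (C1 * (P c3 - Q c3) + C2 * (- (1 / P c3) + 1 / Q c3)) / c3"
    unfolding T_def PQ(1,2) P_def[symmetric] Q_def[symmetric] by (simp add: algebra_simps diff_divide_distrib add_divide_distrib)
  have sin: "(Q c - 1 / Q c) / c = sin (of_real pi * (2 - of_real \<Delta>) * u) / (of_real pi * u)" if "c = 2 * of_real pi * \<i> * u" for c u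
  proof -
    have "Q c = exp (\<i> * (of_real pi * (2 - of_real \<Delta>) * u))"
      unfolding Q_def that by (simp add: m_def algebra_simps)
    then have "Q c - 1 / Q c = 2 * \<i> * sin (of_real pi * (2 - of_real \<Delta>) * u)"
      by (simp add: sin_exp_eq exp_minus inverse_eq_divide)
    then show ?thesis unfolding that by (simp add: mult_ac)
  qed
  have t4: "T D c4 (- m) m = D * sin (of_real pi * (2 - of_real \<Delta>) * z) / (of_real pi * z)"
  proof -
    have "T D c4 (- m) m = D * ((Q c4 - 1 / Q c4) / c4)"
      unfolding T_def PQ(1,2) Q_def[symmetric] by (simp add: algebra_simps diff_divide_distrib)
    then show ?thesis unfolding sin[OF c4_def] by simp
  qed
  have t5: "T 1 c3 (- m) m = sin (of_real pi * (2 - of_real \<Delta>) * (z - v)) / (of_real pi * (z - v))"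
  proof -
    have "T 1 c3 (- m) m = (Q c3 - 1 / Q c3) / c3"
      unfolding T_def PQ(1,2) Q_def[symmetric] by (simp add: diff_divide_distrib)
    then show ?thesis unfolding sin[OF c3_def] .
  qed
  have eP: "exp (- of_real \<Delta> * (of_real pi * \<i> * z + \<i> / 4)) = 1 / P c1" "exp (- of_real \<Delta> * (of_real pi * \<i> * z - \<i> / 4)) = 1 / P c2"
     "exp (- (2 - of_real \<Delta>) * (of_real pi * \<i> * z + \<i> / 4)) = 1 / Q c1" "exp (- (2 - of_real \<Delta>) * (of_real pi * \<i> * z - \<i> / 4)) = 1 / Q c2"
     "exp (of_real pi * of_real \<Delta> * \<i> * (z - v)) = P c3" "exp (of_real pi * (2 - of_real \<Delta>) * \<i> * (z - v)) = Q c3"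
     "exp (- of_real pi * of_real \<Delta> * \<i> * (z - v)) = 1 / P c3" "exp (- of_real pi * (2 - of_real \<Delta>) * \<i> * (z - v)) = 1 / Q c3"
    unfolding PQ(1,2)[symmetric] unfolding P_def Q_def a_def m_def c1_def c2_def c3_def
    by (intro arg_cong[of _ _ exp]; simp add: algebra_simps add_divide_distrib diff_divide_distrib)+
  have "kform2 \<Delta> w z = (T A c1 (- a) (- m) + T AR c1 m a) + (T B c2 (- a) (- m) + T BR c2 m a)
     + (T C2 c3 (- a) (- m) + T C1 c3 m a) + T D c4 (- m) m + T 1 c3 (- m) m"
    unfolding kform2_def Let_def v_def[symmetric] A_def[symmetric] B_def[symmetric] C1_def[symmetric] C2_def[symmetric] D_def[symmetric]
      t1 t2 t3 t4 t5 eP c1_def[symmetric] c2_def[symmetric] c3_def[symmetric] ..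
  then show ?thesis unfolding K ft by simp
qed

theorem theorem5:
  fixes \<Delta> :: real
  shows "(0 < \<Delta> \<and> \<Delta> \<le> 1 \<longrightarrow>
            (\<forall>w z. gen1 w z \<longrightarrow> K_SO \<Delta> w z = kform1 \<Delta> w z) \<and>
            (\<forall>w z. ((\<lambda>q. kform1 \<Delta> (fst q) (snd q)) \<longlongrightarrow> K_SO \<Delta> w z)
                     (at (w, z) within {q. gen1 (fst q) (snd q)})))
       \<and> (1 < \<Delta> \<and> \<Delta> \<le> 2 \<longrightarrow>
            (\<forall>w z. gen2 w z \<longrightarrow> K_SO \<Delta> w z = kform2 \<Delta> w z) \<and>
            (\<forall>w z. ((\<lambda>q. kform2 \<Delta> (fst q) (snd q)) \<longlongrightarrow> K_SO \<Delta> w z)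
                     (at (w, z) within {q. gen2 (fst q) (snd q)})))"
proof (intro conjI impI allI)
  fix w z
  assume "0 < \<Delta> \<and> \<Delta> \<le> 1"
  then have \<Delta>: "0 < \<Delta>" "\<Delta> \<le> 1" by auto
  show "gen1 w z \<Longrightarrow> K_SO \<Delta> w z = kform1 \<Delta> w z" by (rule K_SO_small[OF \<Delta>])
  \<comment> \<open>On generic points the formula is the kernel itself, so its limits at removable
    singularities are values of a continuous function.\<close>
  have "((\<lambda>q. K_SO \<Delta> (fst q) (snd q)) \<longlongrightarrow> K_SO \<Delta> w z) (at (w, z) within {q. gen1 (fst q) (snd q)})"
    using \<Delta> by (intro continuous_K_SO) auto
  then show "((\<lambda>q. kform1 \<Delta> (fst q) (snd q)) \<longlongrightarrow> K_SO \<Delta> w z) (at (w, z) within {q. gen1 (fst q) (snd q)})"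
    by (rule Lim_transform_eventually) (auto simp: eventually_at_filter K_SO_small[OF \<Delta>])
next
  fix w z
  assume "1 < \<Delta> \<and> \<Delta> \<le> 2"
  then have \<Delta>: "1 < \<Delta>" "\<Delta> \<le> 2" by auto
  show "gen2 w z \<Longrightarrow> K_SO \<Delta> w z = kform2 \<Delta> w z" by (rule K_SO_large[OF \<Delta>])
  have "((\<lambda>q. K_SO \<Delta> (fst q) (snd q)) \<longlongrightarrow> K_SO \<Delta> w z) (at (w, z) within {q. gen2 (fst q) (snd q)})"
    using \<Delta> by (intro continuous_K_SO) auto
  then show "((\<lambda>q. kform2 \<Delta> (fst q) (snd q)) \<longlongrightarrow> K_SO \<Delta> w z) (at (w, z) within {q. gen2 (fst q) (snd q)})"
    by (rule Lim_transform_eventually) (auto simp: eventually_at_filter K_SO_large[OF \<Delta>])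
qed

end
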